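(* Let $\Psi_2(x_1,x_2,\mathbf{q},u)$ be the generating series for cycle factorizations of permutations with two cycles, $$\Psi_2(x_1,x_2,\mathbf{q},u)=\sum_{n\ge 1}\ \sum_{\mathbf{i}\ge\mathbf{0}}\ \sum_{\substack{\alpha=(\alpha_1,\alpha_2)\\ \alpha_1,\alpha_2\ge 1,\ \alpha_1+\alpha_2=n}} H_\alpha(\mathbf{i})\,\mathbf{q}^{\mathbf{i}}\,\frac{x_1^{\alpha_1}}{\alpha_1}\frac{x_2^{\alpha_2}}{\alpha_2}\,\frac{u^{r(\mathbf{i})}}{r(\mathbf{i})!}.$$ Let $Q(z)=\sum_{k\ge 2}q_k z^{k-1}$, let $w=w(x,\mathbf{q},u)\in\mathbb{Q}[\mathbf{q},u][[x]]$ be the unique solution of $w=x\,e^{uQ(w)}$, and set $w_i=w(x_i,\mathbf{q},u)$ for $i=1,2$. Then $$\Psi_2(x_1,x_2,\mathbf{q},u)=\log\left(\frac{w_1-w_2}{x_1-x_2}\right)-u\,\frac{w_1Q(w_1)-w_2Q(w_2)}{w_1-w_2}$$ as formal power series.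
   Context: A transitive factorization of $\pi\in S_n$ is a tuple $F=(\sigma_r,\ldots,\sigma_1)$ of permutations in $S_n$ such that $\pi=\sigma_r\cdots\sigma_1$ and the group $\langle\sigma_1,\ldots,\sigma_r\rangle$ acts transitively on $\{1,\ldots,n\}$. If $\ell(\sigma)$ denotes the number of cycles (including fixed points) of a permutation $\sigma\in S_n$, then any transitive factorization satisfies $nr-\sum_{i=1}^r\ell(\sigma_i)\ge n+\ell(\pi)-2$; $F$ is minimal transitive if equality holds. A $k$-cycle in $S_n$ is a permutation with one cycle of length $k$ and $n-k$ fixed points. A cycle factorization is a minimal transitive factorization all of whose factors are cycles of length at least two (that is, $k$-cycles with $k\ge2$). For a composition $\alpha=(\alpha_1,\ldots,\alpha_m)$ of $n$ (a sequence of positive integers with sum $n$) and a sequence $\mathbf{i}=(i_2,i_3,\ldots)$ of nonnegative integers, finitely many of them nonzero (the cycle index), $H_\alpha(\mathbf{i})$ denotes the number of cycle factorizations of any fixed permutation $\pi\in S_n$ with cycle lengths $\alpha_1,\ldots,\alpha_m$ into exactly $i_2$ 2-cycles, $i_3$ 3-cycles, etc. (in any order); this is independent of the choice of $\pi$. Here $\mathbf{q}=(q_2,q_3,\ldots)$ are indeterminates, $\mathbf{q}^{\mathbf{i}}=\prod_{k\ge2}q_k^{i_k}$, and $r(\mathbf{i})=i_2+i_3+\cdots$ is the number of factors. *)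

theory Defs
  imports
    "HOL-Algebra.Sym_Groups"
    "HOL-Combinatorics.Orbits"
    "HOL-Library.Multiset"
    "HOL-Library.Poly_Mapping"
    "HOL-Computational_Algebra.Polynomial"
    "HOL-Computational_Algebra.Formal_Power_Series"
begin

section \<open>Cycle factorizations\<close>

text \<open>The symmetric group on n letters consists of the functions that permute \<open>{1..n}\<close>. The orbits
  of single points under a permutation are the supports of its cycles, fixed points included.\<close>

definition cycle_type :: "nat \<Rightarrow> (nat \<Rightarrow> nat) \<Rightarrow> nat multiset" where
  "cycle_type n \<sigma> = image_mset card (mset_set (orbit \<sigma> ` {1..n}))"

definition num_cycles :: "nat \<Rightarrow> (nat \<Rightarrow> nat) \<Rightarrow> nat" where
  "num_cycles n \<sigma> = size (cycle_type n \<sigma>)"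

definition is_k_cycle :: "nat \<Rightarrow> nat \<Rightarrow> (nat \<Rightarrow> nat) \<Rightarrow> bool" where
  "is_k_cycle n k \<sigma> \<longleftrightarrow>
     \<sigma> permutes {1..n} \<and> cycle_type n \<sigma> = add_mset k (replicate_mset (n - k) 1)"

text \<open>A tuple \<open>(\<sigma>\<^sub>r, \<dots>, \<sigma>\<^sub>1)\<close> is the list with head \<open>\<sigma>\<^sub>r\<close>, so its product, the leftmost
  factor being applied last, is \<open>foldr (\<circ>) F id\<close>.\<close>

definition transitive_factorization ::
    "nat \<Rightarrow> (nat \<Rightarrow> nat) \<Rightarrow> (nat \<Rightarrow> nat) list \<Rightarrow> bool" where
  "transitive_factorization n \<pi> F \<longleftrightarrow>
     (\<forall>\<sigma>\<in>set F. \<sigma> permutes {1..n}) \<and>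
     \<pi> = foldr (\<circ>) F id \<and>
     (\<forall>a\<in>{1..n}. \<forall>b\<in>{1..n}. \<exists>g\<in>generate (sym_group n) (set F). g a = b)"

definition minimal_transitive ::
    "nat \<Rightarrow> (nat \<Rightarrow> nat) \<Rightarrow> (nat \<Rightarrow> nat) list \<Rightarrow> bool" where
  "minimal_transitive n \<pi> F \<longleftrightarrow>
     transitive_factorization n \<pi> F \<and>
     int n * int (length F) - (\<Sum>\<sigma>\<leftarrow>F. int (num_cycles n \<sigma>)) = int n + int (num_cycles n \<pi>) - 2"

definition cycle_factorization ::
    "nat \<Rightarrow> (nat \<Rightarrow> nat) \<Rightarrow> (nat \<Rightarrow> nat) list \<Rightarrow> bool" where
  "cycle_factorization n \<pi> F \<longleftrightarrow>
     minimal_transitive n \<pi> F \<and> (\<forall>\<sigma>\<in>set F. \<exists>k\<ge>2. is_k_cycle n k \<sigma>)"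

text \<open>A cycle index \<open>(i\<^sub>2, i\<^sub>3, \<dots>)\<close> is a finitely supported function on the naturals vanishing
  at 0 and 1.\<close>

definition is_cycle_index :: "(nat \<Rightarrow>\<^sub>0 nat) \<Rightarrow> bool" where
  "is_cycle_index i \<longleftrightarrow> Poly_Mapping.keys i \<subseteq> {2..}"

definition num_factors :: "(nat \<Rightarrow>\<^sub>0 nat) \<Rightarrow> nat" where
  "num_factors i = (\<Sum>k\<in>Poly_Mapping.keys i. Poly_Mapping.lookup i k)"

definition cycle_factorizations_of ::
    "nat \<Rightarrow> (nat \<Rightarrow> nat) \<Rightarrow> (nat \<Rightarrow>\<^sub>0 nat) \<Rightarrow> (nat \<Rightarrow> nat) list set" where
  "cycle_factorizations_of n \<pi> i =
     {F. cycle_factorization n \<pi> F \<and>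
         (\<forall>k\<ge>2. length (filter (is_k_cycle n k) F) = Poly_Mapping.lookup i k)}"

text \<open>The count depends only on the cycle type of the target permutation (conjugation), so one
  of the given type is chosen.\<close>

definition H :: "nat list \<Rightarrow> (nat \<Rightarrow>\<^sub>0 nat) \<Rightarrow> nat" where
  "H \<alpha> i =
     card (cycle_factorizations_of (sum_list \<alpha>)
       (SOME \<pi>. \<pi> permutes {1..sum_list \<alpha>} \<and> cycle_type (sum_list \<alpha>) \<pi> = mset \<alpha>) i)"


section \<open>Formal power series\<close>

unbundle fps_syntax

text \<open>\<open>coeff_ring\<close> is \<open>\<rat>[\<^bold>q][u]\<close>: the exponents of a monomial in \<open>\<^bold>q\<close> form a finitely supported
  function of the index, and \<open>u\<close> is the variable of the outer type \<open>poly\<close>. The two unused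
  variables \<open>q\<^sub>0\<close> and \<open>q\<^sub>1\<close> are harmless. In \<open>series2\<close>, which is \<open>\<rat>[\<^bold>q,u][[x\<^sub>1]][[x\<^sub>2]]\<close>, the coefficient of
  \<open>x\<^sub>1\<^sup>a x\<^sub>2\<^sup>b\<close> in \<open>S\<close> is \<open>S $ b $ a\<close>.\<close>

type_synonym coeff_ring = "((nat \<Rightarrow>\<^sub>0 nat) \<Rightarrow>\<^sub>0 rat) poly"
type_synonym series1 = "coeff_ring fps"
type_synonym series2 = "coeff_ring fps fps"

definition scalar :: "rat \<Rightarrow> coeff_ring" where
  "scalar c = [:Poly_Mapping.single 0 c:]"

definition qvar :: "nat \<Rightarrow> coeff_ring" where
  "qvar k = [:Poly_Mapping.single (Poly_Mapping.single k 1) 1:]"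

definition uvar :: coeff_ring where
  "uvar = [:0, 1:]"

definition qmonom :: "(nat \<Rightarrow>\<^sub>0 nat) \<Rightarrow> coeff_ring" where
  "qmonom i = (\<Prod>k\<in>Poly_Mapping.keys i. qvar k ^ Poly_Mapping.lookup i k)"

text \<open>Only finitely many cycle indices contribute to a given coefficient, see
  \<open>finite_H_support\<close> below.\<close>

definition Psi2 :: series2 where
  "Psi2 = Abs_fps (\<lambda>b. Abs_fps (\<lambda>a.
     if 1 \<le> a \<and> 1 \<le> b
     then Sum_any (\<lambda>i. if is_cycle_index i
            then scalar (of_nat (H [a, b] i) / (of_nat a * of_nat b * fact (num_factors i)))
                 * qmonom i * uvar ^ num_factors i
            else 0)
     else 0))"

definition Qser :: series1 where
  "Qser = Abs_fps (\<lambda>m. if 1 \<le> m then qvar (m + 1) else 0)"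

text \<open>The library's \<open>fps_exp\<close> needs a field of coefficients.\<close>

definition exp_ser :: series1 where
  "exp_ser = Abs_fps (\<lambda>m. scalar (1 / fact m))"

text \<open>The equation forces \<open>w\<close> to have constant term 0; hence both compositions are
  genuine substitutions.\<close>

definition tree_equation :: "series1 \<Rightarrow> bool" where
  "tree_equation w \<longleftrightarrow> w = fps_X * (exp_ser oo (fps_const uvar * (Qser oo w)))"

text \<open>\<open>at_x1 f\<close> and \<open>at_x2 f\<close> are \<open>f(x\<^sub>1)\<close> and \<open>f(x\<^sub>2)\<close>.\<close>

definition at_x1 :: "series1 \<Rightarrow> series2" where
  "at_x1 f = fps_const f"

definition at_x2 :: "series1 \<Rightarrow> series2" where
  "at_x2 f = Abs_fps (\<lambda>b. fps_const (f $ b))"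

abbreviation x1 :: series2 where "x1 \<equiv> at_x1 fps_X"
abbreviation x2 :: series2 where "x2 \<equiv> at_x2 fps_X"
abbreviation u2 :: series2 where "u2 \<equiv> fps_const (fps_const uvar)"

text \<open>Exact quotient in an integral domain.\<close>

definition exact_quot :: "'a::idom \<Rightarrow> 'a \<Rightarrow> 'a" where
  "exact_quot f g = (THE h. f = g * h)"

text \<open>\<open>log S = \<Sum>\<^sub>m (-1)\<^sup>m\<^sup>+\<^sup>1 (S - 1)\<^sup>m / m\<close> for \<open>S\<close> with constant term 1. Then \<open>(S - 1)\<^sup>m\<close>
  has no terms of total degree below \<open>m\<close>, so the coefficient at \<open>x\<^sub>1\<^sup>a x\<^sub>2\<^sup>b\<close> only involves
  \<open>m \<le> a + b\<close>. Composition \<open>oo\<close> does not apply here, as \<open>S - 1\<close> may have nonzero terms free of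
  \<open>x\<^sub>2\<close>.\<close>

definition series_log :: "series2 \<Rightarrow> series2" where
  "series_log S = Abs_fps (\<lambda>b. Abs_fps (\<lambda>a.
     \<Sum>m=1..a+b. scalar ((-1) ^ (m + 1) / of_nat m) * (((S - 1) ^ m) $ b $ a)))"


section \<open>Finiteness of the sums over cycle indices\<close>

lemma orbit_subset: "\<sigma> permutes A \<Longrightarrow> a \<in> A \<Longrightarrow> orbit \<sigma> a \<subseteq> A"
proof
  fix y assume "\<sigma> permutes A" "a \<in> A" "y \<in> orbit \<sigma> a"
  from this(3,1,2) show "y \<in> A"
    by induction (auto simp: permutes_in_image)
qed

lemma is_k_cycle_le:
  assumes "is_k_cycle n k \<sigma>"
  shows "k \<le> n"
proof -
  have "k \<in># cycle_type n \<sigma>" and p: "\<sigma> permutes {1..n}"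
    using assms by (auto simp: is_k_cycle_def)
  then obtain a where "a \<in> {1..n}" "k = card (orbit \<sigma> a)"
    by (auto simp: cycle_type_def)
  with orbit_subset[OF p] show ?thesis
    using card_mono[of "{1..n}" "orbit \<sigma> a"] by fastforce
qed

lemma num_cycles_le: "num_cycles n \<sigma> \<le> n"
  using card_image_le[of "{1..n}" "orbit \<sigma>"] by (simp add: num_cycles_def cycle_type_def)

lemma cycle_factorization_length:
  assumes "cycle_factorization n \<pi> F"
  shows "length F \<le> 2 * n"
proof -
  have c: "num_cycles n \<sigma> < n" if \<sigma>: "\<sigma> \<in> set F" for \<sigma>
  proof -
    obtain k where "k \<ge> 2" "is_k_cycle n k \<sigma>"
      using assms \<sigma> by (auto simp: cycle_factorization_def)
    with is_k_cycle_le[OF this(2)] show ?thesis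
      by (simp add: is_k_cycle_def num_cycles_def)
  qed
  have "(\<Sum>\<sigma>\<leftarrow>F. int (num_cycles n \<sigma>)) \<le> (\<Sum>\<sigma>\<leftarrow>F. int n - 1)"
    by (rule sum_list_mono) (use c in fastforce)
  also have "\<dots> = int n * int (length F) - int (length F)"
    by (simp add: sum_list_triv algebra_simps)
  finally show ?thesis
    using assms num_cycles_le[of n \<pi>]
    by (simp add: cycle_factorization_def minimal_transitive_def)
qed

lemma finite_H_support: "finite {i. is_cycle_index i \<and> H \<alpha> i \<noteq> 0}"
proof -
  define n where "n = sum_list \<alpha>"
  define T where "T = {f :: nat \<Rightarrow> nat. \<forall>k. (k \<in> {..n} \<longrightarrow> f k \<in> {..2*n}) \<and> (k \<notin> {..n} \<longrightarrow> f k = 0)}"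
  have "finite T"
    unfolding T_def by (rule finite_set_of_finite_funs) auto
  moreover have "Poly_Mapping.lookup i \<in> T" if i: "is_cycle_index i" "H \<alpha> i \<noteq> 0" for i
  proof -
    obtain \<pi> where "cycle_factorizations_of n \<pi> i \<noteq> {}"
      using i(2) unfolding H_def n_def by (metis card.empty)
    then obtain F where F: "cycle_factorization n \<pi> F"
      "\<And>k. k \<ge> 2 \<Longrightarrow> length (filter (is_k_cycle n k) F) = Poly_Mapping.lookup i k"
      by (auto simp: cycle_factorizations_of_def)
    have small: "Poly_Mapping.lookup i k = 0" if "k < 2" for k
      using i(1) that by (force simp: is_cycle_index_def in_keys_iff)
    have "Poly_Mapping.lookup i k \<le> 2 * n" for k
      using small[of k] F(2)[of k] cycle_factorization_length[OF F(1)]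
        length_filter_le[of "is_k_cycle n k" F] by (cases "k < 2") auto
    moreover have "Poly_Mapping.lookup i k = 0" if "k > n" for k
    proof (cases "k < 2")
      case False
      then show ?thesis
        using F(2)[of k] is_k_cycle_le[of n k] that
        by (metis (no_types, lifting) filter_False leD list.size(3) not_le)
    qed (rule small)
    ultimately show ?thesis by (auto simp: T_def)
  qed
  ultimately have "finite (Poly_Mapping.lookup ` {i. is_cycle_index i \<and> H \<alpha> i \<noteq> 0})"
    by (auto intro: finite_subset)
  then show ?thesis
    by (rule finite_imageD) (auto simp: inj_on_def Poly_Mapping.lookup_inject)
qed

end

theory Submission
  imports Defs
begin

text \<open>Remove the last factor, a \<open>k\<close>-cycle \<open>\<sigma>\<close>, from a minimal transitive factorization of \<open>\<pi>\<close>. By a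
  Riemann--Hurwitz count, the remaining factors form minimal transitive factorizations on blocks each
  of which contains exactly one orbit of \<open>\<sigma>\<inverse>\<pi>\<close> meeting the support of \<open>\<sigma>\<close>. If \<open>\<pi>\<close> has one cycle, this
  forces \<open>\<sigma>\<close> to be the first-return map of \<open>\<pi>\<close> to its support, and the blocks are the arcs cut out on the
  cycle. If \<open>\<pi>\<close> has two cycles, either \<open>\<sigma>\<close> is the first-return map to a subset of one cycle and the other
  cycle is attached to one of the arcs, or \<open>\<sigma>\<close> is a product of first-return maps on both cycles with a
  transposition that joins two arcs. Since the exponential series in \<open>u\<close> of a disjoint union of blocks is
  the product over the blocks, this reads, with \<open>Q\<^sub>i = Q(w\<^sub>i)\<close> and \<open>D\<^sub>i = x\<^sub>i \<partial>/\<partial>x\<^sub>i\<close>,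
  \<open>\<partial>\<^sub>u w = Q(w) D w\<close> and
  \<open>\<partial>\<^sub>u \<Psi>\<^sub>2 = Q\<^sub>1 D\<^sub>1\<Psi>\<^sub>2 + Q\<^sub>2 D\<^sub>2\<Psi>\<^sub>2 + (Q\<^sub>1 - Q\<^sub>2)/(w\<^sub>1 - w\<^sub>2) \<cdot> (x\<^sub>2w\<^sub>1 - x\<^sub>1w\<^sub>2)/(x\<^sub>1 - x\<^sub>2)\<close>.
  The closed form satisfies the same equation, because \<open>\<partial>\<^sub>u - Q\<^sub>1D\<^sub>1 - Q\<^sub>2D\<^sub>2\<close> annihilates \<open>w\<^sub>1\<close> and \<open>w\<^sub>2\<close>, and
  both sides vanish at \<open>u = 0\<close>.\<close>

section \<open>Effect of a transposition or of a cycle on the orbits of a permutation\<close>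

section \<open>Orbits of permutations\<close>

text \<open>Transitivity is lost when a factor is removed, so the recursion runs over arbitrary
  partitions into blocks, and transitivity becomes the case of a single block. Minimality has to
  become local as well: twice the total genus of the blocks is a sum of nonnegative contributions,
  one per factor, so it vanishes exactly when every factor satisfies two equalities, one about
  merged blocks and one about cycles. These equalities make the possible last factors classifiable.
  Blocks with at most two cycles form a class closed under removal, so no data on three or more
  cycles enters. Unrooted first-return maps are counted through rooted ones. The division by the
  length k that this requires is avoided by the identity D(w^k) = k w^(k-1) Dw. The logarithm cannot
  be handled by the chain rule for composition; it is differentiated on truncations, and the total
  degree controls the error. Finally, cycle lengths are positive, so the closed form must also be
  shown to have no terms with a zero exponent.\<close>

abbreviation tau :: "'a \<Rightarrow> 'a \<Rightarrow> 'a \<Rightarrow> 'a" where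
  "tau \<equiv> Transposition.transpose"

lemma in_orbit_iff:
  assumes "permutation p"
  shows "y \<in> orbit p x \<longleftrightarrow> orbit p y = orbit p x"
  by (metis assms cyclic_on_orbit' orbit_cyclic_eq3 permutation_self_in_orbit)

lemma orbit_disjoint:
  assumes "permutation p" "orbit p x \<noteq> orbit p y"
  shows "orbit p x \<inter> orbit p y = {}"
  using assms in_orbit_iff by (metis disjoint_iff)

lemma orbit_subset_closed:
  assumes "x \<in> U" "\<And>y. y \<in> U \<Longrightarrow> p y \<in> U"
  shows "orbit p x \<subseteq> U"
proof
  fix y assume "y \<in> orbit p x"
  then show "y \<in> U" by induction (use assms in auto)
qed

lemma permutation_comp_permutes:
  assumes "permutation p" "\<sigma> permutes A" "finite A"
  shows "permutation (\<sigma> \<circ> p)"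
  using assms by (meson permutation_compose permutation_permutes)

text \<open>\<open>\<sigma>\<close> moves only points of \<open>A\<close>, so it leaves the
  trajectory of \<open>p\<close> unchanged until that trajectory first enters \<open>A\<close>, and
  acts there once. The later computations with first-return maps rest on this.\<close>

lemma funpow_follow:
  fixes p :: "'a \<Rightarrow> 'a"
  assumes \<sigma>: "\<sigma> permutes A" and out: "\<And>i. 0 < i \<Longrightarrow> i < j \<Longrightarrow> (p ^^ i) x \<notin> A"
  shows "i < j \<Longrightarrow> ((\<sigma> \<circ> p) ^^ i) x = (p ^^ i) x"
    and "0 < j \<Longrightarrow> ((\<sigma> \<circ> p) ^^ j) x = \<sigma> ((p ^^ j) x)"
proof -
  show *: "((\<sigma> \<circ> p) ^^ i) x = (p ^^ i) x" if "i < j" for i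
    using that
  proof (induction i)
    case (Suc i)
    then have "(p ^^ Suc i) x \<notin> A" using out by blast
    then have "\<sigma> (p ((p ^^ i) x)) = p ((p ^^ i) x)" using permutes_not_in[OF \<sigma>] by simp
    then show ?case using Suc by (simp add: funpow.simps(2))
  qed simp
  assume "0 < j"
  then obtain i where "j = Suc i" by (cases j) auto
  then show "((\<sigma> \<circ> p) ^^ j) x = \<sigma> ((p ^^ j) x)" using *[of i] by (simp add: funpow.simps(2))
qed

lemma orbit_comp_disjoint:
  assumes "permutation p" "\<sigma> permutes A" "orbit p x \<inter> A = {}"
  shows "orbit (\<sigma> \<circ> p) x = orbit p x"
proof (rule orbit_cong)
  show "x \<in> orbit p x" by (rule permutation_self_in_orbit[OF assms(1)])
  show "(\<sigma> \<circ> p) s = p s" if "s \<in> orbit p x" for s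
    using that assms(2,3) orbit.step[OF that] permutes_not_in by fastforce
qed

text \<open>Let \<open>N\<close> be the first return time of \<open>p\<close> to \<open>a\<close>.
  The trajectory avoids \<open>b\<close> and comes back to \<open>a\<close> only at time
  \<open>N\<close>, where the transposition redirects it to \<open>b\<close>.\<close>

lemma orbit_transp_join_mem:
  assumes "permutation p" "b \<notin> orbit p a"
  shows "b \<in> orbit (tau a b \<circ> p) a" "orbit p a \<subseteq> orbit (tau a b \<circ> p) a"
proof -
  have a: "a \<in> orbit p a" by (rule permutation_self_in_orbit[OF assms(1)])
  define N where "N = funpow_dist1 p a a"
  have N: "(p ^^ N) a = a" "0 < N" and orb: "orbit p a = (\<lambda>n. (p ^^ n) a) ` {0..<N}"
    using funpow_dist1_prop[OF a] orbit_conv_funpow_dist1[OF a] by (simp_all add: N_def)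
  have out: "(p ^^ i) a \<notin> {a, b}" if "0 < i" "i < N" for i
    using that funpow_dist1_least[of i p a a] assms(2) a
    by (auto simp: N_def funpow_in_orbit)
  have perm: "tau a b permutes {a, b}" by (rule permutes_swap_id) auto
  note f = funpow_follow[OF perm out]
  have pq: "permutation (tau a b \<circ> p)"
    by (rule permutation_comp_permutes[OF assms(1) perm]) simp
  have "((tau a b \<circ> p) ^^ N) a = b"
    using f(2) N by simp
  then show "b \<in> orbit (tau a b \<circ> p) a"
    using N(2) unfolding orbit_altdef by (metis (mono_tags, lifting) mem_Collect_eq)
  show "orbit p a \<subseteq> orbit (tau a b \<circ> p) a"
  proof
    fix y assume "y \<in> orbit p a"
    then obtain n where "n < N" "y = (p ^^ n) a" unfolding orb by auto
    then have "y = ((tau a b \<circ> p) ^^ n) a" using f(1) by simp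
    then show "y \<in> orbit (tau a b \<circ> p) a"
      unfolding orbit_altdef_permutation[OF pq] by blast
  qed
qed

lemma orbit_transp_join:
  assumes "permutation p" "b \<notin> orbit p a"
  shows "orbit (tau a b \<circ> p) a = orbit p a \<union> orbit p b"
    and "orbit (tau a b \<circ> p) b = orbit p a \<union> orbit p b"
proof -
  have "a \<notin> orbit p b"
    using assms in_orbit_iff[OF assms(1)] by metis
  note 1 = orbit_transp_join_mem[OF assms] and 2 = orbit_transp_join_mem[OF assms(1) this]
  have comm: "tau a b = tau b a" by (rule transpose_commute)
  have pq: "permutation (tau a b \<circ> p)"
    by (rule permutation_comp_permutes[OF assms(1) permutes_swap_id[of a "{a,b}" b]]) auto
  have eq: "orbit (tau a b \<circ> p) b = orbit (tau a b \<circ> p) a"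
    using 1(1) in_orbit_iff[OF pq] by blast
  have "orbit (tau a b \<circ> p) a \<subseteq> orbit p a \<union> orbit p b"
  proof (rule orbit_subset_closed)
    show "a \<in> orbit p a \<union> orbit p b" using permutation_self_in_orbit[OF assms(1)] by auto
    show "(tau a b \<circ> p) y \<in> orbit p a \<union> orbit p b" if "y \<in> orbit p a \<union> orbit p b" for y
    proof -
      have "p y \<in> orbit p a \<union> orbit p b" using that by (auto intro: orbit.step)
      then show ?thesis
        using permutation_self_in_orbit[OF assms(1)] by (auto simp: Transposition.transpose_def)
    qed
  qed
  then show "orbit (tau a b \<circ> p) a = orbit p a \<union> orbit p b"
    using 1(2) 2(2)[folded comm] eq by (simp add: subset_antisym)
  with eq show "orbit (tau a b \<circ> p) b = orbit p a \<union> orbit p b" by simp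
qed

text \<open>If \<open>p\<close> leads from \<open>a\<close> to \<open>b\<close> in \<open>N\<close>
  steps, the transposition sends the trajectory back to \<open>a\<close> at that moment, so the new
  cycle of \<open>a\<close> closes before \<open>b\<close>. Applying the transposition again joins
  the two pieces and restores \<open>p\<close>, which gives the second claim.\<close>

lemma orbit_transp_cut:
  assumes "permutation p" "b \<in> orbit p a" "a \<noteq> b"
  shows "b \<notin> orbit (tau a b \<circ> p) a"
    and "orbit (tau a b \<circ> p) a \<union> orbit (tau a b \<circ> p) b = orbit p a"
proof -
  let ?q = "tau a b \<circ> p"
  have perm: "tau a b permutes {a, b}" by (rule permutes_swap_id) auto
  have pq: "permutation ?q"
    by (rule permutation_comp_permutes[OF assms(1) perm]) simp
  define N where "N = funpow_dist1 p a b"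
  have N: "(p ^^ N) a = b" "0 < N"
    using funpow_dist1_prop[OF assms(2)] by (simp_all add: N_def)
  have a: "a \<in> orbit p a" by (rule permutation_self_in_orbit[OF assms(1)])
  have nb: "(p ^^ i) a \<noteq> b" if "i < N" for i
    using that assms(3) funpow_dist1_least[of i p a b] by (cases "i = 0") (auto simp: N_def)
  \<comment> \<open>A return to \<open>a\<close> at time \<open>i < N\<close> would let the
    remaining \<open>N - i\<close> steps already reach \<open>b\<close>, against the minimality of
    \<open>N\<close>.\<close>
  have na: "(p ^^ i) a \<noteq> a" if "0 < i" "i < N" for i
  proof
    assume "(p ^^ i) a = a"
    then have "(p ^^ (N - i)) a = (p ^^ (N - i)) ((p ^^ i) a)" by simp
    also have "\<dots> = (p ^^ N) a" using that by (metis add.commute comp_apply funpow_add le_add_diff_inverse2 less_imp_le)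
    finally show False using N nb[of "N - i"] that by simp
  qed
  note f = funpow_follow[OF perm, of N p a]
  have "((?q) ^^ N) a = a" using f(2) N nb na by simp
  then have "orbit ?q a = {(?q ^^ m) a |m. m < N}"
    by (rule orbit_altdef_bounded) (rule N)
  then show nin: "b \<notin> orbit ?q a"
    using f(1) nb na by fastforce
  have "tau a b \<circ> ?q = p" by (simp add: fun_eq_iff)
  then show "orbit ?q a \<union> orbit ?q b = orbit p a"
    using orbit_transp_join(1)[OF pq nin] by simp
qed

text \<open>The transposition turns \<open>a\<close> into a fixed point and redirects the
  predecessor of \<open>a\<close> to \<open>\<sigma> a\<close>, so the cycle merely bypasses
  \<open>a\<close>. This is the induction step for the genus inequality.\<close>

lemma cyclic_on_remove:
  assumes "\<sigma> permutes A" "cyclic_on \<sigma> A" "a \<in> A" "A \<noteq> {a}"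
  defines "\<sigma>' \<equiv> tau a (\<sigma> a) \<circ> \<sigma>"
  shows "\<sigma>' permutes (A - {a})" "cyclic_on \<sigma>' (A - {a})" "\<sigma> a \<noteq> a" "\<sigma> a \<in> A"
proof -
  have fin: "finite A" using assms(2) by (rule finite_cyclic_on)
  have p: "permutation \<sigma>" using assms(1) fin by (auto simp: permutation_permutes)
  have orb: "orbit \<sigma> a = A" using assms(2,3) by (rule orbit_cyclic_eq3)
  show ne: "\<sigma> a \<noteq> a" using orb assms(4) orbit_eq_singleton_iff by metis
  show inA: "\<sigma> a \<in> A" using orb orbit.base by metis
  note cut = orbit_transp_cut[OF p, of "\<sigma> a" a, folded \<sigma>'_def]
  have fix_a: "\<sigma>' a = a" by (simp add: \<sigma>'_def)
  then have oa: "orbit \<sigma>' a = {a}" by (simp add: orbit_eq_singleton_iff)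
  have "\<sigma>' permutes A"
    unfolding \<sigma>'_def by (rule permutes_compose[OF assms(1)]) (use inA assms(3) in \<open>auto intro: permutes_swap_id\<close>)
  then show perm: "\<sigma>' permutes (A - {a})"
    using fix_a by (auto simp: permutes_def)
  have "orbit \<sigma>' (\<sigma> a) = A - {a}"
  proof -
    have "orbit \<sigma>' (\<sigma> a) \<subseteq> A - {a}"
      using permutes_orbit_subset[OF perm] inA ne by auto
    moreover have "{a} \<union> orbit \<sigma>' (\<sigma> a) = A"
      using cut(2) orb oa ne inA by simp
    ultimately show ?thesis by auto
  qed
  then show "cyclic_on \<sigma>' (A - {a})"
    using inA ne by (auto simp: cyclic_on_def)
qed

section \<open>The genus inequality for multiplication by one cycle\<close>

lemma card_insert_le_Suc: "card (insert x A) \<le> card A + 1"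
  by (cases "finite A") (simp_all add: card_insert_if)

text \<open>Local form of the Riemann--Hurwitz inequality: the slack is twice the genus created by
  the cycle \<open>\<sigma>\<close>. Bypassing one point \<open>a\<close> splits off a
  transposition, which either cuts an orbit or joins two; in both cases the left-hand side grows by
  at most one, as does the right-hand side.\<close>

lemma orbit_image_card_genus:
  assumes "\<sigma> permutes A" "cyclic_on \<sigma> A" "permutation p"
  shows "card (orbit (\<sigma> \<circ> p) ` A) + card (orbit p ` A) \<le> card A + 1"
  using assms
proof (induction "card A" arbitrary: A \<sigma> rule: less_induct)
  case less
  have fin: "finite A" using less.prems(2) by (rule finite_cyclic_on)
  obtain a where a: "a \<in> A" using less.prems(2) by (auto simp: cyclic_on_def)
  show ?case
  proof (cases "A = {a}")
    case False
    define b where "b = \<sigma> a"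
    define \<sigma>' where "\<sigma>' = tau a b \<circ> \<sigma>"
    define A' where "A' = A - {a}"
    define r where "r = \<sigma>' \<circ> p"
    have rem: "\<sigma>' permutes A'" "cyclic_on \<sigma>' A'" "b \<noteq> a" "b \<in> A"
      unfolding \<sigma>'_def b_def A'_def by (rule cyclic_on_remove[OF less.prems(1,2) a False])+
    have fin': "finite A'" and cA: "card A = Suc (card A')" and A: "A = insert a A'"
      and bA': "b \<in> A'"
      using fin a rem card_Suc_Diff1[OF fin a] unfolding A'_def by auto
    have IH: "card (orbit r ` A') + card (orbit p ` A') \<le> card A' + 1"
      unfolding r_def using less.hyps[of A' \<sigma>'] rem less.prems(3) cA by simp
    have r: "permutation r"
      unfolding r_def using less.prems(3) rem(1) fin' by (rule permutation_comp_permutes)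
    have "\<sigma> = tau a b \<circ> \<sigma>'" by (simp add: \<sigma>'_def fun_eq_iff)
    then have sp: "\<sigma> \<circ> p = tau a b \<circ> r" by (simp add: r_def comp_assoc)
    let ?q = "tau a b \<circ> r"
    have perm: "tau a b permutes {a, b}" by (rule permutes_swap_id) auto
    have other: "orbit ?q x \<in> orbit r ` A' - {orbit r b}"
      if "x \<in> A" "orbit r x \<noteq> orbit r a" "orbit r x \<noteq> orbit r b" for x
    proof -
      have "orbit ?q x = orbit r x"
        by (rule orbit_comp_disjoint[OF r perm]) (use that in_orbit_iff[OF r] in auto)
      then show ?thesis using that A by auto
    qed
    have cardm: "card (orbit r ` A' - {orbit r b}) + 1 = card (orbit r ` A')"
      using bA' fin' by (metis One_nat_def Suc_eq_plus1 card.remove finite_imageI image_eqI)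
    show ?thesis
    proof (cases "b \<in> orbit r a")
      case True
      then have eq: "orbit r b = orbit r a" using in_orbit_iff[OF r] by auto
      have cut: "orbit ?q a \<union> orbit ?q b = orbit r a"
        using orbit_transp_cut(2)[OF r True] rem(3) by auto
      have pq: "permutation ?q"
        by (rule permutation_comp_permutes[OF r perm]) simp
      have "orbit ?q ` A \<subseteq> {orbit ?q a, orbit ?q b} \<union> (orbit r ` A' - {orbit r b})"
      proof
        fix X assume "X \<in> orbit ?q ` A"
        then obtain x where x: "x \<in> A" "X = orbit ?q x" by auto
        show "X \<in> {orbit ?q a, orbit ?q b} \<union> (orbit r ` A' - {orbit r b})"
        proof (cases "orbit r x = orbit r a")
          case True
          then have "x \<in> orbit ?q a \<union> orbit ?q b"
            using cut in_orbit_iff[OF r] by auto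
          then show ?thesis using in_orbit_iff[OF pq] x by auto
        qed (use other[OF x(1)] eq x in auto)
      qed
      then have "card (orbit ?q ` A) \<le> card ({orbit ?q a, orbit ?q b} \<union> (orbit r ` A' - {orbit r b}))"
        by (rule card_mono[rotated]) (use fin' in auto)
      also have "\<dots> \<le> card {orbit ?q a, orbit ?q b} + card (orbit r ` A' - {orbit r b})"
        by (rule card_Un_le)
      also have "\<dots> \<le> 2 + card (orbit r ` A' - {orbit r b})"
        using card_insert_le_Suc[of "orbit ?q a" "{orbit ?q b}"] by simp
      finally have 1: "card (orbit ?q ` A) \<le> card (orbit r ` A') + 1" using cardm by simp
      \<comment> \<open>A cut gains an orbit, so \<open>a\<close> must not bring a new orbit of
        \<open>p\<close>. If the orbit of \<open>a\<close> under \<open>p\<close> missed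
        \<open>A'\<close>, then \<open>\<sigma>'\<close> would leave it unchanged and
        \<open>r\<close> could not lead from \<open>a\<close> to \<open>b\<close>.\<close>
      have "orbit p ` A = orbit p ` A'"
      proof -
        have "orbit p a \<inter> A' \<noteq> {}"
        proof
          assume "orbit p a \<inter> A' = {}"
          then have "orbit r a = orbit p a"
            unfolding r_def using orbit_comp_disjoint[OF less.prems(3) rem(1)] by simp
          then show False using True bA' \<open>orbit p a \<inter> A' = {}\<close> by auto
        qed
        then obtain y where "y \<in> A'" "orbit p y = orbit p a"
          using in_orbit_iff[OF less.prems(3)] by blast
        then show ?thesis using A by auto
      qed
      then have "card (orbit p ` A) = card (orbit p ` A')" by (simp only:)
      then show ?thesis using 1 IH cA unfolding sp by linarith
    next
      case False
      \<comment> \<open>The join keeps the number of orbits of \<open>?q\<close> through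
        \<open>A\<close> within that of \<open>r\<close> through \<open>A'\<close>, which leaves
        room for one new orbit of \<open>p\<close> through \<open>a\<close>.\<close>
      note join = orbit_transp_join[OF r False]
      have "orbit ?q ` A \<subseteq> insert (orbit ?q b) (orbit r ` A' - {orbit r b})"
      proof
        fix X assume "X \<in> orbit ?q ` A"
        then obtain x where x: "x \<in> A" "X = orbit ?q x" by auto
        show "X \<in> insert (orbit ?q b) (orbit r ` A' - {orbit r b})"
        proof (cases "orbit r x = orbit r a \<or> orbit r x = orbit r b")
          case True
          then have "x \<in> orbit ?q b" using join in_orbit_iff[OF r] by auto
          then have "orbit ?q x = orbit ?q b"
            using in_orbit_iff[OF permutation_comp_permutes[OF r perm]] by simp
          then show ?thesis using x by auto
        qed (use other[OF x(1)] x in auto)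
      qed
      then have "card (orbit ?q ` A) \<le> card (insert (orbit ?q b) (orbit r ` A' - {orbit r b}))"
        by (rule card_mono[rotated]) (use fin' in auto)
      also have "\<dots> \<le> card (orbit r ` A' - {orbit r b}) + 1"
        by (rule card_insert_le_Suc)
      also have "\<dots> = card (orbit r ` A')" by (rule cardm)
      finally have 1: "card (orbit ?q ` A) \<le> card (orbit r ` A')" .
      have "card (orbit p ` A) \<le> card (orbit p ` A') + 1"
        unfolding A image_insert by (rule card_insert_le_Suc)
      then show ?thesis using 1 IH cA unfolding sp by linarith
    qed
  qed simp
qed

section \<open>Orbit partitions of lists of cycles and the local form of minimality\<close>

section \<open>Minimal transitive products of cycles\<close>

definition moved :: "('a \<Rightarrow> 'a) \<Rightarrow> 'a set" where
  "moved \<sigma> = {x. \<sigma> x \<noteq> x}"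

definition merge :: "'a set set \<Rightarrow> 'a set \<Rightarrow> 'a set set" where
  "merge P A = insert (\<Union>{B \<in> P. B \<inter> A \<noteq> {}}) {B \<in> P. B \<inter> A = {}}"

text \<open>\<open>cyclic_on\<close> requires a nonempty set, so the identity is excluded and the
  support has at least two points.\<close>

definition is_cycle :: "'a set \<Rightarrow> ('a \<Rightarrow> 'a) \<Rightarrow> bool" where
  "is_cycle S \<sigma> \<longleftrightarrow> moved \<sigma> \<subseteq> S \<and> \<sigma> permutes moved \<sigma> \<and> cyclic_on \<sigma> (moved \<sigma>)"

text \<open>The orbits of the group generated by the factors, computed one factor at a time; the
  counting arguments then need no group.\<close>

primrec blocks :: "'a set \<Rightarrow> ('a \<Rightarrow> 'a) list \<Rightarrow> 'a set set" where
  "blocks S [] = (\<lambda>x. {x}) ` S"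
| "blocks S (\<sigma> # F) = merge (blocks S F) (moved \<sigma>)"

primrec product :: "('a \<Rightarrow> 'a) list \<Rightarrow> 'a \<Rightarrow> 'a" where
  "product [] = id"
| "product (\<sigma> # F) = \<sigma> \<circ> product F"

text \<open>The two equalities are the equality cases of \<open>card_blocks_le_card_orbits\<close>
  and \<open>orbit_image_card_genus\<close>: each block touched by \<open>\<sigma>\<close> contains
  only one orbit of \<open>p\<close> that meets the support, and no genus is created.\<close>

definition tight_step :: "('a \<Rightarrow> 'a) \<Rightarrow> 'a set set \<Rightarrow> ('a \<Rightarrow> 'a) \<Rightarrow> bool" where
  "tight_step \<sigma> P p \<longleftrightarrow> card {B \<in> P. B \<inter> moved \<sigma> \<noteq> {}} = card (orbit p ` moved \<sigma>) \<and>
     card (orbit (\<sigma> \<circ> p) ` moved \<sigma>) + card (orbit p ` moved \<sigma>) = card (moved \<sigma>) + 1"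

primrec tight :: "'a set \<Rightarrow> ('a \<Rightarrow> 'a) list \<Rightarrow> bool" where
  "tight S [] = True"
| "tight S (\<sigma> # F) = (tight S F \<and> tight_step \<sigma> (blocks S F) (product F))"

lemma merge_partition:
  assumes P: "partition_on S P" and A: "A \<subseteq> S" "A \<noteq> {}"
  shows "partition_on S (merge P A)"
proof (rule partition_onI)
  show "\<Union>(merge P A) = S"
    using partition_onD1[OF P] by (auto simp: merge_def)
  obtain a where "a \<in> A" "a \<in> S" using A by auto
  then obtain B where "B \<in> P" "a \<in> B" using partition_onD1[OF P] by auto
  then show "{} \<notin> merge P A"
    using \<open>a \<in> A\<close> partition_onD3[OF P] by (auto simp: merge_def)
  have dis: "disjnt X Y" if "X \<in> P" "Y \<in> P" "X \<noteq> Y" for X Y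
    using that partition_onD2[OF P] by (auto simp: pairwise_def)
  have u: "disjnt (\<Union>{B \<in> P. B \<inter> A \<noteq> {}}) Y" if "Y \<in> P" "Y \<inter> A = {}" for Y
    unfolding disjnt_def
  proof (intro equals0I)
    fix x assume "x \<in> \<Union>{B \<in> P. B \<inter> A \<noteq> {}} \<inter> Y"
    then obtain X where "X \<in> P" "X \<inter> A \<noteq> {}" "x \<in> X" "x \<in> Y" by auto
    then show False using dis[of X Y] that by (auto simp: disjnt_def)
  qed
  show "disjnt X Y" if "X \<in> merge P A" "Y \<in> merge P A" "X \<noteq> Y" for X Y
  proof -
    from that(1,2) consider "X = \<Union>{B \<in> P. B \<inter> A \<noteq> {}}" "Y = \<Union>{B \<in> P. B \<inter> A \<noteq> {}}"
      | "X = \<Union>{B \<in> P. B \<inter> A \<noteq> {}}" "Y \<in> P" "Y \<inter> A = {}"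
      | "Y = \<Union>{B \<in> P. B \<inter> A \<noteq> {}}" "X \<in> P" "X \<inter> A = {}"
      | "X \<in> P" "Y \<in> P"
      unfolding merge_def by blast
    then show ?thesis
    proof cases
      case 1 then show ?thesis using that(3) by simp
    next
      case 2 then show ?thesis using u[of Y] by simp
    next
      case 3 then show ?thesis using disjnt_sym[OF u[of X]] by simp
    next
      case 4 then show ?thesis using dis that(3) by simp
    qed
  qed
qed

lemma merge_card:
  assumes P: "partition_on S P" and A: "A \<subseteq> S" "A \<noteq> {}" and fin: "finite S"
  shows "card (merge P A) + card {B \<in> P. B \<inter> A \<noteq> {}} = card P + 1"
proof -
  have fP: "finite P" using finite_elements[OF fin P] .
  let ?t = "{B \<in> P. B \<inter> A \<noteq> {}}" and ?o = "{B \<in> P. B \<inter> A = {}}"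
  have "\<Union>?t \<inter> A \<noteq> {}" using A partition_onD1[OF P] by auto
  then have "\<Union>?t \<notin> ?o" by auto
  then have "card (merge P A) = Suc (card ?o)"
    unfolding merge_def using fP by (subst card_insert_disjoint) auto
  moreover have "card P = card ?t + card ?o"
  proof -
    have "P = ?t \<union> ?o" by auto
    then have "card P = card (?t \<union> ?o)" by simp
    also have "\<dots> = card ?t + card ?o" by (rule card_Un_disjoint) (use fP in auto)
    finally show ?thesis .
  qed
  ultimately show ?thesis by simp
qed

lemma closed_orbit_subset:
  assumes "\<And>x. x \<in> B \<Longrightarrow> p x \<in> B" "x \<in> B"
  shows "orbit p x \<subseteq> B"
  by (rule orbit_subset_closed) (use assms in auto)

text \<open>A block closed under \<open>p\<close> that meets \<open>A\<close> contains a whole orbit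
  through a point of \<open>A\<close>. Distinct blocks are disjoint, so orbits chosen in this way
  are distinct.\<close>

lemma card_blocks_le_card_orbits:
  assumes P: "partition_on S P" and fin: "finite A" and p: "permutation p"
    and cl: "\<And>B x. B \<in> P \<Longrightarrow> x \<in> B \<Longrightarrow> p x \<in> B"
  shows "card {B \<in> P. B \<inter> A \<noteq> {}} \<le> card (orbit p ` A)"
proof (rule card_inj_on_le)
  let ?g = "\<lambda>B. orbit p (SOME a. a \<in> B \<inter> A)"
  have s: "(SOME a. a \<in> B \<inter> A) \<in> B \<inter> A" if "B \<inter> A \<noteq> {}" for B
    by (rule someI_ex) (use that in auto)
  show "?g ` {B \<in> P. B \<inter> A \<noteq> {}} \<subseteq> orbit p ` A"
    using s by blast
  show "finite (orbit p ` A)" using fin by simp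
  show "inj_on ?g {B \<in> P. B \<inter> A \<noteq> {}}"
  proof (rule inj_onI)
    fix X Y assume X: "X \<in> {B \<in> P. B \<inter> A \<noteq> {}}" and Y: "Y \<in> {B \<in> P. B \<inter> A \<noteq> {}}" and eq: "?g X = ?g Y"
    have "?g X \<subseteq> X" using X s[of X] cl by (intro closed_orbit_subset) auto
    moreover have "?g Y \<subseteq> Y" using Y s[of Y] cl by (intro closed_orbit_subset) auto
    moreover have "?g X \<noteq> {}" by (rule orbit_nonempty)
    ultimately have "X \<inter> Y \<noteq> {}" using eq by auto
    then show "X = Y"
      using X Y partition_onD2[OF P] by (auto simp: pairwise_def disjnt_def)
  qed
qed

lemma inv_comp_cancel:
  assumes "\<sigma> permutes A"
  shows "inv_into UNIV \<sigma> \<circ> (\<sigma> \<circ> p) = p" "\<sigma> \<circ> (inv_into UNIV \<sigma> \<circ> p) = p"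
  using permutes_inv_o[OF assms] by (simp_all add: comp_assoc[symmetric])

lemma orbits_off_support:
  assumes p: "permutation p" and \<sigma>: "\<sigma> permutes A" "finite A" and A: "A \<subseteq> S"
  shows "orbit (\<sigma> \<circ> p) ` S - orbit (\<sigma> \<circ> p) ` A = orbit p ` S - orbit p ` A"
proof -
  have *: "orbit p ` S - orbit p ` A \<subseteq> orbit (\<sigma> \<circ> p) ` S - orbit (\<sigma> \<circ> p) ` A"
    if p: "permutation p" and \<sigma>: "\<sigma> permutes A" for \<sigma> p :: "'a \<Rightarrow> 'a"
  proof
    fix X assume X: "X \<in> orbit p ` S - orbit p ` A"
    then obtain x where x: "x \<in> S" "X = orbit p x" by auto
    have dis: "orbit p x \<inter> A = {}"
      using X x in_orbit_iff[OF p] by (metis DiffE disjoint_iff imageI)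
    have eq: "orbit (\<sigma> \<circ> p) x = orbit p x" using orbit_comp_disjoint[OF p \<sigma> dis] .
    have "X \<notin> orbit (\<sigma> \<circ> p) ` A"
    proof
      assume "X \<in> orbit (\<sigma> \<circ> p) ` A"
      then obtain a where "a \<in> A" "X = orbit (\<sigma> \<circ> p) a" by auto
      then have "a \<in> X"
        using permutation_self_in_orbit[OF permutation_comp_permutes[OF p \<sigma> assms(3)]] by auto
      then show False using dis x \<open>a \<in> A\<close> by auto
    qed
    then show "X \<in> orbit (\<sigma> \<circ> p) ` S - orbit (\<sigma> \<circ> p) ` A" using x eq by auto
  qed
  \<comment> \<open>The reverse inclusion is the same statement for \<open>pinv \<sigma>\<close> and
    \<open>\<sigma> \<circ> p\<close>.\<close>
  have "orbit (\<sigma> \<circ> p) ` S - orbit (\<sigma> \<circ> p) ` A \<subseteq> orbit p ` S - orbit p ` A"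
    using *[OF permutation_comp_permutes[OF p \<sigma>] permutes_inv[OF \<sigma>(1)]]
    by (simp only: inv_comp_cancel[OF \<sigma>(1)])
  with *[OF p \<sigma>(1)] show ?thesis by auto
qed

lemma orbit_count_change:
  assumes p: "permutation p" and \<sigma>: "\<sigma> permutes A" and A: "A \<subseteq> S" and S: "finite S"
  shows "card (orbit (\<sigma> \<circ> p) ` S) + card (orbit p ` A) = card (orbit p ` S) + card (orbit (\<sigma> \<circ> p) ` A)"
proof -
  have fA: "finite A" using A S finite_subset by auto
  have "card (orbit q ` S) = card (orbit q ` S - orbit q ` A) + card (orbit q ` A)" for q
  proof -
    have "card (orbit q ` S - orbit q ` A) = card (orbit q ` S) - card (orbit q ` A)"
      by (rule card_Diff_subset) (use fA A in auto)
    moreover have "card (orbit q ` A) \<le> card (orbit q ` S)"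
      by (rule card_mono) (use S A in auto)
    ultimately show ?thesis by simp
  qed
  from this[of p] this[of "\<sigma> \<circ> p"] show ?thesis
    using orbits_off_support[OF p \<sigma> fA A] by simp
qed

lemma is_cycle_facts:
  assumes "is_cycle S \<sigma>"
  shows "moved \<sigma> \<subseteq> S" "\<sigma> permutes moved \<sigma>" "cyclic_on \<sigma> (moved \<sigma>)" "moved \<sigma> \<noteq> {}"
    "finite (moved \<sigma>)" "\<sigma> permutes S"
  using assms finite_cyclic_on[of \<sigma> "moved \<sigma>"] permutes_subset[of \<sigma> "moved \<sigma>" S]
  by (auto simp: is_cycle_def cyclic_on_def)

lemma product_permutes:
  assumes "\<forall>\<sigma>\<in>set F. is_cycle S \<sigma>"
  shows "product F permutes S"
  using assms
proof (induction F)
  case (Cons \<sigma> F)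
  then show ?case
    unfolding product.simps by (intro permutes_compose is_cycle_facts(6)[of S \<sigma>]) simp_all
qed (auto simp: permutes_id)

lemma blocks_partition:
  assumes "\<forall>\<sigma>\<in>set F. is_cycle S \<sigma>"
  shows "partition_on S (blocks S F)"
  using assms
proof (induction F)
  case Nil
  then show ?case by (simp add: partition_on_singletons)
next
  case (Cons \<sigma> F)
  then show ?case
    using merge_partition[of S "blocks S F" "moved \<sigma>"] is_cycle_facts(1,4)[of S \<sigma>] by simp
qed

lemma moved_closed:
  assumes "\<sigma> permutes moved \<sigma>" "x \<in> B" "moved \<sigma> \<subseteq> B"
  shows "\<sigma> x \<in> B"
  using assms permutes_in_image[OF assms(1), of x] by (cases "x \<in> moved \<sigma>") (auto simp: moved_def)

lemma merge_closed:
  assumes cl: "\<And>B x. B \<in> P \<Longrightarrow> x \<in> B \<Longrightarrow> p x \<in> B"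
    and \<sigma>: "\<sigma> permutes moved \<sigma>" "moved \<sigma> \<subseteq> \<Union>P" and B: "B \<in> merge P (moved \<sigma>)" and x: "x \<in> B"
  shows "p x \<in> B" "\<sigma> x \<in> B" "\<sigma> (p x) \<in> B"
proof -
  have 1: "p x \<in> B" if "x \<in> B" for x
    using that B cl unfolding merge_def by blast
  have 2: "\<sigma> x \<in> B" if "x \<in> B" for x
  proof (cases "B \<inter> moved \<sigma> = {}")
    case True
    then show ?thesis using that by (auto simp: moved_def)
  next
    case False
    then have "B = \<Union>{B \<in> P. B \<inter> moved \<sigma> \<noteq> {}}" using B by (auto simp: merge_def)
    then have "moved \<sigma> \<subseteq> B" using \<sigma>(2) by auto
    then show ?thesis using moved_closed[OF \<sigma>(1) that] by simp
  qed
  from x show "p x \<in> B" "\<sigma> x \<in> B" "\<sigma> (p x) \<in> B" by (auto intro: 1 2)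
qed

lemma blocks_closed:
  assumes "\<forall>\<sigma>\<in>set F. is_cycle S \<sigma>" "B \<in> blocks S F" "x \<in> B"
  shows "product F x \<in> B"
  using assms
proof (induction F arbitrary: B x)
  case (Cons \<sigma> F)
  show ?case
    using merge_closed(3)[of "blocks S F" "product F" \<sigma> B x] Cons
      is_cycle_facts(1,2)[of S \<sigma>] partition_onD1[OF blocks_partition[of F S]] by simp
qed auto

text \<open>The quantity \<open>d\<close> is twice the sum of the genera of the blocks; for a single
  block it vanishes exactly under the minimality equation. A further factor increases it by the
  slack of the genus inequality plus twice the slack between touched blocks and touched orbits. Both
  slacks are nonnegative, so \<open>d\<close> vanishes only if every step is tight.\<close>

lemma deficiency:
  assumes F: "\<forall>\<sigma>\<in>set F. is_cycle S \<sigma>" and S: "finite S"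
  defines "d \<equiv> (\<lambda>F. (\<Sum>\<sigma>\<leftarrow>F. int (card (moved \<sigma>)) - 1) + 2 * int (card (blocks S F))
     - int (card S) - int (card (orbit (product F) ` S)))"
  shows "d F \<ge> 0 \<and> (d F = 0 \<longleftrightarrow> tight S F)"
  using F
proof (induction F)
  case Nil
  have "orbit id x = {x}" for x :: 'a by (simp add: orbit_eq_singleton_iff)
  then have "orbit id ` S = (\<lambda>x. {x}) ` S" by auto
  moreover have "card ((\<lambda>x. {x}) ` S) = card S" by (rule card_image) auto
  ultimately show ?case by (simp add: d_def)
next
  case (Cons \<sigma> F)
  define p A P where "p = product F" and "A = moved \<sigma>" and "P = blocks S F"
  have cyc: "\<forall>\<sigma>\<in>set F. is_cycle S \<sigma>" and IH: "d F \<ge> 0 \<and> (d F = 0 \<longleftrightarrow> tight S F)"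
    using Cons by auto
  have \<sigma>: "A \<subseteq> S" "\<sigma> permutes A" "cyclic_on \<sigma> A" "A \<noteq> {}" "finite A"
    using Cons.prems is_cycle_facts[of S \<sigma>] unfolding A_def by auto
  have p: "permutation p"
    unfolding p_def using product_permutes[OF cyc] S permutation_permutes by auto
  note P = blocks_partition[OF cyc, folded P_def]
  have t: "card {B \<in> P. B \<inter> A \<noteq> {}} \<le> card (orbit p ` A)"
    by (rule card_blocks_le_card_orbits[OF P \<sigma>(5) p])
      (use blocks_closed[OF cyc] in \<open>auto simp: P_def p_def\<close>)
  have g: "card (orbit (\<sigma> \<circ> p) ` A) + card (orbit p ` A) \<le> card A + 1"
    by (rule orbit_image_card_genus[OF \<sigma>(2,3) p])
  have c: "card (orbit (\<sigma> \<circ> p) ` S) + card (orbit p ` A) = card (orbit p ` S) + card (orbit (\<sigma> \<circ> p) ` A)"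
    by (rule orbit_count_change[OF p \<sigma>(2,1) S])
  have m: "card (merge P A) + card {B \<in> P. B \<inter> A \<noteq> {}} = card P + 1"
    by (rule merge_card[OF P \<sigma>(1,4) S])
  have dF: "d (\<sigma> # F) = int (card A) - 1 + (\<Sum>\<sigma>\<leftarrow>F. int (card (moved \<sigma>)) - 1) + 2 * int (card (merge P A))
     - int (card S) - int (card (orbit (\<sigma> \<circ> p) ` S))"
    "d F = (\<Sum>\<sigma>\<leftarrow>F. int (card (moved \<sigma>)) - 1) + 2 * int (card P)
     - int (card S) - int (card (orbit p ` S))"
    by (simp_all add: d_def A_def p_def P_def)
  have "d (\<sigma> # F) = d F
      + (int (card A) + 1 - int (card (orbit (\<sigma> \<circ> p) ` A)) - int (card (orbit p ` A)))
      + 2 * (int (card (orbit p ` A)) - int (card {B \<in> P. B \<inter> A \<noteq> {}}))"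
    using arg_cong[OF c, of int] arg_cong[OF m, of int] unfolding dF of_nat_add by simp
  moreover have "tight S (\<sigma> # F) \<longleftrightarrow> tight S F \<and> card {B \<in> P. B \<inter> A \<noteq> {}} = card (orbit p ` A) \<and>
     card (orbit (\<sigma> \<circ> p) ` A) + card (orbit p ` A) = card A + 1"
    by (simp add: tight_step_def A_def p_def P_def)
  ultimately show ?case using IH t g by auto
qed

section \<open>Recursion over the last factor and its exponential generating function\<close>

section \<open>Removing the last factor\<close>

abbreviation pinv :: "('a \<Rightarrow> 'a) \<Rightarrow> 'a \<Rightarrow> 'a" where
  "pinv \<equiv> inv_into UNIV"

text \<open>The partition \<open>P\<close> is a parameter because the factors that remain after a
  removal may generate a group with several orbits.\<close>

definition facs :: "'a set \<Rightarrow> nat \<Rightarrow> 'a set set \<Rightarrow> ('a \<Rightarrow> 'a) \<Rightarrow> ('a \<Rightarrow> 'a) list set" where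
  "facs S r P \<pi> = {F. length F = r \<and> (\<forall>\<sigma>\<in>set F. is_cycle S \<sigma>) \<and> tight S F \<and> blocks S F = P \<and> product F = \<pi>}"

text \<open>\<open>\<sigma>\<close> is the removed factor and \<open>Q\<close> the partition into
  which the block \<open>B\<close> falls. The conditions are those of \<open>tight_step\<close>,
  rewritten for the remaining product \<open>pinv \<sigma> \<circ> \<pi>\<close>, so that no list of
  factors occurs.\<close>

definition steps :: "('a \<Rightarrow> 'a) \<Rightarrow> 'a set \<Rightarrow> (('a \<Rightarrow> 'a) \<times> 'a set set) set" where
  "steps \<pi> B = {(\<sigma>, Q). is_cycle B \<sigma> \<and> partition_on B Q \<and>
     (\<forall>X\<in>Q. X \<inter> moved \<sigma> \<noteq> {} \<and> (\<forall>x\<in>X. pinv \<sigma> (\<pi> x) \<in> X)) \<and>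
     card Q = card (orbit (pinv \<sigma> \<circ> \<pi>) ` moved \<sigma>) \<and>
     card (orbit \<pi> ` moved \<sigma>) + card Q = card (moved \<sigma>) + 1}"

definition wt :: "(nat \<Rightarrow> 'c::comm_monoid_mult) \<Rightarrow> ('a \<Rightarrow> 'a) list \<Rightarrow> 'c" where
  "wt q F = (\<Prod>\<sigma>\<leftarrow>F. q (card (moved \<sigma>)))"

lemma finite_facs: "finite S \<Longrightarrow> finite (facs S r P \<pi>)"
  by (rule finite_subset[OF _ finite_lists_length_eq[of "{\<sigma>. \<sigma> permutes S}" r]])
    (auto simp: facs_def is_cycle_facts(6) finite_permutations)

lemma finite_steps: "finite B \<Longrightarrow> finite (steps \<pi> B)"
proof (rule finite_subset)
  show "steps \<pi> B \<subseteq> {\<sigma>. \<sigma> permutes B} \<times> Pow (Pow B)"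
    using partition_onD1 by (fastforce simp: steps_def is_cycle_facts(6))
qed (simp add: finite_permutations)

lemma partition_subset:
  assumes "partition_on S P" "Q \<subseteq> P"
  shows "partition_on (\<Union>Q) Q"
  using assms pairwise_subset[of disjnt P Q] by (auto simp: partition_on_def)

lemma partition_refine:
  assumes P: "partition_on S P" and B: "B \<in> P" and Q: "partition_on B Q"
  shows "partition_on S (Q \<union> (P - {B}))" "Q \<inter> (P - {B}) = {}"
proof -
  have dis: "X \<inter> Y = {}" if "X \<in> Q" "Y \<in> P - {B}" for X Y
  proof -
    have "X \<subseteq> B" using that partition_onD1[OF Q] by auto
    moreover have "B \<inter> Y = {}"
      using that B partition_onD2[OF P] by (auto simp: pairwise_def disjnt_def)
    ultimately show ?thesis by auto
  qed
  show "Q \<inter> (P - {B}) = {}"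
  proof (rule equals0I)
    fix X assume "X \<in> Q \<inter> (P - {B})"
    then have "X \<in> Q" "X = {}" using dis[of X X] by simp_all
    then show False using partition_onD3[OF Q] by simp
  qed
  have U: "\<Union>(Q \<union> (P - {B})) = S"
  proof -
    have "\<Union>(Q \<union> (P - {B})) = B \<union> \<Union>(P - {B})" using partition_onD1[OF Q] by simp
    also have "\<dots> = \<Union>P" using B by blast
    finally show ?thesis using partition_onD1[OF P] by simp
  qed
  show "partition_on S (Q \<union> (P - {B}))"
  proof (rule partition_onI)
    show "\<Union>(Q \<union> (P - {B})) = S" by (rule U)
    show "{} \<notin> Q \<union> (P - {B})" using partition_onD3[OF P] partition_onD3[OF Q] by auto
    fix X Y assume XY: "X \<in> Q \<union> (P - {B})" "Y \<in> Q \<union> (P - {B})" "X \<noteq> Y"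
    then consider "X \<in> Q" "Y \<in> Q" | "X \<in> Q" "Y \<in> P - {B}" | "X \<in> P - {B}" "Y \<in> Q"
      | "X \<in> P" "Y \<in> P" by blast
    then show "disjnt X Y"
    proof cases
      case 1 then show ?thesis using partition_onD2[OF Q] XY(3) by (auto simp: pairwise_def)
    next
      case 2 then show ?thesis using dis by (simp add: disjnt_def)
    next
      case 3 then show ?thesis using dis[of Y X] by (simp add: disjnt_def Int_commute)
    next
      case 4 then show ?thesis using partition_onD2[OF P] XY(3) by (auto simp: pairwise_def)
    qed
  qed
qed

text \<open>The other blocks of \<open>P\<close> are disjoint from \<open>B\<close> and hence from
  the support, so the touched blocks are exactly those in \<open>Q\<close>, and merging them
  restores \<open>B\<close>.\<close>

lemma facs_Suc_intro:
  assumes P: "partition_on S P" and B: "B \<in> P" and st: "(\<sigma>, Q) \<in> steps \<pi> B"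
    and F: "F \<in> facs S r (Q \<union> (P - {B})) (pinv \<sigma> \<circ> \<pi>)"
  shows "\<sigma> # F \<in> facs S (Suc r) P \<pi>" "{X \<in> blocks S F. X \<inter> moved \<sigma> \<noteq> {}} = Q" "\<Union>Q = B"
proof -
  have cyc: "is_cycle B \<sigma>" and Q: "partition_on B Q" and meet: "\<And>X. X \<in> Q \<Longrightarrow> X \<inter> moved \<sigma> \<noteq> {}"
    and c1: "card Q = card (orbit (pinv \<sigma> \<circ> \<pi>) ` moved \<sigma>)"
    and c2: "card (orbit \<pi> ` moved \<sigma>) + card Q = card (moved \<sigma>) + 1"
    using st by (auto simp: steps_def)
  have BS: "B \<subseteq> S" using B partition_onD1[OF P] by auto
  have bl: "blocks S F = Q \<union> (P - {B})" and pr: "product F = pinv \<sigma> \<circ> \<pi>" using F by (auto simp: facs_def)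
  have A: "moved \<sigma> \<subseteq> B" using cyc by (rule is_cycle_facts)
  have off: "Y \<inter> moved \<sigma> = {}" if "Y \<in> P - {B}" for Y
  proof -
    have "B \<inter> Y = {}" using that B partition_onD2[OF P] by (auto simp: pairwise_def disjnt_def)
    then show ?thesis using A by auto
  qed
  show eq: "{X \<in> blocks S F. X \<inter> moved \<sigma> \<noteq> {}} = Q"
    unfolding bl using off meet by blast
  have eq2: "{X \<in> blocks S F. X \<inter> moved \<sigma> = {}} = P - {B}"
    unfolding bl using off meet by blast
  show UQ: "\<Union>Q = B" using partition_onD1[OF Q] by simp
  have "merge (blocks S F) (moved \<sigma>) = P"
    unfolding merge_def eq eq2 UQ using B by auto
  moreover have "\<sigma> \<circ> product F = \<pi>"
    unfolding pr by (rule inv_comp_cancel(2)[OF is_cycle_facts(2)[OF cyc]])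
  moreover have "is_cycle S \<sigma>" using cyc BS by (auto simp: is_cycle_def)
  moreover have "tight_step \<sigma> (blocks S F) (product F)"
    unfolding tight_step_def eq \<open>\<sigma> \<circ> product F = \<pi>\<close> using c1 c2 pr by simp
  ultimately show "\<sigma> # F \<in> facs S (Suc r) P \<pi>"
    using F by (simp add: facs_def)
qed

text \<open>Conversely, the touched blocks of the shorter list unite to one block of
  \<open>P\<close>, and the conditions of \<open>tight_step\<close> turn into those of
  \<open>steps\<close> once the remaining product is written as
  \<open>pinv \<sigma> \<circ> \<pi>\<close>.\<close>

lemma facs_Suc_elim:
  assumes F: "\<sigma> # F \<in> facs S (Suc r) P \<pi>"
  defines "Q \<equiv> {X \<in> blocks S F. X \<inter> moved \<sigma> \<noteq> {}}"
  shows "\<Union>Q \<in> P" "(\<sigma>, Q) \<in> steps \<pi> (\<Union>Q)" "F \<in> facs S r (Q \<union> (P - {\<Union>Q})) (pinv \<sigma> \<circ> \<pi>)"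
proof -
  define P' where "P' = blocks S F"
  have cyc: "is_cycle S \<sigma>" and cycF: "\<forall>\<sigma>\<in>set F. is_cycle S \<sigma>" and tF: "tight S F"
    and ts: "tight_step \<sigma> P' (product F)" and m: "merge P' (moved \<sigma>) = P"
    and pr: "\<sigma> \<circ> product F = \<pi>" and len: "length F = r"
    using F by (auto simp: facs_def P'_def)
  have P': "partition_on S P'" unfolding P'_def by (rule blocks_partition[OF cycF])
  have Q: "Q = {X \<in> P'. X \<inter> moved \<sigma> \<noteq> {}}" by (simp add: Q_def P'_def)
  have prF: "product F = pinv \<sigma> \<circ> \<pi>"
    unfolding pr[symmetric] by (rule inv_comp_cancel(1)[OF is_cycle_facts(2)[OF cyc], symmetric])
  show "\<Union>Q \<in> P" unfolding m[symmetric] merge_def Q by simp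
  have A: "moved \<sigma> \<subseteq> \<Union>Q"
    using is_cycle_facts(1)[OF cyc] partition_onD1[OF P'] by (auto simp: Q)
  have "moved \<sigma> \<noteq> {}" by (rule is_cycle_facts[OF cyc])
  then have "\<Union>Q \<notin> {X \<in> P'. X \<inter> moved \<sigma> = {}}" using A by blast
  then have "P - {\<Union>Q} = {X \<in> P'. X \<inter> moved \<sigma> = {}}"
    unfolding m[symmetric] merge_def Q[symmetric] by (simp add: Diff_insert_absorb)
  then have "Q \<union> (P - {\<Union>Q}) = P'" by (auto simp: Q)
  then show "F \<in> facs S r (Q \<union> (P - {\<Union>Q})) (pinv \<sigma> \<circ> \<pi>)"
    using cycF tF len prF by (simp add: facs_def P'_def)
  have "is_cycle (\<Union>Q) \<sigma>" using cyc A by (simp add: is_cycle_def)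
  moreover have "partition_on (\<Union>Q) Q" by (rule partition_subset[OF P']) (auto simp: Q)
  moreover have "\<forall>X\<in>Q. X \<inter> moved \<sigma> \<noteq> {} \<and> (\<forall>x\<in>X. pinv \<sigma> (\<pi> x) \<in> X)"
    using blocks_closed[OF cycF] unfolding prF by (auto simp: Q P'_def)
  moreover have "card Q = card (orbit (pinv \<sigma> \<circ> \<pi>) ` moved \<sigma>)"
    "card (orbit \<pi> ` moved \<sigma>) + card Q = card (moved \<sigma>) + 1"
    using ts unfolding tight_step_def pr unfolding prF Q by simp_all
  ultimately show "(\<sigma>, Q) \<in> steps \<pi> (\<Union>Q)" by (simp add: steps_def)
qed

text \<open>All blocks touched by the removed factor merge into one block \<open>B\<close> of
  \<open>P\<close>, and \<open>Q\<close> is read off as the set of touched blocks. Lists therefore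
  correspond bijectively to a choice of \<open>B\<close>, a step on \<open>B\<close>, and a list for
  the refined partition.\<close>

lemma sum_facs_Suc:
  fixes q :: "nat \<Rightarrow> 'c::comm_semiring_1"
  assumes S: "finite S" and P: "partition_on S P"
  shows "(\<Sum>F\<in>facs S (Suc r) P \<pi>. wt q F) =
    (\<Sum>B\<in>P. \<Sum>(\<sigma>, Q)\<in>steps \<pi> B. q (card (moved \<sigma>)) *
       (\<Sum>F\<in>facs S r (Q \<union> (P - {B})) (pinv \<sigma> \<circ> \<pi>). wt q F))"
proof -
  define T where "T = (SIGMA B:P. SIGMA s:steps \<pi> B. facs S r (snd s \<union> (P - {B})) (pinv (fst s) \<circ> \<pi>))"
  have fP: "finite P" by (rule finite_elements[OF S P])
  have fB: "finite B" if "B \<in> P" for B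
    using that S partition_onD1[OF P] by (metis Union_upper finite_subset)
  have "(\<Sum>F\<in>facs S (Suc r) P \<pi>. wt q F) = (\<Sum>(B, s, F)\<in>T. q (card (moved (fst s))) * wt q F)"
  proof (rule sum.reindex_bij_witness[where i = "\<lambda>(B, s, F). fst s # F" and
        j = "\<lambda>F. let Q = {X \<in> blocks S (tl F). X \<inter> moved (hd F) \<noteq> {}} in (\<Union>Q, (hd F, Q), tl F)"])
    fix F assume F: "F \<in> facs S (Suc r) P \<pi>"
    then obtain \<sigma> F' where [simp]: "F = \<sigma> # F'" by (auto simp: facs_def length_Suc_conv)
    note e = facs_Suc_elim[OF F[simplified]]
    show "(case let Q = {X \<in> blocks S (tl F). X \<inter> moved (hd F) \<noteq> {}} in (\<Union>Q, (hd F, Q), tl F) of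
        (B, s, F) \<Rightarrow> fst s # F) = F" by (simp add: Let_def)
    show "(let Q = {X \<in> blocks S (tl F). X \<inter> moved (hd F) \<noteq> {}} in (\<Union>Q, (hd F, Q), tl F)) \<in> T"
      using e by (simp add: Let_def T_def)
    show "(case let Q = {X \<in> blocks S (tl F). X \<inter> moved (hd F) \<noteq> {}} in (\<Union>Q, (hd F, Q), tl F) of
        (B, s, F) \<Rightarrow> q (card (moved (fst s))) * wt q F) = wt q F"
      by (simp add: Let_def wt_def)
  next
    fix t assume "t \<in> T"
    then obtain B \<sigma> Q F where [simp]: "t = (B, (\<sigma>, Q), F)" and B: "B \<in> P"
      and st: "(\<sigma>, Q) \<in> steps \<pi> B" and F: "F \<in> facs S r (Q \<union> (P - {B})) (pinv \<sigma> \<circ> \<pi>)"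
      by (auto simp: T_def)
    note i = facs_Suc_intro[OF P B st F]
    show "(case t of (B, s, F) \<Rightarrow> fst s # F) \<in> facs S (Suc r) P \<pi>" using i by simp
    show "(let Q = {X \<in> blocks S (tl (case t of (B, s, F) \<Rightarrow> fst s # F)).
                X \<inter> moved (hd (case t of (B, s, F) \<Rightarrow> fst s # F)) \<noteq> {}}
          in (\<Union>Q, (hd (case t of (B, s, F) \<Rightarrow> fst s # F), Q), tl (case t of (B, s, F) \<Rightarrow> fst s # F))) = t"
      using i by simp
  qed
  also have "\<dots> = (\<Sum>B\<in>P. \<Sum>(s, F)\<in>(SIGMA s:steps \<pi> B. facs S r (snd s \<union> (P - {B})) (pinv (fst s) \<circ> \<pi>)).
       q (card (moved (fst s))) * wt q F)"
    unfolding T_def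
    by (rule sum.Sigma[symmetric]) (use fP fB S in \<open>auto intro!: finite_steps finite_facs\<close>)
  also have "\<dots> = (\<Sum>B\<in>P. \<Sum>s\<in>steps \<pi> B.
       \<Sum>F\<in>facs S r (snd s \<union> (P - {B})) (pinv (fst s) \<circ> \<pi>). q (card (moved (fst s))) * wt q F)"
    by (intro sum.cong refl sum.Sigma[symmetric]) (use fB S in \<open>auto intro!: finite_steps finite_facs\<close>)
  also have "\<dots> = (\<Sum>B\<in>P. \<Sum>(\<sigma>, Q)\<in>steps \<pi> B. q (card (moved \<sigma>)) *
       (\<Sum>F\<in>facs S r (Q \<union> (P - {B})) (pinv \<sigma> \<circ> \<pi>). wt q F))"
    by (simp add: sum_distrib_left split_def)
  finally show ?thesis .
qed

text \<open>The bound two survives every step, see \<open>block_orbits_le_2\<close>, so the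
  differential system closes on these blocks.\<close>

definition adm :: "('a \<Rightarrow> 'a) \<Rightarrow> 'a set \<Rightarrow> bool" where
  "adm \<pi> B \<longleftrightarrow> finite B \<and> B \<noteq> {} \<and> permutation \<pi> \<and> (\<forall>x\<in>B. \<pi> x \<in> B) \<and> card (orbit \<pi> ` B) \<le> 2"

lemma step_outside:
  assumes "\<sigma> permutes moved \<sigma>" "moved \<sigma> \<subseteq> B" "X \<inter> B = {}" "x \<in> X" "\<pi> x \<in> X"
  shows "(pinv \<sigma> \<circ> \<pi>) x = \<pi> x"
proof -
  have "pinv \<sigma> (\<pi> x) = \<pi> x"
    using permutes_not_in[OF permutes_inv[OF assms(1)]] assms(2-5) by blast
  then show ?thesis by simp
qed

lemma orbit_image_cong:
  assumes "\<And>x. x \<in> X \<Longrightarrow> f x \<in> X" "\<And>x. x \<in> X \<Longrightarrow> g x = f x"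
  shows "orbit g ` X = orbit f ` X"
  by (intro image_cong refl orbit_cong0[where A = X]) (use assms in auto)

text \<open>The Leibniz rule for the product over blocks selects the block that contains the removed
  factor, and \<open>ode\<close> replaces its series by the product over the parts into which it
  falls. The factorial accounts for interleaving the factors on different blocks. The induction on
  \<open>r\<close> covers all permutations and partitions at once, since both change with a removal;
  \<open>local\<close> carries the untouched blocks over to the new permutation.\<close>

lemma facs_sum_eq_coeff:
  fixes q :: "nat \<Rightarrow> 'c::{idom, ring_char_0}" and f :: "('a \<Rightarrow> 'a) \<Rightarrow> 'a set \<Rightarrow> 'c poly"
  assumes ode: "\<And>\<pi> B. adm \<pi> B \<Longrightarrow>
      pderiv (f \<pi> B) = (\<Sum>(\<sigma>, Q)\<in>steps \<pi> B. [:q (card (moved \<sigma>)):] * (\<Prod>X\<in>Q. f (pinv \<sigma> \<circ> \<pi>) X))"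
    and closed: "\<And>(\<pi> :: 'a \<Rightarrow> 'a) B \<sigma> Q X. adm \<pi> B \<Longrightarrow> (\<sigma>, Q) \<in> steps \<pi> B \<Longrightarrow> X \<in> Q \<Longrightarrow>
      card (orbit (pinv \<sigma> \<circ> \<pi>) ` X) \<le> 2"
    and local: "\<And>\<pi> \<pi>' X. (\<And>x. x \<in> X \<Longrightarrow> \<pi> x \<in> X) \<Longrightarrow> (\<And>x. x \<in> X \<Longrightarrow> \<pi>' x = \<pi> x) \<Longrightarrow> f \<pi>' X = f \<pi> X"
    and init: "\<And>\<pi> B. adm \<pi> B \<Longrightarrow> coeff (f \<pi> B) 0 = (if card B = 1 then 1 else 0)"
    and S: "finite S" and \<pi>: "\<pi> permutes S" and P: "partition_on S P"
    and a: "\<And>B. B \<in> P \<Longrightarrow> adm \<pi> B"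
  shows "fact r * coeff (\<Prod>B\<in>P. f \<pi> B) r = (\<Sum>F\<in>facs S r P \<pi>. wt q F)"
  using \<pi> P a
proof (induction r arbitrary: \<pi> P)
  case 0
  have fP: "finite P" by (rule finite_elements[OF S 0(2)])
  have "coeff (\<Prod>B\<in>P. f \<pi> B) 0 = (\<Prod>B\<in>P. coeff (f \<pi> B) 0)"
    by (simp add: poly_0_coeff_0[symmetric] poly_prod)
  also have "\<dots> = (\<Prod>B\<in>P. if card B = 1 then 1 else 0)"
    by (rule prod.cong) (use init 0(3) in auto)
  also have "\<dots> = (if \<forall>B\<in>P. card B = 1 then 1 else 0)"
    using fP by (auto intro: prod.neutral)
  also have "\<dots> = (\<Sum>F\<in>facs S 0 P \<pi>. wt q F)"
  proof (cases "\<forall>B\<in>P. card B = 1")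
    case True
    have Pe: "P = (\<lambda>x. {x}) ` S"
    proof (intro equalityI subsetI)
      fix B assume B: "B \<in> P"
      then obtain x where "B = {x}" using True card_1_singletonE by blast
      then show "B \<in> (\<lambda>x. {x}) ` S" using B partition_onD1[OF 0(2)] by auto
    next
      fix B assume "B \<in> (\<lambda>x. {x}) ` S"
      then obtain x where x: "x \<in> S" "B = {x}" by auto
      then obtain C where C: "C \<in> P" "x \<in> C" using partition_onD1[OF 0(2)] by auto
      then obtain y where "C = {y}" using True card_1_singletonE by blast
      then show "B \<in> P" using C x by auto
    qed
    have "\<pi> = id"
    proof
      fix x show "\<pi> x = id x"
      proof (cases "x \<in> S")
        case True
        then have "{x} \<in> P" using Pe by auto
        then show ?thesis using 0(3) by (force simp: adm_def)
      next
        case False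
        then show ?thesis using permutes_not_in[OF 0(1)] by simp
      qed
    qed
    then have "facs S 0 P \<pi> = {[]}" using Pe by (auto simp: facs_def)
    then show ?thesis using True by (simp add: wt_def)
  next
    case False
    then have "P \<noteq> (\<lambda>x. {x}) ` S" by auto
    then have "facs S 0 P \<pi> = {}" by (auto simp: facs_def)
    then show ?thesis using False by auto
  qed
  finally show ?case by simp
next
  case (Suc r)
  have fP: "finite P" by (rule finite_elements[OF S Suc(3)])
  \<comment> \<open>Differentiation absorbs the factor \<open>Suc r\<close> of the
    factorial.\<close>
  have "fact (Suc r) * coeff (\<Prod>B\<in>P. f \<pi> B) (Suc r) = fact r * coeff (pderiv (\<Prod>B\<in>P. f \<pi> B)) r"
    by (simp add: coeff_pderiv algebra_simps)
  also have "\<dots> = (\<Sum>B\<in>P. fact r * coeff ((\<Prod>X\<in>P - {B}. f \<pi> X) * pderiv (f \<pi> B)) r)"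
    by (simp add: pderiv_prod coeff_sum sum_distrib_left)
  also have "\<dots> = (\<Sum>B\<in>P. \<Sum>(\<sigma>, Q)\<in>steps \<pi> B. q (card (moved \<sigma>)) *
       (\<Sum>F\<in>facs S r (Q \<union> (P - {B})) (pinv \<sigma> \<circ> \<pi>). wt q F))"
  proof (rule sum.cong[OF refl])
    fix B assume B: "B \<in> P"
    have aB: "adm \<pi> B" using Suc(4) B .
    have BS: "B \<subseteq> S" using B partition_onD1[OF Suc(3)] by auto
    have key: "fact r * coeff ((\<Prod>X\<in>P - {B}. f \<pi> X) * ([:q (card (moved \<sigma>)):] * (\<Prod>X\<in>Q. f (pinv \<sigma> \<circ> \<pi>) X))) r
       = q (card (moved \<sigma>)) * (\<Sum>F\<in>facs S r (Q \<union> (P - {B})) (pinv \<sigma> \<circ> \<pi>). wt q F)"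
      if st: "(\<sigma>, Q) \<in> steps \<pi> B" for \<sigma> Q
    proof -
      let ?p = "pinv \<sigma> \<circ> \<pi>"
      have cyc: "is_cycle B \<sigma>" and Q: "partition_on B Q"
        and clQ: "\<And>X x. X \<in> Q \<Longrightarrow> x \<in> X \<Longrightarrow> ?p x \<in> X"
        using st by (auto simp: steps_def)
      have cS: "is_cycle S \<sigma>" using cyc BS by (auto simp: is_cycle_def)
      note ref = partition_refine[OF Suc(3) B Q]
      have pS: "?p permutes S"
        using permutes_compose[OF Suc(2) permutes_inv[OF is_cycle_facts(6)[OF cS]]] .
      then have pp: "permutation ?p" using S permutation_permutes by auto
      have fB: "finite B" using aB by (simp add: adm_def)
      have out: "?p x = \<pi> x" "\<pi> x \<in> X" if "X \<in> P - {B}" "x \<in> X" for X x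
      proof -
        show x: "\<pi> x \<in> X" using Suc(4)[of X] that by (auto simp: adm_def)
        have "X \<inter> B = {}"
          using that B partition_onD2[OF Suc(3)] by (auto simp: pairwise_def disjnt_def)
        then show "?p x = \<pi> x"
          using step_outside[OF is_cycle_facts(2,1)[OF cyc]] that x by blast
      qed
      have adm': "adm ?p X" if "X \<in> Q \<union> (P - {B})" for X
      proof (cases "X \<in> Q")
        case True
        have "X \<subseteq> B" using True partition_onD1[OF Q] by auto
        then have "finite X" using fB finite_subset by auto
        moreover have "X \<noteq> {}" using True partition_onD3[OF Q] by auto
        ultimately show ?thesis
          using closed[OF aB st True] clQ[OF True] pp by (simp add: adm_def)
      next
        case False
        then have X: "X \<in> P - {B}" using that by auto
        then have aX: "adm \<pi> X" using Suc(4) by auto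
        have "orbit ?p ` X = orbit \<pi> ` X"
          by (rule orbit_image_cong) (use out[OF X] in auto)
        then show ?thesis using aX out[OF X] pp by (simp add: adm_def)
      qed
      have "(\<Prod>X\<in>P - {B}. f \<pi> X) = (\<Prod>X\<in>P - {B}. f ?p X)"
        by (intro prod.cong refl local[symmetric]) (use out in auto)
      then have "(\<Prod>X\<in>P - {B}. f \<pi> X) * (\<Prod>X\<in>Q. f ?p X) = (\<Prod>X\<in>Q \<union> (P - {B}). f ?p X)"
        using fP finite_elements[OF fB Q] ref(2) by (subst prod.union_disjoint) (auto simp: mult.commute)
      then have eq: "(\<Prod>X\<in>P - {B}. f \<pi> X) * ([:q (card (moved \<sigma>)):] * (\<Prod>X\<in>Q. f ?p X))
        = smult (q (card (moved \<sigma>))) (\<Prod>X\<in>Q \<union> (P - {B}). f ?p X)"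
        by (simp add: mult.left_commute)
      have IH: "fact r * coeff (\<Prod>X\<in>Q \<union> (P - {B}). f ?p X) r =
        (\<Sum>F\<in>facs S r (Q \<union> (P - {B})) ?p. wt q F)"
        by (rule Suc.IH[OF pS ref(1) adm'])
      show ?thesis
        unfolding eq coeff_smult IH[symmetric] by (rule mult.left_commute)
    qed
    show "fact r * coeff ((\<Prod>X\<in>P - {B}. f \<pi> X) * pderiv (f \<pi> B)) r =
      (\<Sum>(\<sigma>, Q)\<in>steps \<pi> B. q (card (moved \<sigma>)) *
       (\<Sum>F\<in>facs S r (Q \<union> (P - {B})) (pinv \<sigma> \<circ> \<pi>). wt q F))"
    proof -
      have lin: "fact r * coeff (u * (\<Sum>s\<in>T. g s)) r = (\<Sum>s\<in>T. fact r * coeff (u * g s) r)"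
        for u :: "'c poly" and g :: "('a \<Rightarrow> 'a) \<times> 'a set set \<Rightarrow> 'c poly" and T
        by (simp only: sum_distrib_left coeff_sum)
      show ?thesis
        unfolding ode[OF aB] lin
      proof (rule sum.cong[OF refl])
        fix s assume "s \<in> steps \<pi> B"
        then show "fact r * coeff ((\<Prod>X\<in>P - {B}. f \<pi> X) *
            (case s of (\<sigma>, Q) \<Rightarrow> [:q (card (moved \<sigma>)):] * (\<Prod>X\<in>Q. f (pinv \<sigma> \<circ> \<pi>) X))) r =
          (case s of (\<sigma>, Q) \<Rightarrow> q (card (moved \<sigma>)) *
            (\<Sum>F\<in>facs S r (Q \<union> (P - {B})) (pinv \<sigma> \<circ> \<pi>). wt q F))"
          using key[of "fst s" "snd s"] by (simp only: split_def prod.collapse)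
      qed
    qed
  qed
  also have "\<dots> = (\<Sum>F\<in>facs S (Suc r) P \<pi>. wt q F)"
    by (rule sum_facs_Suc[OF S Suc(3), symmetric])
  finally show ?case .
qed

section \<open>First-return maps of a cycle and compositions of its length\<close>

section \<open>First-return maps of a cycle\<close>

lemma card_orbit:
  assumes "permutation p"
  shows "(p ^^ card (orbit p x)) x = x" "0 < card (orbit p x)"
    "inj_on (\<lambda>n. (p ^^ n) x) {..<card (orbit p x)}"
    "orbit p x = (\<lambda>n. (p ^^ n) x) ` {..<card (orbit p x)}"
proof -
  have x: "x \<in> orbit p x" by (rule permutation_self_in_orbit[OF assms])
  have "card (orbit p x) = card ((\<lambda>n. (p ^^ n) x) ` {0..<funpow_dist1 p x x})"
    by (simp only: orbit_conv_funpow_dist1[OF x, symmetric])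
  also have "\<dots> = funpow_dist1 p x x"
    by (subst card_image[OF inj_on_funpow_dist1[OF x]]) simp
  finally have *: "card (orbit p x) = funpow_dist1 p x x" .
  show "(p ^^ card (orbit p x)) x = x" unfolding * by (rule funpow_dist1_prop[OF x])
  show "0 < card (orbit p x)" unfolding * by simp
  show "inj_on (\<lambda>n. (p ^^ n) x) {..<card (orbit p x)}"
    unfolding * using inj_on_funpow_dist1[OF x] by (simp only: lessThan_atLeast0)
  show "orbit p x = (\<lambda>n. (p ^^ n) x) ` {..<card (orbit p x)}"
    unfolding * using orbit_conv_funpow_dist1[OF x] by (simp only: lessThan_atLeast0)
qed

text \<open>Given a cycle \<open>\<pi>\<close> on \<open>C\<close>, the pairs below are exactly the first-return maps \<open>\<rho>\<close> of \<open>\<pi>\<close> to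
  subsets \<open>A\<close> containing \<open>a\<close>; the orbits of \<open>\<rho>\<inverse>\<pi>\<close> are the arcs into which \<open>A\<close> cuts the cycle.\<close>

definition arcs :: "'a set \<Rightarrow> ('a \<Rightarrow> 'a) \<Rightarrow> 'a \<Rightarrow> nat \<Rightarrow> ('a set \<times> ('a \<Rightarrow> 'a)) set" where
  "arcs C \<pi> a k = {(A, \<rho>). A \<subseteq> C \<and> a \<in> A \<and> card A = k \<and> \<rho> permutes A \<and> cyclic_on \<rho> A \<and>
     inj_on (orbit (pinv \<rho> \<circ> \<pi>)) A}"

definition comps :: "nat \<Rightarrow> nat \<Rightarrow> nat list set" where
  "comps n k = {gs. length gs = k \<and> sum_list gs = n \<and> (\<forall>g\<in>set gs. 0 < g)}"

text \<open>By injectivity the orbit of \<open>p\<close> through \<open>x\<close> meets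
  \<open>A\<close> only in \<open>x\<close>. Hence \<open>\<pi> = \<rho> \<circ> p\<close> follows
  \<open>p\<close> along this orbit and feels \<open>\<rho>\<close> only when the orbit closes:
  \<open>\<rho> x\<close> is the first return to \<open>A\<close>, and the return time is the length
  of the arc.\<close>

lemma return_steps:
  assumes \<pi>: "permutation \<pi>" and \<rho>: "\<rho> permutes A" and fin: "finite A"
    and inj: "inj_on (orbit (pinv \<rho> \<circ> \<pi>)) A" and x: "x \<in> A"
  defines "p \<equiv> pinv \<rho> \<circ> \<pi>"
  shows "(\<pi> ^^ card (orbit p x)) x = \<rho> x"
    and "j < card (orbit p x) \<Longrightarrow> (\<pi> ^^ j) x = (p ^^ j) x"
    and "0 < j \<Longrightarrow> j < card (orbit p x) \<Longrightarrow> (p ^^ j) x \<notin> A"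
proof -
  have p: "permutation p"
    unfolding p_def by (rule permutation_comp_permutes[OF \<pi> permutes_inv[OF \<rho>] fin])
  note co = card_orbit[OF p, of x]
  show out: "(p ^^ j) x \<notin> A" if "0 < j" "j < card (orbit p x)" for j
  proof
    assume y: "(p ^^ j) x \<in> A"
    have "(p ^^ j) x \<in> orbit p x"
      using permutation_self_in_orbit[OF p] by (rule funpow_in_orbit)
    then have "orbit p ((p ^^ j) x) = orbit p x" by (simp add: in_orbit_iff[OF p])
    then have "(p ^^ j) x = x" using inj y x by (simp add: inj_on_def p_def)
    then have "j = 0" using inj_onD[OF co(3), of j 0] that by simp
    then show False using that by simp
  qed
  have \<rho>p: "\<rho> \<circ> p = \<pi>" unfolding p_def by (rule inv_comp_cancel[OF \<rho>])
  show "(\<pi> ^^ card (orbit p x)) x = \<rho> x"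
    using funpow_follow(2)[OF \<rho> out co(2)] unfolding \<rho>p co(1) by simp
  show "(\<pi> ^^ j) x = (p ^^ j) x" if "j < card (orbit p x)"
    using funpow_follow(1)[OF \<rho> out that] unfolding \<rho>p by simp
qed

text \<open>An orbit of \<open>p\<close> that missed \<open>A\<close> would be an orbit of
  \<open>\<pi>\<close>, hence all of \<open>C\<close>, which contains \<open>A\<close>.\<close>

lemma orbits_cover_cycle:
  assumes \<pi>: "permutation \<pi>" "cyclic_on \<pi> C" and \<rho>: "\<rho> permutes A" and A: "A \<subseteq> C" "A \<noteq> {}"
  defines "p \<equiv> pinv \<rho> \<circ> \<pi>"
  shows "(\<Union>x\<in>A. orbit p x) = C" and "\<And>x. x \<in> C \<Longrightarrow> p x \<in> C"
proof -
  have fin: "finite A" using A finite_cyclic_on[OF \<pi>(2)] finite_subset by auto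
  have p: "permutation p"
    unfolding p_def by (rule permutation_comp_permutes[OF \<pi>(1) permutes_inv[OF \<rho>] fin])
  show cl: "p x \<in> C" if "x \<in> C" for x
  proof -
    have "\<pi> x \<in> C" using cyclic_on_inI[OF \<pi>(2) that] .
    then show ?thesis
      using permutes_subset[OF permutes_inv[OF \<rho>] A(1)] permutes_in_image
      unfolding p_def by fastforce
  qed
  show "(\<Union>x\<in>A. orbit p x) = C"
  proof (intro equalityI subsetI)
    fix y assume "y \<in> (\<Union>x\<in>A. orbit p x)"
    then show "y \<in> C" using closed_orbit_subset[of C p] cl A(1) by blast
  next
    fix y assume y: "y \<in> C"
    have "orbit p y \<inter> A \<noteq> {}"
    proof
      assume e: "orbit p y \<inter> A = {}"
      have "orbit (\<rho> \<circ> p) y = orbit p y" by (rule orbit_comp_disjoint[OF p \<rho> e])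
      moreover have "\<rho> \<circ> p = \<pi>" unfolding p_def by (rule inv_comp_cancel[OF \<rho>])
      ultimately have "orbit p y = C" using orbit_cyclic_eq3[OF \<pi>(2) y] by simp
      then show False using e A by auto
    qed
    then obtain x where x: "x \<in> A" "x \<in> orbit p y" by auto
    then have "orbit p x = orbit p y" by (simp add: in_orbit_iff[OF p])
    then have "y \<in> orbit p x" using permutation_self_in_orbit[OF p] by auto
    then show "y \<in> (\<Union>x\<in>A. orbit p x)" using x by auto
  qed
qed

definition arc_lengths :: "('a \<Rightarrow> 'a) \<Rightarrow> 'a \<Rightarrow> nat \<Rightarrow> ('a \<Rightarrow> 'a) \<Rightarrow> nat list" where
  "arc_lengths \<pi> a k \<rho> = map (\<lambda>i. card (orbit (pinv \<rho> \<circ> \<pi>) ((\<rho> ^^ i) a))) [0..<k]"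

text \<open>The partial sums of the arc lengths are the times at which \<open>\<pi>\<close> visits
  the points of \<open>A\<close>, so the lengths determine these points. They add up to
  \<open>card C\<close> because the arcs partition the cycle.\<close>

lemma arcs_facts:
  assumes \<pi>: "permutation \<pi>" "cyclic_on \<pi> C" and A: "(A, \<rho>) \<in> arcs C \<pi> a k"
  shows "bij_betw (\<lambda>i. (\<rho> ^^ i) a) {..<k} A" "i < k \<Longrightarrow> (\<rho> ^^ i) a \<in> A"
    and "i \<le> k \<Longrightarrow> (\<pi> ^^ sum_list (take i (arc_lengths \<pi> a k \<rho>))) a = (\<rho> ^^ i) a"
    and "arc_lengths \<pi> a k \<rho> \<in> comps (card C) k"
proof -
  let ?p = "pinv \<rho> \<circ> \<pi>"
  have AC: "A \<subseteq> C" and a: "a \<in> A" and k: "card A = k" and \<rho>: "\<rho> permutes A" and cyc: "cyclic_on \<rho> A"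
    and inj: "inj_on (orbit ?p) A" using A by (auto simp: arcs_def)
  have finA: "finite A" using cyc by (rule finite_cyclic_on)
  have \<rho>p: "permutation \<rho>" using \<rho> finA permutation_permutes by auto
  have orbA: "orbit \<rho> a = A" using cyc a by (rule orbit_cyclic_eq3)
  show bij: "bij_betw (\<lambda>i. (\<rho> ^^ i) a) {..<k} A"
    using card_orbit(3,4)[OF \<rho>p, of a] unfolding orbA k bij_betw_def by simp
  show inA: "(\<rho> ^^ i) a \<in> A" for i
    using cyclic_on_funpow_in[OF cyc a] .
  show "(\<pi> ^^ sum_list (take i (arc_lengths \<pi> a k \<rho>))) a = (\<rho> ^^ i) a" if "i \<le> k"
    using that
  proof (induction i)
    case (Suc i)
    let ?g = "arc_lengths \<pi> a k \<rho> ! i"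
    have len: "i < length (arc_lengths \<pi> a k \<rho>)" using Suc by (simp add: arc_lengths_def)
    have g: "?g = card (orbit ?p ((\<rho> ^^ i) a))" using Suc by (simp add: arc_lengths_def)
    have "(\<pi> ^^ sum_list (take (Suc i) (arc_lengths \<pi> a k \<rho>))) a
        = (\<pi> ^^ ?g) ((\<pi> ^^ sum_list (take i (arc_lengths \<pi> a k \<rho>))) a)"
      using len by (simp add: take_Suc_conv_app_nth funpow_add add.commute)
    also have "\<dots> = \<rho> ((\<rho> ^^ i) a)"
      using Suc return_steps(1)[OF \<pi>(1) \<rho> finA inj inA] g by simp
    finally show ?case by (simp add: funpow.simps(2))
  qed simp
  have p: "permutation ?p"
    by (rule permutation_comp_permutes[OF \<pi>(1) permutes_inv[OF \<rho>] finA])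
  have "sum_list (arc_lengths \<pi> a k \<rho>) = (\<Sum>i<k. card (orbit ?p ((\<rho> ^^ i) a)))"
    unfolding arc_lengths_def by (simp add: sum_list_sum_nth lessThan_atLeast0)
  also have "\<dots> = (\<Sum>x\<in>A. card (orbit ?p x))"
    by (rule sum.reindex_bij_betw[OF bij])
  also have "\<dots> = card (\<Union>x\<in>A. orbit ?p x)"
  proof (rule card_UN_disjoint[symmetric])
    show "\<forall>x\<in>A. finite (orbit ?p x)"
      using finite_orbit permutation_self_in_orbit[OF p] by metis
    show "\<forall>x\<in>A. \<forall>y\<in>A. x \<noteq> y \<longrightarrow> orbit ?p x \<inter> orbit ?p y = {}"
    proof (intro ballI impI)
      fix x y assume "x \<in> A" "y \<in> A" "x \<noteq> y"
      then have "orbit ?p x \<noteq> orbit ?p y" using inj by (auto dest: inj_onD)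
      then show "orbit ?p x \<inter> orbit ?p y = {}" by (rule orbit_disjoint[OF p])
    qed
  qed (rule finA)
  also have "\<dots> = card C"
    using orbits_cover_cycle(1)[OF \<pi> \<rho> AC] a by auto
  finally show "arc_lengths \<pi> a k \<rho> \<in> comps (card C) k"
    using card_orbit(2)[OF p] by (auto simp: comps_def arc_lengths_def)
qed

lemma arcs_inj:
  assumes \<pi>: "permutation \<pi>" "cyclic_on \<pi> C"
    and 1: "(A, \<rho>) \<in> arcs C \<pi> a k" and 2: "(A', \<rho>') \<in> arcs C \<pi> a k"
    and eq: "arc_lengths \<pi> a k \<rho> = arc_lengths \<pi> a k \<rho>'"
  shows "A = A'" "\<rho> = \<rho>'"
proof -
  have pw: "(\<rho> ^^ i) a = (\<rho>' ^^ i) a" if "i \<le> k" for i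
    using arcs_facts(3)[OF \<pi> 1 that] arcs_facts(3)[OF \<pi> 2 that] eq by simp
  have A: "A = (\<lambda>i. (\<rho> ^^ i) a) ` {..<k}" "A' = (\<lambda>i. (\<rho>' ^^ i) a) ` {..<k}"
    using arcs_facts(1)[OF \<pi> 1] arcs_facts(1)[OF \<pi> 2] by (auto simp: bij_betw_def)
  show AA: "A = A'" unfolding A by (intro image_cong refl) (simp add: pw)
  have perm: "\<rho> permutes A" "\<rho>' permutes A'" using 1 2 by (auto simp: arcs_def)
  show "\<rho> = \<rho>'"
  proof
    fix x show "\<rho> x = \<rho>' x"
    proof (cases "x \<in> A")
      case True
      then obtain i where i: "i < k" "x = (\<rho> ^^ i) a" using A(1) by auto
      then show ?thesis using pw[of i] pw[of "Suc i"] by (simp add: funpow.simps(2))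
    next
      case False
      then show ?thesis using perm AA permutes_not_in by metis
    qed
  qed
qed

text \<open>The cut points are placed along the cycle at the partial sums of the composition,
  starting from \<open>a\<close>, and \<open>\<rho>\<close> runs through them in this order.\<close>

lemma arcs_surj:
  assumes \<pi>: "permutation \<pi>" "cyclic_on \<pi> C" and a: "a \<in> C" and gs: "gs \<in> comps (card C) k" and k: "0 < k"
  obtains A \<rho> where "(A, \<rho>) \<in> arcs C \<pi> a k" "arc_lengths \<pi> a k \<rho> = gs"
proof -
  define n where "n = card C"
  define s where "s = (\<lambda>i. sum_list (take i gs))"
  define e where "e = (\<lambda>i. (\<pi> ^^ s i) a)"
  have len: "length gs = k" and sum: "sum_list gs = n" and pos: "\<And>i. i < k \<Longrightarrow> 0 < gs ! i"
    using gs by (auto simp: comps_def n_def)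
  have orbC: "orbit \<pi> a = C" using \<pi>(2) a by (rule orbit_cyclic_eq3)
  note co = card_orbit[OF \<pi>(1), of a, unfolded orbC, folded n_def]
  have s0: "s 0 = 0" and sk: "s k = n" using len sum by (auto simp: s_def)
  have sS: "s (Suc i) = s i + gs ! i" if "i < k" for i
    using that len by (simp add: s_def take_Suc_conv_app_nth)
  have mono: "s i < s j" if "i < j" "j \<le> k" for i j
    using that
  proof (induction j)
    case (Suc j)
    then show ?case using sS[of j] pos[of j] by (cases "i = j") auto
  qed simp
  have sn: "s i < n" if "i < k" for i using mono[of i k] that sk by simp
  have e0: "e 0 = a" "e k = a" using s0 sk co(1) by (simp_all add: e_def)
  have e_inj: "inj_on e {..<k}"
  proof (rule inj_onI)
    fix i j assume ij: "i \<in> {..<k}" "j \<in> {..<k}" "e i = e j"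
    then have "s i = s j" using inj_onD[OF co(3), of "s i" "s j"] sn by (simp add: e_def)
    then show "i = j" using mono[of i j] mono[of j i] ij by (cases i j rule: linorder_cases) auto
  qed
  define A where "A = e ` {..<k}"
  \<comment> \<open>As \<open>e k = a\<close>, the last cut point is sent to \<open>a\<close>, which
    closes the cycle.\<close>
  define \<rho> where "\<rho> = (\<lambda>x. if x \<in> A then e (Suc (the_inv_into {..<k} e x)) else x)"
  have \<rho>e: "\<rho> (e i) = e (Suc i)" if "i < k" for i
    using that the_inv_into_f_f[OF e_inj, of i] by (simp add: \<rho>_def A_def)
  have cA: "card A = k" unfolding A_def using card_image[OF e_inj] by simp
  have aA: "a \<in> A" unfolding A_def using e0 k by force
  have eA: "e i \<in> A" if "i \<le> k" for i
    using that aA e0 by (cases "i = k") (auto simp: A_def)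
  have finA: "finite A" by (simp add: A_def)
  have pw: "(\<rho> ^^ i) a = e i" if "i \<le> k" for i
    using that by (induction i) (simp_all add: e0 \<rho>e funpow.simps(2))
  have "\<rho> ` A = A"
  proof (intro equalityI subsetI)
    fix y assume "y \<in> \<rho> ` A"
    then show "y \<in> A" using \<rho>e eA by (auto simp: A_def Suc_leI)
  next
    fix y assume "y \<in> A"
    then obtain i where i: "i < k" "y = e i" by (auto simp: A_def)
    show "y \<in> \<rho> ` A"
    proof (cases i)
      case 0
      then have "y = \<rho> (e (k - 1))" using i \<rho>e[of "k - 1"] e0 k by simp
      then show ?thesis using eA[of "k - 1"] by simp
    next
      case (Suc j)
      then have "y = \<rho> (e j)" using i \<rho>e[of j] by simp
      then show ?thesis using eA[of j] Suc i by simp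
    qed
  qed
  then have "bij_betw \<rho> A A" using finA by (simp add: bij_betw_def finite_surj_inj)
  then have \<rho>: "\<rho> permutes A" by (rule bij_imp_permutes) (simp add: \<rho>_def)
  have "orbit \<rho> a = {(\<rho> ^^ m) a |m. m < k}"
    by (rule orbit_altdef_bounded) (use pw[of k] e0 k in auto)
  also have "\<dots> = (\<lambda>m. (\<rho> ^^ m) a) ` {..<k}" by auto
  also have "\<dots> = A" unfolding A_def by (intro image_cong refl) (simp add: pw)
  finally have cyc: "cyclic_on \<rho> A" using aA by (auto simp: cyclic_on_def)
  have AC: "A \<subseteq> C" unfolding A_def e_def using cyclic_on_funpow_in[OF \<pi>(2) a] by auto
  define p where "p = pinv \<rho> \<circ> \<pi>"
  have p: "permutation p"
    unfolding p_def by (rule permutation_comp_permutes[OF \<pi>(1) permutes_inv[OF \<rho>] finA])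
  have shift: "(\<pi> ^^ j) (e i) = (\<pi> ^^ (s i + j)) a" for i j
    by (simp add: e_def add.commute[of "s i"] funpow_add)
  \<comment> \<open>A visit to \<open>A\<close> strictly between two consecutive cut times would
    make that time a cut time too, because times below \<open>n\<close> determine the points of the
    cycle.\<close>
  have out: "(\<pi> ^^ j) (e i) \<notin> A" if i: "i < k" and j: "0 < j" "j < gs ! i" for i j
  proof
    assume "(\<pi> ^^ j) (e i) \<in> A"
    then obtain l where l: "l < k" "(\<pi> ^^ (s i + j)) a = (\<pi> ^^ s l) a"
      unfolding shift by (auto simp: A_def e_def)
    have "s i + j < s (Suc i)" using sS[OF i] j by simp
    moreover have "s (Suc i) \<le> n" using mono[of "Suc i" k] i sk by (cases "Suc i = k") auto
    ultimately have eq: "s i + j = s l"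
      using inj_onD[OF co(3) l(2)] sn[OF l(1)] by simp
    have "i < l" using eq j mono[of l i] i by (cases i l rule: linorder_cases) auto
    moreover have "l < Suc i"
      using eq \<open>s i + j < s (Suc i)\<close> mono[of "Suc i" l] l by (cases l "Suc i" rule: linorder_cases) auto
    ultimately show False by simp
  qed
  have foll: "(p ^^ j) (e i) = (\<pi> ^^ j) (e i)" if "i < k" "j < gs ! i" for i j
    unfolding p_def by (rule funpow_follow(1)[OF permutes_inv[OF \<rho>] out[OF that(1)] that(2)])
  have ret: "(p ^^ (gs ! i)) (e i) = e i" if "i < k" for i
  proof -
    have "(p ^^ (gs ! i)) (e i) = pinv \<rho> ((\<pi> ^^ (gs ! i)) (e i))"
      unfolding p_def by (rule funpow_follow(2)[OF permutes_inv[OF \<rho>] out[OF that] pos[OF that]])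
    also have "(\<pi> ^^ (gs ! i)) (e i) = \<rho> (e i)"
      unfolding shift \<rho>e[OF that] using sS[OF that] by (simp add: e_def)
    finally show ?thesis using permutes_inverses(2)[OF \<rho>] by simp
  qed
  have orb: "orbit p (e i) = (\<lambda>j. (\<pi> ^^ j) (e i)) ` {..<gs ! i}" if "i < k" for i
  proof -
    have "orbit p (e i) = (\<lambda>j. (p ^^ j) (e i)) ` {..<gs ! i}"
      using orbit_altdef_bounded[OF ret[OF that] pos[OF that]] by auto
    also have "\<dots> = (\<lambda>j. (\<pi> ^^ j) (e i)) ` {..<gs ! i}"
      by (intro image_cong refl) (simp add: foll[OF that])
    finally show ?thesis .
  qed
  have c: "card (orbit p (e i)) = gs ! i" if i: "i < k" for i
  proof -
    have "inj_on (\<lambda>j. (\<pi> ^^ j) (e i)) {..<gs ! i}"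
    proof (rule inj_onI)
      fix j l assume jl: "j \<in> {..<gs ! i}" "l \<in> {..<gs ! i}" "(\<pi> ^^ j) (e i) = (\<pi> ^^ l) (e i)"
      have "s (Suc i) \<le> n" using mono[of "Suc i" k] i sk by (cases "Suc i = k") auto
      then show "j = l"
        using inj_onD[OF co(3), of "s i + j" "s i + l"] jl sS[OF i] by (simp add: shift)
    qed
    then show ?thesis unfolding orb[OF i] by (simp add: card_image)
  qed
  have "inj_on (orbit p) A"
  proof (rule inj_onI)
    fix x y assume xy: "x \<in> A" "y \<in> A" "orbit p x = orbit p y"
    then obtain i where i: "i < k" "x = e i" by (auto simp: A_def)
    have "y \<in> orbit p x" using xy permutation_self_in_orbit[OF p] by auto
    then obtain j where "j < gs ! i" "y = (\<pi> ^^ j) (e i)" using orb[OF i(1)] i by auto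
    then show "x = y" using out[OF i(1), of j] xy i by (cases "j = 0") auto
  qed
  then have "(A, \<rho>) \<in> arcs C \<pi> a k"
    using AC aA cA \<rho> cyc by (simp add: arcs_def p_def)
  moreover have "arc_lengths \<pi> a k \<rho> = gs"
    by (rule nth_equalityI) (use len c pw in \<open>simp_all add: arc_lengths_def p_def\<close>)
  ultimately show ?thesis by (rule that)
qed

lemma comps_Suc_sum:
  fixes G :: "nat list \<Rightarrow> 'c::comm_monoid_add"
  shows "(\<Sum>gs\<in>comps n (Suc k). G gs) = (\<Sum>g=1..n. \<Sum>gs\<in>comps (n - g) k. G (g # gs))"
proof -
  have fin: "finite (comps m k)" for m
  proof (rule finite_subset)
    show "comps m k \<subseteq> {gs. set gs \<subseteq> {..m} \<and> length gs = k}"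
      using member_le_sum_list by (fastforce simp: comps_def)
  qed (simp add: finite_lists_length_eq)
  have "(\<Sum>g=1..n. \<Sum>gs\<in>comps (n - g) k. G (g # gs)) = (\<Sum>(g, gs)\<in>(SIGMA g:{1..n}. comps (n - g) k). G (g # gs))"
    by (rule sum.Sigma) (use fin in auto)
  also have "\<dots> = (\<Sum>gs\<in>comps n (Suc k). G gs)"
    by (rule sum.reindex_bij_witness[where i = "\<lambda>gs. (hd gs, tl gs)" and j = "\<lambda>(g, gs). g # gs"])
      (auto simp: comps_def length_Suc_conv)
  finally show ?thesis by simp
qed

text \<open>Vanishing constant terms restrict the convolution to positive parts. In the second claim
  the first part has a series of its own, because it will belong to the arc of the root.\<close>

lemma sum_comps:
  fixes \<Phi> W :: "'c::comm_ring_1 fps"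
  assumes "\<Phi> $ 0 = 0" "W $ 0 = 0"
  shows "(\<Sum>gs\<in>comps n k. \<Prod>g\<leftarrow>gs. W $ g) = (W ^ k) $ n"
    and "(\<Sum>gs\<in>comps n (Suc k). \<Phi> $ hd gs * (\<Prod>g\<leftarrow>tl gs. W $ g)) = (\<Phi> * W ^ k) $ n"
proof -
  have conv: "(\<Sum>g=1..n. \<Psi> $ g * Z $ (n - g)) = (\<Psi> * Z) $ n" if "\<Psi> $ 0 = 0" for \<Psi> Z :: "'c fps" and n :: nat
  proof -
    have "(\<Psi> * Z) $ n = (\<Sum>g=0..n. \<Psi> $ g * Z $ (n - g))" by (rule fps_mult_nth)
    also have "\<dots> = (\<Sum>g=1..n. \<Psi> $ g * Z $ (n - g))"
      by (rule sum.mono_neutral_right) (use that in \<open>auto simp: not_less_eq_eq\<close>)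
    finally show ?thesis by simp
  qed
  have W: "(\<Sum>gs\<in>comps n k. \<Prod>g\<leftarrow>gs. W $ g) = (W ^ k) $ n" for n k
  proof (induction k arbitrary: n)
    case 0
    have "comps n 0 = (if n = 0 then {[]} else {})" by (auto simp: comps_def)
    then show ?case by simp
  next
    case (Suc k)
    then show ?case using conv[OF assms(2), where n = n and Z = "W ^ k"]
      by (simp add: comps_Suc_sum sum_distrib_left[symmetric])
  qed
  show "(\<Sum>gs\<in>comps n k. \<Prod>g\<leftarrow>gs. W $ g) = (W ^ k) $ n" by (rule W)
  show "(\<Sum>gs\<in>comps n (Suc k). \<Phi> $ hd gs * (\<Prod>g\<leftarrow>tl gs. W $ g)) = (\<Phi> * W ^ k) $ n"
    using conv[OF assms(1), where n = n and Z = "W ^ k"]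
    by (simp add: comps_Suc_sum sum_distrib_left[symmetric] W)
qed

text \<open>First-return maps rooted at \<open>a\<close> correspond to compositions of the cycle
  length, with the arc of \<open>a\<close> as first part. That arc receives the weight
  \<open>\<Phi>\<close>, which encodes whatever is attached to it.\<close>

lemma sum_arcs:
  fixes \<Phi> W :: "'c::comm_ring_1 fps"
  assumes \<pi>: "permutation \<pi>" "cyclic_on \<pi> C" and a: "a \<in> C"
    and \<Phi>: "\<Phi> $ 0 = 0" "W $ 0 = 0"
  shows "(\<Sum>(A, \<rho>)\<in>arcs C \<pi> a (Suc k). \<Phi> $ card (orbit (pinv \<rho> \<circ> \<pi>) a) *
      (\<Prod>x\<in>A - {a}. W $ card (orbit (pinv \<rho> \<circ> \<pi>) x))) = (\<Phi> * W ^ k) $ card C"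
proof -
  have inj: "inj_on (\<lambda>(A, \<rho>). arc_lengths \<pi> a (Suc k) \<rho>) (arcs C \<pi> a (Suc k))"
  proof (rule inj_onI)
    fix s t assume st: "s \<in> arcs C \<pi> a (Suc k)" "t \<in> arcs C \<pi> a (Suc k)"
      "(\<lambda>(A, \<rho>). arc_lengths \<pi> a (Suc k) \<rho>) s = (\<lambda>(A, \<rho>). arc_lengths \<pi> a (Suc k) \<rho>) t"
    obtain A \<rho> A' \<rho>' where [simp]: "s = (A, \<rho>)" "t = (A', \<rho>')" by (cases s; cases t) auto
    have "A = A'" "\<rho> = \<rho>'"
      by (rule arcs_inj[OF \<pi>, of A \<rho> a "Suc k" A' \<rho>']; use st in simp)+
    then show "s = t" by simp
  qed
  have im: "(\<lambda>(A, \<rho>). arc_lengths \<pi> a (Suc k) \<rho>) ` arcs C \<pi> a (Suc k) = comps (card C) (Suc k)"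
  proof (intro equalityI subsetI)
    fix gs assume "gs \<in> (\<lambda>(A, \<rho>). arc_lengths \<pi> a (Suc k) \<rho>) ` arcs C \<pi> a (Suc k)"
    then show "gs \<in> comps (card C) (Suc k)" using arcs_facts(4)[OF \<pi>] by auto
  next
    fix gs assume "gs \<in> comps (card C) (Suc k)"
    then obtain A \<rho> where "(A, \<rho>) \<in> arcs C \<pi> a (Suc k)" "arc_lengths \<pi> a (Suc k) \<rho> = gs"
      using arcs_surj[OF \<pi> a _ zero_less_Suc] by metis
    then show "gs \<in> (\<lambda>(A, \<rho>). arc_lengths \<pi> a (Suc k) \<rho>) ` arcs C \<pi> a (Suc k)"
      by (intro image_eqI[of _ _ "(A, \<rho>)"]) simp_all
  qed
  have "(\<Phi> * W ^ k) $ card C = (\<Sum>gs\<in>comps (card C) (Suc k). \<Phi> $ hd gs * (\<Prod>g\<leftarrow>tl gs. W $ g))"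
    using sum_comps(2)[OF \<Phi>] by simp
  also have "\<dots> = (\<Sum>(A, \<rho>)\<in>arcs C \<pi> a (Suc k). \<Phi> $ card (orbit (pinv \<rho> \<circ> \<pi>) a) *
      (\<Prod>x\<in>A - {a}. W $ card (orbit (pinv \<rho> \<circ> \<pi>) x)))"
    unfolding im[symmetric] sum.reindex[OF inj]
  proof (rule sum.cong[OF refl])
    fix t assume "t \<in> arcs C \<pi> a (Suc k)"
    then obtain A \<rho> where t: "t = (A, \<rho>)" and A: "(A, \<rho>) \<in> arcs C \<pi> a (Suc k)" by (cases t) auto
    let ?p = "pinv \<rho> \<circ> \<pi>"
    note bij = arcs_facts(1)[OF \<pi> A]
    have i0: "{1..<Suc k} = {..<Suc k} - {0}" by auto
    have "bij_betw (\<lambda>i. (\<rho> ^^ i) a) ({..<Suc k} - {0}) (A - {a})"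
      by (rule bij_betw_DiffI[OF bij]) (use A in \<open>auto simp: bij_betw_def arcs_def\<close>)
    then have bij1: "bij_betw (\<lambda>i. (\<rho> ^^ i) a) {1..<Suc k} (A - {a})"
      unfolding i0 .
    have "(\<Prod>g\<leftarrow>tl (arc_lengths \<pi> a (Suc k) \<rho>). W $ g)
        = (\<Prod>i\<leftarrow>[1..<Suc k]. W $ card (orbit ?p ((\<rho> ^^ i) a)))"
      unfolding arc_lengths_def by (simp add: upt_conv_Cons map_tl[symmetric] comp_def[of "($) W"] del: upt_Suc)
    also have "\<dots> = (\<Prod>i\<in>{1..<Suc k}. W $ card (orbit ?p ((\<rho> ^^ i) a)))"
      by (subst prod.distinct_set_conv_list[symmetric]) (simp_all only: distinct_upt set_upt)
    also have "\<dots> = (\<Prod>x\<in>A - {a}. W $ card (orbit ?p x))"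
      by (rule prod.reindex_bij_betw[OF bij1])
    moreover have "hd (arc_lengths \<pi> a (Suc k) \<rho>) = card (orbit ?p a)"
      unfolding arc_lengths_def by (simp add: upt_conv_Cons del: upt_Suc)
    ultimately show "((\<lambda>gs. \<Phi> $ hd gs * (\<Prod>g\<leftarrow>tl gs. W $ g)) \<circ> (\<lambda>(A, \<rho>). arc_lengths \<pi> a (Suc k) \<rho>)) t =
      (case t of (A, \<rho>) \<Rightarrow> \<Phi> $ card (orbit (pinv \<rho> \<circ> \<pi>) a) *
        (\<Prod>x\<in>A - {a}. W $ card (orbit (pinv \<rho> \<circ> \<pi>) x)))"
      by (simp add: t)
  qed
  finally show ?thesis by simp
qed

section \<open>The possible last factors on a block that is a single cycle\<close>

section \<open>Steps on a block with one cycle\<close>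

lemma moved_cyclic:
  assumes "\<sigma> permutes A" "cyclic_on \<sigma> A" "2 \<le> card A"
  shows "moved \<sigma> = A"
proof (intro equalityI subsetI)
  fix x assume "x \<in> moved \<sigma>"
  then show "x \<in> A" using permutes_not_in[OF assms(1)] by (auto simp: moved_def)
next
  fix x assume x: "x \<in> A"
  have "\<sigma> x \<noteq> x"
  proof
    assume "\<sigma> x = x"
    then have "A = {x}" using orbit_eq_singleton_iff orbit_cyclic_eq3[OF assms(2) x] by metis
    then show False using assms(3) by simp
  qed
  then show "x \<in> moved \<sigma>" by (simp add: moved_def)
qed

lemma card_moved:
  assumes "is_cycle B \<sigma>"
  shows "2 \<le> card (moved \<sigma>)"
proof -
  obtain x where x: "x \<in> moved \<sigma>" using is_cycle_facts(4)[OF assms] by auto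
  have "\<sigma> x \<in> moved \<sigma>" using permutes_in_image[OF is_cycle_facts(2)[OF assms]] x by simp
  then have "{x, \<sigma> x} \<subseteq> moved \<sigma>" using x by simp
  moreover have "card {x, \<sigma> x} = 2" using x by (simp add: moved_def)
  ultimately show ?thesis using card_mono[OF is_cycle_facts(5)[OF assms]] by metis
qed

lemma orbit_image_orbit:
  assumes "permutation p"
  shows "orbit p ` orbit p x = {orbit p x}"
  using in_orbit_iff[OF assms] permutation_self_in_orbit[OF assms, of x] by blast

lemma closed_orbit_iff:
  assumes "permutation p" "\<And>x. x \<in> X \<Longrightarrow> p x \<in> X" "orbit p y \<inter> X \<noteq> {}"
  shows "orbit p y \<subseteq> X" "y \<in> X"
proof -
  obtain x where x: "x \<in> orbit p y" "x \<in> X" using assms(3) by auto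
  then have "orbit p y = orbit p x" by (simp add: in_orbit_iff[OF assms(1)])
  then show s: "orbit p y \<subseteq> X" using closed_orbit_subset[of X p x] assms(2) x(2) by simp
  show "y \<in> X" using s permutation_self_in_orbit[OF assms(1)] by auto
qed

lemma partition_orbits:
  assumes p: "permutation p" and cov: "(\<Union>x\<in>A. orbit p x) = B"
  shows "partition_on B (orbit p ` A)"
proof (rule partition_onI)
  show "\<Union>(orbit p ` A) = B" by (rule cov)
  show "disjnt X Y" if "X \<in> orbit p ` A" "Y \<in> orbit p ` A" "X \<noteq> Y" for X Y
    using that orbit_disjoint[OF p] by (auto simp only: disjnt_def)
  show "{} \<notin> orbit p ` A" using orbit_nonempty by (metis imageE)
qed

text \<open>Every orbit lies in one block and every block contains an orbit through
  \<open>A\<close>, so the orbits map onto the blocks. Equal cardinalities make this map injective,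
  and then no block has room for a second orbit.\<close>

lemma invariant_partition_eq_orbits:
  assumes p: "permutation p" and Q: "partition_on B Q" and fin: "finite A"
    and cl: "\<And>X x. X \<in> Q \<Longrightarrow> x \<in> X \<Longrightarrow> p x \<in> X" and meet: "\<And>X. X \<in> Q \<Longrightarrow> X \<inter> A \<noteq> {}"
    and cov: "(\<Union>x\<in>A. orbit p x) = B" and card: "card Q = card (orbit p ` A)"
  shows "Q = orbit p ` A"
proof -
  define \<psi> where "\<psi> = (\<lambda>O'. SOME X. X \<in> Q \<and> O' \<subseteq> X)"
  have disj: "X = Y" if "X \<in> Q" "Y \<in> Q" "z \<in> X" "z \<in> Y" for X Y z
    using partition_onD2[OF Q] that by (auto simp: pairwise_def disjnt_def)
  have \<psi>: "\<psi> O' = X" if "O' \<noteq> {}" "X \<in> Q" "O' \<subseteq> X" for O' X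
  proof -
    have "\<psi> O' \<in> Q \<and> O' \<subseteq> \<psi> O'" unfolding \<psi>_def by (rule someI[of _ X]) (use that in simp)
    then show ?thesis using that disj by blast
  qed
  have sub: "orbit p x \<subseteq> X" if "X \<in> Q" "x \<in> X" for X x
    using closed_orbit_subset[of X p x] cl that by simp
  have ex: "\<exists>X\<in>Q. orbit p x \<subseteq> X" if "x \<in> A" for x
  proof -
    have "x \<in> B" using cov that permutation_self_in_orbit[OF p] by blast
    then show ?thesis using sub partition_onD1[OF Q] by auto
  qed
  have "\<psi> ` (orbit p ` A) = Q"
  proof (intro equalityI subsetI)
    fix X assume "X \<in> \<psi> ` (orbit p ` A)"
    then show "X \<in> Q" using ex \<psi> orbit_nonempty by (metis (no_types, lifting) imageE)
  next
    fix X assume X: "X \<in> Q"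
    then obtain a where "a \<in> A" "a \<in> X" using meet by auto
    then have "\<psi> (orbit p a) = X" using \<psi>[OF orbit_nonempty X] sub[OF X] by simp
    then show "X \<in> \<psi> ` (orbit p ` A)" using \<open>a \<in> A\<close> by auto
  qed
  then have inj: "inj_on \<psi> (orbit p ` A)"
    using card fin by (intro eq_card_imp_inj_on) simp_all
  have *: "X = orbit p a" if X: "X \<in> Q" and a: "a \<in> A" "a \<in> X" for X a
  proof
    show "orbit p a \<subseteq> X" using sub X a by simp
    show "X \<subseteq> orbit p a"
    proof
      fix y assume y: "y \<in> X"
      then obtain a' where a': "a' \<in> A" "y \<in> orbit p a'"
        using cov partition_onD1[OF Q] X by blast
      then have "orbit p a' \<subseteq> X"
        using closed_orbit_iff(1)[OF p cl[OF X]] y by blast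
      then have "\<psi> (orbit p a') = \<psi> (orbit p a)"
        using \<psi>[OF orbit_nonempty X] sub[OF X a(2)] by simp
      then have "orbit p a' = orbit p a" using inj a a' by (auto dest: inj_onD)
      then show "y \<in> orbit p a" using a' by simp
    qed
  qed
  show ?thesis
  proof (intro equalityI subsetI)
    fix X assume X: "X \<in> Q"
    then obtain a where "a \<in> A" "a \<in> X" using meet by auto
    then show "X \<in> orbit p ` A" using *[OF X] by auto
  next
    fix O' assume "O' \<in> orbit p ` A"
    then obtain a where a: "a \<in> A" "O' = orbit p a" by auto
    obtain X where X: "X \<in> Q" "orbit p a \<subseteq> X" using ex a by auto
    then have "a \<in> X" using permutation_self_in_orbit[OF p] by auto
    then show "O' \<in> Q" using *[OF X(1) a(1)] a X by simp
  qed
qed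

lemma cyclic_on_of_single_orbit:
  assumes "permutation \<pi>" "\<And>x. x \<in> B \<Longrightarrow> \<pi> x \<in> B" "card (orbit \<pi> ` B) = 1"
  shows "cyclic_on \<pi> B"
proof -
  obtain X where X: "orbit \<pi> ` B = {X}" using assms(3) by (rule card_1_singletonE)
  then obtain x where x: "x \<in> B" by auto
  have "orbit \<pi> x = B"
  proof
    show "orbit \<pi> x \<subseteq> B" using closed_orbit_subset assms(2) x by metis
    show "B \<subseteq> orbit \<pi> x"
    proof
      fix y assume "y \<in> B"
      then have "orbit \<pi> y \<in> {X}" "orbit \<pi> x \<in> {X}" using x unfolding X[symmetric] by blast+
      then have "orbit \<pi> y = orbit \<pi> x" by simp
      then show "y \<in> orbit \<pi> x" using permutation_self_in_orbit[OF assms(1)] by auto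
    qed
  qed
  then show ?thesis using x by (auto simp: cyclic_on_def)
qed

text \<open>Only one orbit of \<open>\<pi>\<close> meets the support, so the counts in
  \<open>steps\<close> say that the support has as many points as there are orbits of
  \<open>pinv \<sigma> \<circ> \<pi>\<close> through it. Hence \<open>\<sigma>\<close> is a
  first-return map and \<open>Q\<close> is its set of arcs.\<close>

lemma single_cycle_steps:
  assumes \<pi>: "permutation \<pi>" "cyclic_on \<pi> B"
  defines "\<Sigma> \<equiv> {\<sigma>. is_cycle B \<sigma> \<and> inj_on (orbit (pinv \<sigma> \<circ> \<pi>)) (moved \<sigma>)}"
  shows "steps \<pi> B = (\<lambda>\<sigma>. (\<sigma>, orbit (pinv \<sigma> \<circ> \<pi>) ` moved \<sigma>)) ` \<Sigma>"
proof -
  have *: "(\<sigma>, Q) \<in> steps \<pi> B \<longleftrightarrow> \<sigma> \<in> \<Sigma> \<and> Q = orbit (pinv \<sigma> \<circ> \<pi>) ` moved \<sigma>" for \<sigma> Q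
  proof (cases "is_cycle B \<sigma>")
    case True
    define A where "A = moved \<sigma>"
    let ?p = "pinv \<sigma> \<circ> \<pi>"
    note cyc = is_cycle_facts[OF True, folded A_def]
    have p: "permutation ?p"
      by (rule permutation_comp_permutes[OF \<pi>(1) permutes_inv[OF cyc(2)] cyc(5)])
    note cov = orbits_cover_cycle[OF \<pi> cyc(2,1,4)]
    have "orbit \<pi> ` A = {B}"
      using cyc(1,4) orbit_cyclic_eq3[OF \<pi>(2)] by (auto simp: image_def)
    then have one: "card (orbit \<pi> ` A) = 1" by simp
    show ?thesis
    proof
      assume "(\<sigma>, Q) \<in> steps \<pi> B"
      then have Q: "partition_on B Q" and cl: "\<And>X x. X \<in> Q \<Longrightarrow> x \<in> X \<Longrightarrow> ?p x \<in> X"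
        and meet: "\<And>X. X \<in> Q \<Longrightarrow> X \<inter> A \<noteq> {}"
        and c: "card Q = card (orbit ?p ` A)" "card (orbit \<pi> ` A) + card Q = card A + 1"
        by (auto simp: steps_def A_def)
      have "inj_on (orbit ?p) A"
        by (rule eq_card_imp_inj_on[OF cyc(5)]) (use c one in simp)
      moreover have "Q = orbit ?p ` A"
        by (rule invariant_partition_eq_orbits[OF p Q cyc(5) cl meet cov(1) c(1)])
      ultimately show "\<sigma> \<in> \<Sigma> \<and> Q = orbit ?p ` moved \<sigma>" using True by (simp add: \<Sigma>_def A_def)
    next
      assume "\<sigma> \<in> \<Sigma> \<and> Q = orbit ?p ` moved \<sigma>"
      then have inj: "inj_on (orbit ?p) A" and Q: "Q = orbit ?p ` A" by (simp_all add: \<Sigma>_def A_def)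
      have "partition_on B Q" unfolding Q by (rule partition_orbits[OF p cov(1)])
      moreover have "X \<inter> A \<noteq> {}" "\<forall>x\<in>X. pinv \<sigma> (\<pi> x) \<in> X" if "X \<in> Q" for X
        using that permutation_self_in_orbit[OF p] orbit.step[of _ ?p] unfolding Q by auto
      moreover have "card Q = card A" unfolding Q by (rule card_image[OF inj])
      ultimately show "(\<sigma>, Q) \<in> steps \<pi> B"
        using True one Q by (simp add: steps_def A_def)
    qed
  qed (auto simp: steps_def \<Sigma>_def)
  show ?thesis by (auto simp: *)
qed

text \<open>For \<open>k = 1\<close> the first-return map is the identity, which moves nothing; from
  two points on, \<open>A\<close> is the set of moved points.\<close>

lemma arcs_eq_image:
  assumes "cyclic_on \<pi> B" "2 \<le> k"
  shows "arcs B \<pi> a k = (\<lambda>\<sigma>. (moved \<sigma>, \<sigma>)) `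
    {\<sigma>. is_cycle B \<sigma> \<and> inj_on (orbit (pinv \<sigma> \<circ> \<pi>)) (moved \<sigma>) \<and> card (moved \<sigma>) = k \<and> a \<in> moved \<sigma>}"
proof -
  have "(A, \<sigma>) \<in> arcs B \<pi> a k \<longleftrightarrow> A = moved \<sigma> \<and> is_cycle B \<sigma> \<and>
     inj_on (orbit (pinv \<sigma> \<circ> \<pi>)) (moved \<sigma>) \<and> card (moved \<sigma>) = k \<and> a \<in> moved \<sigma>" for A \<sigma>
    using moved_cyclic[of \<sigma> A] assms(2) by (auto simp: arcs_def is_cycle_def)
  then show ?thesis by (auto simp: image_iff)
qed

text \<open>\<open>sum_arcs\<close> counts maps with a chosen root in the support, and a map of
  length \<open>k\<close> has \<open>k\<close> roots. Counting pairs of map and root in two ways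
  gives \<open>k\<close> times the wanted sum. \<open>Y k\<close> is specified through its multiple
  by \<open>k\<close>, so that no division in the ring is required.\<close>

lemma single_cycle_sum:
  fixes W :: "'c::{idom, ring_char_0} fps"
  assumes \<pi>: "permutation \<pi>" "cyclic_on \<pi> B" and W0: "W $ 0 = 0"
    and Y: "\<And>k. of_nat k * Y k = of_nat (card B) * (W ^ k) $ card B"
  shows "(\<Sum>\<sigma> | is_cycle B \<sigma> \<and> inj_on (orbit (pinv \<sigma> \<circ> \<pi>)) (moved \<sigma>).
      q (card (moved \<sigma>)) * (\<Prod>x\<in>moved \<sigma>. W $ card (orbit (pinv \<sigma> \<circ> \<pi>) x)))
    = (\<Sum>k=2..card B. q k * Y k)"
proof -
  have finB: "finite B" using \<pi>(2) by (rule finite_cyclic_on)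
  define \<Sigma> where "\<Sigma> = {\<sigma>. is_cycle B \<sigma> \<and> inj_on (orbit (pinv \<sigma> \<circ> \<pi>)) (moved \<sigma>)}"
  define G where "G = (\<lambda>\<sigma>. \<Prod>x\<in>moved \<sigma>. W $ card (orbit (pinv \<sigma> \<circ> \<pi>) x))"
  have fin: "finite \<Sigma>"
    by (rule finite_subset[OF _ finite_permutations[OF finB]]) (auto simp: \<Sigma>_def is_cycle_facts(6))
  have key: "(\<Sum>\<sigma> | \<sigma> \<in> \<Sigma> \<and> card (moved \<sigma>) = k. G \<sigma>) = Y k" if k: "2 \<le> k" for k
  proof -
    define \<Sigma>k where "\<Sigma>k = {\<sigma>. \<sigma> \<in> \<Sigma> \<and> card (moved \<sigma>) = k}"
    have fk: "finite \<Sigma>k" using fin by (simp add: \<Sigma>k_def)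
    have rooted: "(\<Sum>\<sigma> | \<sigma> \<in> \<Sigma>k \<and> a \<in> moved \<sigma>. G \<sigma>) = (W ^ k) $ card B" if a: "a \<in> B" for a
    proof -
      obtain j where j: "k = Suc j" using k by (cases k) auto
      have "(W ^ k) $ card B = (\<Sum>(A, \<rho>)\<in>arcs B \<pi> a k. W $ card (orbit (pinv \<rho> \<circ> \<pi>) a) *
          (\<Prod>x\<in>A - {a}. W $ card (orbit (pinv \<rho> \<circ> \<pi>) x)))"
        using sum_arcs[OF \<pi> a W0 W0, of j] unfolding j by simp
      also have "\<dots> = (\<Sum>\<sigma> | \<sigma> \<in> \<Sigma>k \<and> a \<in> moved \<sigma>. W $ card (orbit (pinv \<sigma> \<circ> \<pi>) a) *
          (\<Prod>x\<in>moved \<sigma> - {a}. W $ card (orbit (pinv \<sigma> \<circ> \<pi>) x)))"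
        unfolding arcs_eq_image[OF \<pi>(2) k]
        by (subst sum.reindex) (auto simp: inj_on_def \<Sigma>k_def \<Sigma>_def conj_assoc intro!: sum.cong)
      also have "\<dots> = (\<Sum>\<sigma> | \<sigma> \<in> \<Sigma>k \<and> a \<in> moved \<sigma>. G \<sigma>)"
        unfolding G_def by (intro sum.cong refl prod.remove[symmetric])
          (auto simp: \<Sigma>k_def \<Sigma>_def is_cycle_facts(5))
      finally show ?thesis by simp
    qed
    have "of_nat k * (\<Sum>\<sigma>\<in>\<Sigma>k. G \<sigma>) = (\<Sum>\<sigma>\<in>\<Sigma>k. \<Sum>a\<in>moved \<sigma>. G \<sigma>)"
      unfolding sum_distrib_left by (rule sum.cong) (auto simp: \<Sigma>k_def)
    also have "\<dots> = (\<Sum>\<sigma>\<in>\<Sigma>k. \<Sum>a | a \<in> B \<and> a \<in> moved \<sigma>. G \<sigma>)"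
      by (intro sum.cong refl) (use is_cycle_facts(1) in \<open>auto simp: \<Sigma>k_def \<Sigma>_def\<close>)
    also have "\<dots> = (\<Sum>a\<in>B. \<Sum>\<sigma> | \<sigma> \<in> \<Sigma>k \<and> a \<in> moved \<sigma>. G \<sigma>)"
      by (rule sum.swap_restrict[OF fk finB])
    also have "\<dots> = of_nat k * Y k" by (simp add: rooted Y)
    \<comment> \<open>The common factor \<open>k\<close> cancels in an integral domain of
      characteristic zero.\<close>
    finally show ?thesis using k by (simp add: \<Sigma>k_def)
  qed
  have "(\<Sum>\<sigma>\<in>\<Sigma>. q (card (moved \<sigma>)) * G \<sigma>)
      = (\<Sum>k=2..card B. \<Sum>\<sigma> | \<sigma> \<in> \<Sigma> \<and> card (moved \<sigma>) = k. q (card (moved \<sigma>)) * G \<sigma>)"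
  proof (rule sum.group[symmetric, OF fin])
    show "(\<lambda>\<sigma>. card (moved \<sigma>)) ` \<Sigma> \<subseteq> {2..card B}"
    proof (rule image_subsetI)
      fix \<sigma> assume "\<sigma> \<in> \<Sigma>"
      then have "is_cycle B \<sigma>" by (simp add: \<Sigma>_def)
      then show "card (moved \<sigma>) \<in> {2..card B}"
        using card_moved card_mono[OF finB is_cycle_facts(1)] by auto
    qed
  qed simp
  also have "\<dots> = (\<Sum>k=2..card B. q k * Y k)"
    by (intro sum.cong refl) (auto simp: key[symmetric] sum_distrib_left)
  finally show ?thesis by (simp add: \<Sigma>_def G_def)
qed

section \<open>The possible last factors on a block with two cycles\<close>

section \<open>Steps on a block with two cycles\<close>

lemma two_orbits:
  assumes \<pi>: "permutation \<pi>" and cl: "\<And>x. x \<in> B \<Longrightarrow> \<pi> x \<in> B" and c: "card (orbit \<pi> ` B) = 2"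
  obtains C D where "orbit \<pi> ` B = {C, D}" "C \<inter> D = {}" "C \<union> D = B" "cyclic_on \<pi> C" "cyclic_on \<pi> D"
proof -
  obtain C D where CD: "orbit \<pi> ` B = {C, D}" "C \<noteq> D" using c by (auto simp: card_2_iff)
  have "C \<in> orbit \<pi> ` B" "D \<in> orbit \<pi> ` B" using CD by auto
  then obtain x y where xy: "x \<in> B" "C = orbit \<pi> x" "y \<in> B" "D = orbit \<pi> y" by blast
  have "\<Union>(orbit \<pi> ` B) = B"
  proof (intro equalityI subsetI)
    fix z assume "z \<in> \<Union>(orbit \<pi> ` B)"
    then show "z \<in> B" using closed_orbit_subset[of B \<pi>] cl by blast
  next
    fix z assume "z \<in> B"
    then show "z \<in> \<Union>(orbit \<pi> ` B)" using permutation_self_in_orbit[OF \<pi>] by auto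
  qed
  then have "C \<union> D = B" unfolding CD(1) by simp
  moreover have "C \<inter> D = {}" using orbit_disjoint[OF \<pi>] CD(2) xy by simp
  ultimately show ?thesis
    using that CD(1) cyclic_on_orbit'[OF \<pi>] xy by simp
qed

text \<open>The two cycles are unordered, so the value is described through any enumeration
  \<open>C\<close>, \<open>D\<close>; symmetry of \<open>h\<close> makes it well defined.\<close>

definition block_weight ::
    "'c::comm_ring_1 fps \<Rightarrow> (nat \<Rightarrow> nat \<Rightarrow> 'c) \<Rightarrow> ('a \<Rightarrow> 'a) \<Rightarrow> 'a set \<Rightarrow> 'c" where
  "block_weight W h \<pi> B =
    (if card (orbit \<pi> ` B) = 1 then W $ card B
     else THE v. \<exists>C D. orbit \<pi> ` B = {C, D} \<and> C \<noteq> D \<and> v = h (card C) (card D))"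

lemma block_weight_one:
  assumes "cyclic_on \<pi> B"
  shows "block_weight W h \<pi> B = W $ card B"
proof -
  have "orbit \<pi> ` B = {B}"
    using assms orbit_cyclic_eq3[OF assms] by (auto simp: cyclic_on_def)
  then show ?thesis by (simp add: block_weight_def)
qed

lemma block_weight_orbit:
  assumes "permutation \<pi>"
  shows "block_weight W h \<pi> (orbit \<pi> x) = W $ card (orbit \<pi> x)"
  by (rule block_weight_one[OF cyclic_on_orbit'[OF assms]])

lemma block_weight_two:
  assumes hsym: "\<And>a b. h a b = h b a" and CD: "orbit \<pi> ` B = {C, D}" "C \<noteq> D"
  shows "block_weight W h \<pi> B = h (card C) (card D)"
proof -
  have "(THE v. \<exists>C D. orbit \<pi> ` B = {C, D} \<and> C \<noteq> D \<and> v = h (card C) (card D)) = h (card C) (card D)"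
  proof (rule the_equality)
    show "\<exists>C' D'. orbit \<pi> ` B = {C', D'} \<and> C' \<noteq> D' \<and> h (card C) (card D) = h (card C') (card D')"
      using CD by blast
    fix v assume "\<exists>C' D'. orbit \<pi> ` B = {C', D'} \<and> C' \<noteq> D' \<and> v = h (card C') (card D')"
    then obtain C' D' where "{C, D} = {C', D'}" "v = h (card C') (card D')" unfolding CD by blast
    then show "v = h (card C) (card D)" using hsym by (auto simp: doubleton_eq_iff)
  qed
  then show ?thesis using CD by (simp add: block_weight_def)
qed

text \<open>The root stays part of the data here, as it selects the arc to which the second cycle is
  attached; hence there is no division by the length.\<close>

lemma rooted_sum:
  fixes \<Phi> W :: "'c::comm_ring_1 fps"
  assumes \<pi>: "permutation \<pi>" "cyclic_on \<pi> C" and a: "a \<in> C" and z: "\<Phi> $ 0 = 0" "W $ 0 = 0"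
  shows "(\<Sum>\<sigma> | is_cycle C \<sigma> \<and> inj_on (orbit (pinv \<sigma> \<circ> \<pi>)) (moved \<sigma>) \<and> a \<in> moved \<sigma>.
      q (card (moved \<sigma>)) * (\<Phi> $ card (orbit (pinv \<sigma> \<circ> \<pi>) a) *
        (\<Prod>x\<in>moved \<sigma> - {a}. W $ card (orbit (pinv \<sigma> \<circ> \<pi>) x))))
    = (\<Sum>k=2..card C. q k * (\<Phi> * W ^ (k - 1)) $ card C)"
proof -
  have finC: "finite C" using \<pi>(2) by (rule finite_cyclic_on)
  define \<Sigma> where "\<Sigma> = {\<sigma>. is_cycle C \<sigma> \<and> inj_on (orbit (pinv \<sigma> \<circ> \<pi>)) (moved \<sigma>) \<and> a \<in> moved \<sigma>}"
  define G where "G = (\<lambda>A \<sigma>. \<Phi> $ card (orbit (pinv \<sigma> \<circ> \<pi>) a) *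
        (\<Prod>x\<in>A - {a}. W $ card (orbit (pinv \<sigma> \<circ> \<pi>) x)))"
  have fin: "finite \<Sigma>"
    by (rule finite_subset[OF _ finite_permutations[OF finC]]) (auto simp: \<Sigma>_def is_cycle_facts(6))
  have key: "(\<Sum>\<sigma> | \<sigma> \<in> \<Sigma> \<and> card (moved \<sigma>) = k. G (moved \<sigma>) \<sigma>) = (\<Phi> * W ^ (k - 1)) $ card C"
    if k: "2 \<le> k" for k
  proof -
    have "(\<Phi> * W ^ (k - 1)) $ card C = (\<Sum>(A, \<rho>)\<in>arcs C \<pi> a k. G A \<rho>)"
      using sum_arcs[OF \<pi> a z, of "k - 1"] k unfolding G_def by simp
    also have "\<dots> = (\<Sum>\<sigma> | \<sigma> \<in> \<Sigma> \<and> card (moved \<sigma>) = k. G (moved \<sigma>) \<sigma>)"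
      unfolding arcs_eq_image[OF \<pi>(2) k]
      by (subst sum.reindex) (auto simp: inj_on_def \<Sigma>_def conj_ac intro!: sum.cong)
    finally show ?thesis by simp
  qed
  have "(\<Sum>\<sigma>\<in>\<Sigma>. q (card (moved \<sigma>)) * G (moved \<sigma>) \<sigma>)
      = (\<Sum>k=2..card C. \<Sum>\<sigma> | \<sigma> \<in> \<Sigma> \<and> card (moved \<sigma>) = k. q (card (moved \<sigma>)) * G (moved \<sigma>) \<sigma>)"
  proof (rule sum.group[symmetric, OF fin])
    show "(\<lambda>\<sigma>. card (moved \<sigma>)) ` \<Sigma> \<subseteq> {2..card C}"
    proof (rule image_subsetI)
      fix \<sigma> assume "\<sigma> \<in> \<Sigma>"
      then have "is_cycle C \<sigma>" by (simp add: \<Sigma>_def)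
      then show "card (moved \<sigma>) \<in> {2..card C}"
        using card_moved card_mono[OF finC is_cycle_facts(1)] by auto
    qed
  qed simp
  also have "\<dots> = (\<Sum>k=2..card C. q k * (\<Phi> * W ^ (k - 1)) $ card C)"
  proof (rule sum.cong[OF refl])
    fix k assume "k \<in> {2..card C}"
    then have k: "2 \<le> k" by simp
    have "(\<Sum>\<sigma> | \<sigma> \<in> \<Sigma> \<and> card (moved \<sigma>) = k. q (card (moved \<sigma>)) * G (moved \<sigma>) \<sigma>)
        = q k * (\<Sum>\<sigma> | \<sigma> \<in> \<Sigma> \<and> card (moved \<sigma>) = k. G (moved \<sigma>) \<sigma>)"
      unfolding sum_distrib_left by (rule sum.cong) auto
    then show "(\<Sum>\<sigma> | \<sigma> \<in> \<Sigma> \<and> card (moved \<sigma>) = k. q (card (moved \<sigma>)) * G (moved \<sigma>) \<sigma>)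
        = q k * (\<Phi> * W ^ (k - 1)) $ card C" using key[OF k] by simp
  qed
  finally show ?thesis by (simp add: \<Sigma>_def G_def)
qed

text \<open>A minimal step on a block with cycles \<open>C\<close>, \<open>D\<close> whose factor moves points of \<open>C\<close> only: one arc
  of \<open>C\<close> is joined with \<open>D\<close> in a block of the coarser factorization.\<close>

definition attach :: "('a \<Rightarrow> 'a) \<Rightarrow> 'a set \<Rightarrow> 'a \<times> ('a \<Rightarrow> 'a) \<Rightarrow> ('a \<Rightarrow> 'a) \<times> 'a set set" where
  "attach \<pi> D = (\<lambda>(a, \<sigma>). (\<sigma>, insert (orbit (pinv \<sigma> \<circ> \<pi>) a \<union> D)
     (orbit (pinv \<sigma> \<circ> \<pi>) ` (moved \<sigma> - {a}))))"

lemma attach_setup: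
  assumes \<pi>: "permutation \<pi>" "cyclic_on \<pi> C" "cyclic_on \<pi> D" and CD: "C \<inter> D = {}"
    and cyc: "is_cycle C \<sigma>"
  defines "p \<equiv> pinv \<sigma> \<circ> \<pi>"
  shows "permutation p" "(\<Union>x\<in>moved \<sigma>. orbit p x) = C" "\<And>x. x \<in> C \<Longrightarrow> p x \<in> C"
    "\<And>x. x \<in> D \<Longrightarrow> p x \<in> D" "\<And>x. x \<in> D \<Longrightarrow> orbit p x = D" "orbit \<pi> ` moved \<sigma> = {C}"
    "\<And>x. x \<in> moved \<sigma> \<Longrightarrow> orbit p x \<subseteq> C"
proof -
  note f = is_cycle_facts[OF cyc]
  show p: "permutation p"
    unfolding p_def by (rule permutation_comp_permutes[OF \<pi>(1) permutes_inv[OF f(2)] f(5)])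
  note cov = orbits_cover_cycle[OF \<pi>(1,2) f(2,1,4), folded p_def]
  show "(\<Union>x\<in>moved \<sigma>. orbit p x) = C" by (rule cov)
  show cl: "p x \<in> C" if "x \<in> C" for x using cov(2)[OF that] .
  have pD: "p x = \<pi> x" if "x \<in> D" for x
    unfolding p_def
    by (rule step_outside[OF f(2,1), of D]) (use CD that cyclic_on_inI[OF \<pi>(3) that] in auto)
  show "p x \<in> D" if "x \<in> D" for x using pD[OF that] cyclic_on_inI[OF \<pi>(3) that] by simp
  show "orbit p x = D" if "x \<in> D" for x
  proof -
    have "orbit p x = orbit \<pi> x"
      by (rule orbit_cong0[symmetric, OF that]) (use pD cyclic_on_inI[OF \<pi>(3)] in auto)
    then show ?thesis using orbit_cyclic_eq3[OF \<pi>(3) that] by simp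
  qed
  show "orbit \<pi> ` moved \<sigma> = {C}"
    using f(1,4) orbit_cyclic_eq3[OF \<pi>(2)] by (auto simp: image_def)
  show "orbit p x \<subseteq> C" if "x \<in> moved \<sigma>" for x
    using closed_orbit_subset[of C p x] cl that f(1) by auto
qed

text \<open>Adding \<open>D\<close> to one arc does not change the number of parts. So
  \<open>Q\<close> has as many parts as the support has points, which is what the counts require
  when only one cycle of \<open>\<pi>\<close> meets the support.\<close>

lemma attach_in_steps:
  assumes \<pi>: "permutation \<pi>" "cyclic_on \<pi> C" "cyclic_on \<pi> D" and CD: "C \<inter> D = {}"
    and cyc: "is_cycle C \<sigma>" and inj: "inj_on (orbit (pinv \<sigma> \<circ> \<pi>)) (moved \<sigma>)" and a: "a \<in> moved \<sigma>"
  shows "attach \<pi> D (a, \<sigma>) \<in> steps \<pi> (C \<union> D)"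
proof -
  define p where "p = pinv \<sigma> \<circ> \<pi>"
  define A where "A = moved \<sigma>"
  define Q where "Q = insert (orbit p a \<union> D) (orbit p ` (A - {a}))"
  note f = is_cycle_facts[OF cyc, folded A_def]
  note s = attach_setup[OF \<pi> CD cyc, folded p_def A_def]
  have inj: "inj_on (orbit p) A" and a: "a \<in> A" using inj a by (simp_all add: p_def A_def)
  have "cyclic_on \<pi> D" by (rule \<pi>)
  then obtain d where d: "d \<in> D" by (auto simp: cyclic_on_def)
  have xA: "x \<in> orbit p x" for x using permutation_self_in_orbit[OF s(1)] .
  have new: "orbit p a \<union> D \<notin> orbit p ` (A - {a})"
    using s(7) d CD by blast
  have part: "partition_on (C \<union> D) Q"
  proof (rule partition_onI)
    show "\<Union>Q = C \<union> D" using s(2) a unfolding Q_def by blast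
    show "{} \<notin> Q" using d orbit_nonempty unfolding Q_def by (metis (no_types, lifting) empty_iff imageE insertE UnI2)
    have dis: "disjnt (orbit p a \<union> D) (orbit p x)" if "x \<in> A - {a}" for x
    proof -
      have "orbit p a \<noteq> orbit p x" using inj a that by (auto dest: inj_onD)
      then have "orbit p a \<inter> orbit p x = {}" by (rule orbit_disjoint[OF s(1)])
      then show ?thesis using s(7)[of x] that CD by (auto simp: disjnt_def)
    qed
    show "disjnt X Y" if "X \<in> Q" "Y \<in> Q" "X \<noteq> Y" for X Y
    proof (cases "X = orbit p a \<union> D \<or> Y = orbit p a \<union> D")
      case True
      then show ?thesis using that dis disjnt_sym unfolding Q_def by blast
    next
      case False
      then have "X \<in> orbit p ` (A - {a})" "Y \<in> orbit p ` (A - {a})"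
        using that(1,2) unfolding Q_def by (simp_all only: insert_iff de_Morgan_disj simp_thms)
      then obtain x y where "X = orbit p x" "Y = orbit p y" by blast
      then show ?thesis using orbit_disjoint[OF s(1), of x y] that(3) by (simp add: disjnt_def)
    qed
  qed
  have "\<forall>X\<in>Q. X \<inter> A \<noteq> {} \<and> (\<forall>x\<in>X. p x \<in> X)"
  proof
    fix X assume X: "X \<in> Q"
    have "X \<inter> A \<noteq> {}" using X xA a unfolding Q_def by blast
    moreover have "p x \<in> X" if "x \<in> X" for x
      using X that s(4) orbit.step[of x p] unfolding Q_def by auto
    ultimately show "X \<inter> A \<noteq> {} \<and> (\<forall>x\<in>X. p x \<in> X)" by auto
  qed
  moreover have "card Q = card A"
  proof -
    have "card Q = Suc (card (orbit p ` (A - {a})))"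
      unfolding Q_def using new f(5) by simp
    also have "card (orbit p ` (A - {a})) = card (A - {a})"
      by (rule card_image) (use inj in \<open>auto intro: inj_on_subset\<close>)
    finally show ?thesis using card_Suc_Diff1[OF f(5) a] by simp
  qed
  moreover have "card (orbit p ` A) = card A" by (rule card_image[OF inj])
  moreover have "is_cycle (C \<union> D) \<sigma>" using cyc by (auto simp: is_cycle_def)
  ultimately show ?thesis
    using part s(6) by (simp add: attach_def steps_def p_def[symmetric] A_def[symmetric] Q_def[symmetric])
      (simp add: p_def)
qed

text \<open>Every block meets the support, which lies in \<open>C\<close>. Deleting \<open>D\<close>
  from the blocks therefore leaves an invariant partition of \<open>C\<close> with as many parts as
  there are arcs, so its parts are the arcs. \<open>D\<close> is an orbit of \<open>p\<close> and
  was contained in a single block; the point of the support in that block is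
  \<open>a\<close>.\<close>

lemma steps_attach:
  assumes \<pi>: "permutation \<pi>" "cyclic_on \<pi> C" "cyclic_on \<pi> D" and CD: "C \<inter> D = {}"
    and st: "(\<sigma>, Q) \<in> steps \<pi> (C \<union> D)" and sub: "moved \<sigma> \<subseteq> C"
  obtains a where "is_cycle C \<sigma>" "inj_on (orbit (pinv \<sigma> \<circ> \<pi>)) (moved \<sigma>)" "a \<in> moved \<sigma>"
    "(\<sigma>, Q) = attach \<pi> D (a, \<sigma>)"
proof -
  define p where "p = pinv \<sigma> \<circ> \<pi>"
  define A where "A = moved \<sigma>"
  have cyc: "is_cycle C \<sigma>" using st sub by (auto simp: steps_def is_cycle_def)
  note f = is_cycle_facts[OF cyc, folded A_def]
  note s = attach_setup[OF \<pi> CD cyc, folded p_def A_def]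
  have Q: "partition_on (C \<union> D) Q" and cl: "\<And>X x. X \<in> Q \<Longrightarrow> x \<in> X \<Longrightarrow> p x \<in> X"
    and meet: "\<And>X. X \<in> Q \<Longrightarrow> X \<inter> A \<noteq> {}"
    and c: "card Q = card (orbit p ` A)" "card (orbit \<pi> ` A) + card Q = card A + 1"
    using st by (auto simp: steps_def A_def p_def)
  have xA: "x \<in> orbit p x" for x using permutation_self_in_orbit[OF s(1)] .
  have disj: "X = Y" if "X \<in> Q" "Y \<in> Q" "z \<in> X" "z \<in> Y" for X Y z
    using partition_onD2[OF Q] that by (auto simp: pairwise_def disjnt_def)
  have cA: "card (orbit p ` A) = card A" using c s(6) by simp
  then have inj: "inj_on (orbit p) A" by (intro eq_card_imp_inj_on f(5))
  obtain d where d: "d \<in> D" using \<pi>(3) by (auto simp: cyclic_on_def)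
  obtain X0 where X0: "X0 \<in> Q" "d \<in> X0" using d partition_onD1[OF Q] by auto
  have DX0: "D \<subseteq> X0" using closed_orbit_subset[of X0 p d] cl[OF X0(1)] X0(2) s(5)[OF d] by simp
  obtain a where a: "a \<in> A" "a \<in> X0" using meet[OF X0(1)] by auto
  have AD: "A \<inter> D = {}" using f(1) CD by auto
  have out: "X \<inter> D = {}" if "X \<in> Q" "X \<noteq> X0" for X
    using that DX0 disj[OF that(1) X0(1)] by blast
  let ?r = "\<lambda>X. X - D"
  \<comment> \<open>Two blocks with the same trace outside \<open>D\<close> share a point of the
    support, which avoids \<open>D\<close>.\<close>
  have rinj: "inj_on ?r Q"
  proof (rule inj_onI)
    fix X Y assume XY: "X \<in> Q" "Y \<in> Q" "X - D = Y - D"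
    obtain z where "z \<in> X" "z \<in> A" using meet XY by auto
    then have "z \<in> Y" using XY AD by auto
    then show "X = Y" using disj XY \<open>z \<in> X\<close> by blast
  qed
  have part: "partition_on C (?r ` Q)"
  proof (rule partition_onI)
    show "\<Union>(?r ` Q) = C" using partition_onD1[OF Q] CD by auto
    show "{} \<notin> ?r ` Q" using meet AD by blast
    show "disjnt X Y" if XY: "X \<in> ?r ` Q" "Y \<in> ?r ` Q" "X \<noteq> Y" for X Y
    proof -
      obtain X' Y' where X': "X' \<in> Q" "X = X' - D" "Y' \<in> Q" "Y = Y' - D" using XY by blast
      then have "X' \<noteq> Y'" using XY by auto
      then have "X' \<inter> Y' = {}" using disj X' by blast
      then show ?thesis using X' by (auto simp: disjnt_def)
    qed
  qed
  have "?r ` Q = orbit p ` A"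
  proof (rule invariant_partition_eq_orbits[OF s(1) part f(5) _ _ s(2)])
    show "p x \<in> X" if X: "X \<in> ?r ` Q" "x \<in> X" for X x
    proof -
      obtain X' where X': "X' \<in> Q" "X = X' - D" using X(1) by blast
      have "x \<in> C" using X partition_onD1[OF part] by auto
      then have "p x \<in> C" by (rule s(3))
      then show ?thesis using cl[OF X'(1)] X' X CD by auto
    qed
    show "X \<inter> A \<noteq> {}" if "X \<in> ?r ` Q" for X using that meet AD by blast
    show "card (?r ` Q) = card (orbit p ` A)" using card_image[OF rinj] c by simp
  qed
  have aX: "X0 - D = orbit p a"
  proof -
    have "X0 - D \<in> orbit p ` A" using X0 \<open>?r ` Q = orbit p ` A\<close> by blast
    then obtain a' where a': "a' \<in> A" "X0 - D = orbit p a'" by auto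
    then have "a \<in> orbit p a'" using a AD by auto
    then show ?thesis using a' by (simp add: in_orbit_iff[OF s(1)])
  qed
  have "Q - {X0} = ?r ` (Q - {X0})"
  proof -
    have "?r ` (Q - {X0}) = (\<lambda>X. X) ` (Q - {X0})" by (rule image_cong[OF refl]) (use out in auto)
    then show ?thesis by simp
  qed
  also have "\<dots> = ?r ` Q - ?r ` {X0}" by (rule inj_on_image_set_diff[OF rinj]) (use X0 in auto)
  also have "\<dots> = orbit p ` A - orbit p ` {a}" using \<open>?r ` Q = orbit p ` A\<close> aX by simp
  also have "\<dots> = orbit p ` (A - {a})" by (rule inj_on_image_set_diff[OF inj, symmetric]) (use a in auto)
  finally have "Q - {X0} = orbit p ` (A - {a})" .
  moreover have "X0 = orbit p a \<union> D" using aX DX0 by blast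
  moreover have "Q = insert X0 (Q - {X0})" using X0(1) by blast
  ultimately have "Q = insert (orbit p a \<union> D) (orbit p ` (A - {a}))" by simp
  then show ?thesis
    using that[of a] cyc inj a by (simp add: attach_def p_def A_def)
qed

text \<open>The block that contains \<open>D\<close> reveals the arc of the root, and an arc
  contains only one point of the support.\<close>

lemma inj_on_attach:
  assumes \<pi>: "permutation \<pi>" "cyclic_on \<pi> C" "cyclic_on \<pi> D" and CD: "C \<inter> D = {}"
  shows "inj_on (attach \<pi> D) {(a, \<sigma>). is_cycle C \<sigma> \<and> inj_on (orbit (pinv \<sigma> \<circ> \<pi>)) (moved \<sigma>) \<and> a \<in> moved \<sigma>}"
proof (rule inj_onI, clarify, rule conjI)
  fix a \<sigma> b \<tau>
  assume 1: "is_cycle C \<sigma>" "inj_on (orbit (pinv \<sigma> \<circ> \<pi>)) (moved \<sigma>)" "a \<in> moved \<sigma>"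
    and 2: "b \<in> moved \<tau>" and eq: "attach \<pi> D (a, \<sigma>) = attach \<pi> D (b, \<tau>)"
  show st: "\<sigma> = \<tau>" using eq by (simp add: attach_def)
  let ?p = "pinv \<sigma> \<circ> \<pi>"
  note s = attach_setup[OF \<pi> CD 1(1)]
  obtain d where d: "d \<in> D" using \<pi>(3) by (auto simp: cyclic_on_def)
  have "insert (orbit ?p a \<union> D) (orbit ?p ` (moved \<sigma> - {a})) = insert (orbit ?p b \<union> D) (orbit ?p ` (moved \<sigma> - {b}))"
    using eq st by (simp add: attach_def)
  then have "orbit ?p a \<union> D \<in> insert (orbit ?p b \<union> D) (orbit ?p ` (moved \<sigma> - {b}))" by blast
  moreover have "orbit ?p a \<union> D \<notin> orbit ?p ` (moved \<sigma> - {b})"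
    using s(7) d CD by blast
  ultimately have "orbit ?p a \<union> D = orbit ?p b \<union> D" by simp
  moreover have "a \<in> orbit ?p a" "b \<in> orbit ?p b" using permutation_self_in_orbit[OF s(1)] by auto
  moreover have "a \<notin> D" using is_cycle_facts(1)[OF 1(1)] 1(3) CD by auto
  ultimately have "a \<in> orbit ?p b" by auto
  then have "orbit ?p a = orbit ?p b" by (simp add: in_orbit_iff[OF s(1)])
  then show "a = b" using 1 2 st by (auto dest: inj_onD)
qed

text \<open>The part made of the root's arc and \<open>D\<close> has two cycles and contributes
  \<open>h\<close>; the other arcs contribute \<open>W\<close>. Every point of \<open>C\<close> can
  be the root and gives the same sum, whence the factor \<open>card C\<close>.\<close>

lemma attach_sum:
  fixes W :: "'c::comm_ring_1 fps"
  assumes \<pi>: "permutation \<pi>" "cyclic_on \<pi> C" "cyclic_on \<pi> D" and CD: "C \<inter> D = {}"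
    and W0: "W $ 0 = 0" and h0: "\<And>b. h 0 b = 0" and hsym: "\<And>a b. h a b = h b a"
  shows "(\<Sum>(\<sigma>, Q) | (\<sigma>, Q) \<in> steps \<pi> (C \<union> D) \<and> moved \<sigma> \<subseteq> C.
      q (card (moved \<sigma>)) * (\<Prod>X\<in>Q. block_weight W h (pinv \<sigma> \<circ> \<pi>) X))
    = of_nat (card C) * (\<Sum>k=2..card C. q k * (Abs_fps (\<lambda>g. h g (card D)) * W ^ (k - 1)) $ card C)"
proof -
  define T where "T = {(a, \<sigma>). is_cycle C \<sigma> \<and> inj_on (orbit (pinv \<sigma> \<circ> \<pi>)) (moved \<sigma>) \<and> a \<in> moved \<sigma>}"
  define \<Phi> where "\<Phi> = Abs_fps (\<lambda>g. h g (card D))"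
  have finC: "finite C" using \<pi>(2) by (rule finite_cyclic_on)
  have im: "{(\<sigma>, Q). (\<sigma>, Q) \<in> steps \<pi> (C \<union> D) \<and> moved \<sigma> \<subseteq> C} = attach \<pi> D ` T"
  proof (intro equalityI subsetI)
    fix s assume "s \<in> {(\<sigma>, Q). (\<sigma>, Q) \<in> steps \<pi> (C \<union> D) \<and> moved \<sigma> \<subseteq> C}"
    then obtain \<sigma> Q where [simp]: "s = (\<sigma>, Q)" and s: "(\<sigma>, Q) \<in> steps \<pi> (C \<union> D)" "moved \<sigma> \<subseteq> C" by auto
    obtain a where "(a, \<sigma>) \<in> T" "s = attach \<pi> D (a, \<sigma>)"
      using steps_attach[OF \<pi> CD s] by (auto simp: T_def)
    then show "s \<in> attach \<pi> D ` T" by blast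
  next
    fix s assume "s \<in> attach \<pi> D ` T"
    then obtain a \<sigma> where t: "s = attach \<pi> D (a, \<sigma>)" "(a, \<sigma>) \<in> T" by auto
    then have "s \<in> steps \<pi> (C \<union> D)" using attach_in_steps[OF \<pi> CD] by (auto simp: T_def)
    moreover have "moved \<sigma> \<subseteq> C" using t is_cycle_facts(1) by (auto simp: T_def)
    ultimately show "s \<in> {(\<sigma>, Q). (\<sigma>, Q) \<in> steps \<pi> (C \<union> D) \<and> moved \<sigma> \<subseteq> C}"
      using t by (auto simp: attach_def)
  qed
  have "(\<Sum>(\<sigma>, Q) | (\<sigma>, Q) \<in> steps \<pi> (C \<union> D) \<and> moved \<sigma> \<subseteq> C.
      q (card (moved \<sigma>)) * (\<Prod>X\<in>Q. block_weight W h (pinv \<sigma> \<circ> \<pi>) X))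
    = (\<Sum>(a, \<sigma>)\<in>T. q (card (moved \<sigma>)) * (\<Phi> $ card (orbit (pinv \<sigma> \<circ> \<pi>) a) *
        (\<Prod>x\<in>moved \<sigma> - {a}. W $ card (orbit (pinv \<sigma> \<circ> \<pi>) x))))"
    unfolding im
  proof (subst sum.reindex)
    show "inj_on (attach \<pi> D) T" unfolding T_def by (rule inj_on_attach[OF \<pi> CD])
    show "sum ((\<lambda>(\<sigma>, Q). q (card (moved \<sigma>)) * (\<Prod>X\<in>Q. block_weight W h (pinv \<sigma> \<circ> \<pi>) X)) \<circ> attach \<pi> D) T =
      (\<Sum>(a, \<sigma>)\<in>T. q (card (moved \<sigma>)) * (\<Phi> $ card (orbit (pinv \<sigma> \<circ> \<pi>) a) *
        (\<Prod>x\<in>moved \<sigma> - {a}. W $ card (orbit (pinv \<sigma> \<circ> \<pi>) x))))"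
    proof (rule sum.cong[OF refl])
      fix t assume "t \<in> T"
      then obtain a \<sigma> where [simp]: "t = (a, \<sigma>)" and cyc: "is_cycle C \<sigma>"
        and inj: "inj_on (orbit (pinv \<sigma> \<circ> \<pi>)) (moved \<sigma>)" and a: "a \<in> moved \<sigma>" by (auto simp: T_def)
      define p where "p = pinv \<sigma> \<circ> \<pi>"
      note f = is_cycle_facts[OF cyc]
      note s = attach_setup[OF \<pi> CD cyc, folded p_def]
      obtain d where d: "d \<in> D" using \<pi>(3) by (auto simp: cyclic_on_def)
      have new: "orbit p a \<union> D \<notin> orbit p ` (moved \<sigma> - {a})" using s(7) d CD by blast
      have "orbit p ` D = {D}" using s(5) d by (auto simp: image_def)
      then have o2: "orbit p ` (orbit p a \<union> D) = {orbit p a, D}"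
        unfolding image_Un orbit_image_orbit[OF s(1)] by auto
      have ne: "orbit p a \<noteq> D" using s(7)[OF a] d CD by auto
      have "(\<Prod>X\<in>insert (orbit p a \<union> D) (orbit p ` (moved \<sigma> - {a})). block_weight W h p X)
        = block_weight W h p (orbit p a \<union> D) * (\<Prod>X\<in>orbit p ` (moved \<sigma> - {a}). block_weight W h p X)"
        using new f(5) by simp
      also have "block_weight W h p (orbit p a \<union> D) = \<Phi> $ card (orbit p a)"
        unfolding block_weight_two[OF hsym o2 ne] by (simp add: \<Phi>_def)
      also have "(\<Prod>X\<in>orbit p ` (moved \<sigma> - {a}). block_weight W h p X)
        = (\<Prod>x\<in>moved \<sigma> - {a}. W $ card (orbit p x))"
        using inj by (subst prod.reindex) (auto simp: p_def block_weight_orbit s(1)[unfolded p_def] intro: inj_on_subset)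
      finally have e: "(\<Prod>X\<in>insert (orbit p a \<union> D) (orbit p ` (moved \<sigma> - {a})). block_weight W h p X)
        = \<Phi> $ card (orbit p a) * (\<Prod>x\<in>moved \<sigma> - {a}. W $ card (orbit p x))" .
      show "((\<lambda>(\<sigma>, Q). q (card (moved \<sigma>)) * (\<Prod>X\<in>Q. block_weight W h (pinv \<sigma> \<circ> \<pi>) X)) \<circ> attach \<pi> D) t =
        (case t of (a, \<sigma>) \<Rightarrow> q (card (moved \<sigma>)) * (\<Phi> $ card (orbit (pinv \<sigma> \<circ> \<pi>) a) *
          (\<Prod>x\<in>moved \<sigma> - {a}. W $ card (orbit (pinv \<sigma> \<circ> \<pi>) x))))"
        using e unfolding p_def by (simp only: attach_def o_apply prod.case \<open>t = (a, \<sigma>)\<close>)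
    qed
  qed
  also have "T = (SIGMA a:C. {\<sigma>. is_cycle C \<sigma> \<and> inj_on (orbit (pinv \<sigma> \<circ> \<pi>)) (moved \<sigma>) \<and> a \<in> moved \<sigma>})"
    using is_cycle_facts(1) by (auto simp: T_def)
  also have "(\<Sum>(a, \<sigma>)\<in>\<dots>. q (card (moved \<sigma>)) * (\<Phi> $ card (orbit (pinv \<sigma> \<circ> \<pi>) a) *
        (\<Prod>x\<in>moved \<sigma> - {a}. W $ card (orbit (pinv \<sigma> \<circ> \<pi>) x))))
    = (\<Sum>a\<in>C. \<Sum>\<sigma> | is_cycle C \<sigma> \<and> inj_on (orbit (pinv \<sigma> \<circ> \<pi>)) (moved \<sigma>) \<and> a \<in> moved \<sigma>.
        q (card (moved \<sigma>)) * (\<Phi> $ card (orbit (pinv \<sigma> \<circ> \<pi>) a) *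
        (\<Prod>x\<in>moved \<sigma> - {a}. W $ card (orbit (pinv \<sigma> \<circ> \<pi>) x))))"
  proof (rule sum.Sigma[symmetric, OF finC], rule ballI)
    show "finite {\<sigma>. is_cycle C \<sigma> \<and> inj_on (orbit (pinv \<sigma> \<circ> \<pi>)) (moved \<sigma>) \<and> a \<in> moved \<sigma>}" for a
      by (rule finite_subset[OF _ finite_permutations[OF finC]]) (auto simp: is_cycle_facts(6))
  qed
  also have "\<dots> = (\<Sum>a\<in>C. \<Sum>k=2..card C. q k * (\<Phi> * W ^ (k - 1)) $ card C)"
    by (intro sum.cong refl rooted_sum[OF \<pi>(1,2)]) (simp_all add: W0 \<Phi>_def h0)
  also have "\<dots> = of_nat (card C) * (\<Sum>k=2..card C. q k * (\<Phi> * W ^ (k - 1)) $ card C)" by simp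
  finally show ?thesis unfolding \<Phi>_def .
qed

text \<open>One inclusion holds because \<open>\<rho>\<close> acts at each point of \<open>A\<close>
  as some power of \<open>\<pi>\<close>. For the other, the arcs of the points in one cycle of
  \<open>\<rho>\<close> form together a set closed under \<open>\<pi>\<close>.\<close>

lemma orbit_first_return:
  assumes \<pi>: "permutation \<pi>" and \<rho>: "\<rho> permutes A" "finite A"
    and inj: "inj_on (orbit (pinv \<rho> \<circ> \<pi>)) A" and x: "x \<in> A"
  shows "orbit \<rho> x = A \<inter> orbit \<pi> x"
proof -
  define p where "p = pinv \<rho> \<circ> \<pi>"
  have p: "permutation p"
    unfolding p_def by (rule permutation_comp_permutes[OF \<pi> permutes_inv[OF \<rho>(1)] \<rho>(2)])
  have \<rho>p: "\<rho> (p y) = \<pi> y" for y using inv_comp_cancel(2)[OF \<rho>(1), of \<pi>] unfolding p_def by (metis o_apply)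
  show ?thesis
  proof (intro equalityI subsetI)
    fix y assume "y \<in> orbit \<rho> x"
    moreover have "orbit \<rho> x \<subseteq> A \<inter> orbit \<pi> x"
    proof (rule orbit_subset_closed)
      show "x \<in> A \<inter> orbit \<pi> x" using x permutation_self_in_orbit[OF \<pi>] by simp
      fix y assume y: "y \<in> A \<inter> orbit \<pi> x"
      have "\<rho> y \<in> A" using y permutes_in_image[OF \<rho>(1)] by simp
      moreover have "\<rho> y \<in> orbit \<pi> x"
        using return_steps(1)[OF \<pi> \<rho> inj, of y] y funpow_in_orbit[of y \<pi> x] by (metis IntD1 IntD2)
      ultimately show "\<rho> y \<in> A \<inter> orbit \<pi> x" by simp
    qed
    ultimately show "y \<in> A \<inter> orbit \<pi> x" by blast
  next
    fix w assume w: "w \<in> A \<inter> orbit \<pi> x"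
    define U where "U = (\<Union>y\<in>orbit \<rho> x. orbit p y)"
    have oA: "orbit \<rho> x \<subseteq> A" by (rule permutes_orbit_subset[OF \<rho>(1) x])
    have "permutation \<rho>" using \<rho> permutation_permutes by auto
    note self = permutation_self_in_orbit[OF this] permutation_self_in_orbit[OF p]
    have "orbit \<pi> x \<subseteq> U"
    proof (rule orbit_subset_closed)
      show "x \<in> U" using self by (auto simp: U_def)
      fix z assume "z \<in> U"
      then obtain y where y: "y \<in> orbit \<rho> x" "z \<in> orbit p y" by (auto simp: U_def)
      have pz: "p z \<in> orbit p y" using y(2) by (rule orbit.step)
      show "\<pi> z \<in> U"
      proof (cases "p z \<in> A")
        \<comment> \<open>The arc closes at its own point \<open>y\<close>, and \<open>\<pi>\<close>
          passes on to the arc of \<open>\<rho> y\<close>.\<close>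
        case True
        then have "p z = y" using inj oA y(1) pz
          by (metis (no_types, lifting) in_orbit_iff[OF p] inj_onD p_def subsetD)
        then have "\<pi> z = \<rho> y" using \<rho>p[of z] by simp
        moreover have "\<rho> y \<in> orbit \<rho> x" using y(1) by (rule orbit.step)
        ultimately show ?thesis using self(2)[of "\<pi> z"] unfolding U_def by auto
      next
        case False
        then have "\<pi> z = p z" using \<rho>p[of z] permutes_not_in[OF \<rho>(1)] by metis
        then show ?thesis using pz y(1) by (auto simp: U_def)
      qed
    qed
    then obtain y where y: "y \<in> orbit \<rho> x" "w \<in> orbit p y" using w by (auto simp: U_def)
    then have "w = y" using inj oA w
      by (metis (no_types, lifting) IntD1 in_orbit_iff[OF p] inj_onD p_def subsetD)
    then show "w \<in> orbit \<rho> x" using y by simp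
  qed
qed

lemma pinv_comp:
  assumes "\<rho> permutes A" "\<tau> permutes B"
  shows "pinv (\<rho> \<circ> \<tau>) = pinv \<tau> \<circ> pinv \<rho>"
  using o_inv_distrib[OF permutes_bij[OF assms(1)] permutes_bij[OF assms(2)]] .

text \<open>Each of the two maps moves points of one cycle only, and both cycles are invariant, so
  on either cycle just one of the maps acts.\<close>

lemma orbits_split:
  assumes \<pi>: "cyclic_on \<pi> C" "cyclic_on \<pi> D" "permutation \<pi>" and CD: "C \<inter> D = {}"
    and 1: "\<rho>\<^sub>1 permutes A\<^sub>1" "A\<^sub>1 \<subseteq> C" and 2: "\<rho>\<^sub>2 permutes A\<^sub>2" "A\<^sub>2 \<subseteq> D"
  shows "x \<in> C \<Longrightarrow> orbit (pinv (\<rho>\<^sub>1 \<circ> \<rho>\<^sub>2) \<circ> \<pi>) x = orbit (pinv \<rho>\<^sub>1 \<circ> \<pi>) x"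
    and "x \<in> D \<Longrightarrow> orbit (pinv (\<rho>\<^sub>1 \<circ> \<rho>\<^sub>2) \<circ> \<pi>) x = orbit (pinv \<rho>\<^sub>2 \<circ> \<pi>) x"
    and "x \<in> C \<Longrightarrow> orbit (pinv \<rho>\<^sub>1 \<circ> \<pi>) x \<subseteq> C"
    and "x \<in> D \<Longrightarrow> orbit (pinv \<rho>\<^sub>2 \<circ> \<pi>) x \<subseteq> D"
proof -
  have i1: "pinv \<rho>\<^sub>1 permutes A\<^sub>1" and i2: "pinv \<rho>\<^sub>2 permutes A\<^sub>2"
    using 1 2 permutes_inv by auto
  have C: "\<pi> y \<in> C" "pinv \<rho>\<^sub>1 (\<pi> y) \<in> C" if "y \<in> C" for y
    using cyclic_on_inI[OF \<pi>(1) that] permutes_in_image[OF permutes_subset[OF i1 1(2)]] by simp_all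
  have D: "\<pi> y \<in> D" "pinv \<rho>\<^sub>2 (\<pi> y) \<in> D" if "y \<in> D" for y
    using cyclic_on_inI[OF \<pi>(2) that] permutes_in_image[OF permutes_subset[OF i2 2(2)]] by simp_all
  note inv = pinv_comp[OF 1(1) 2(1)]
  have fixC: "pinv \<rho>\<^sub>2 y = y" if "y \<in> C" for y using permutes_not_in[OF i2, of y] that 2(2) CD by auto
  have fixD: "pinv \<rho>\<^sub>1 y = y" if "y \<in> D" for y using permutes_not_in[OF i1, of y] that 1(2) CD by auto
  show "orbit (pinv (\<rho>\<^sub>1 \<circ> \<rho>\<^sub>2) \<circ> \<pi>) x = orbit (pinv \<rho>\<^sub>1 \<circ> \<pi>) x" if "x \<in> C"
    by (rule orbit_cong0[OF that]) (use C fixC in \<open>auto simp: inv\<close>)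
  show "orbit (pinv (\<rho>\<^sub>1 \<circ> \<rho>\<^sub>2) \<circ> \<pi>) x = orbit (pinv \<rho>\<^sub>2 \<circ> \<pi>) x" if "x \<in> D"
    by (rule orbit_cong0[OF that]) (use D fixD in \<open>auto simp: inv\<close>)
  show "orbit (pinv \<rho>\<^sub>1 \<circ> \<pi>) x \<subseteq> C" if "x \<in> C"
    by (rule closed_orbit_subset) (use C that in auto)
  show "orbit (pinv \<rho>\<^sub>2 \<circ> \<pi>) x \<subseteq> D" if "x \<in> D"
    by (rule closed_orbit_subset) (use D that in auto)
qed

text \<open>An orbit of \<open>p\<close> that avoided the support would be an orbit of
  \<open>\<pi>\<close>, hence \<open>C\<close> or \<open>D\<close>, and both of them meet the
  support.\<close>

lemma orbits_cover_two:
  assumes \<pi>: "permutation \<pi>" "cyclic_on \<pi> C" "cyclic_on \<pi> D"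
    and \<sigma>: "\<sigma> permutes A" "finite A" and A: "A \<subseteq> C \<union> D" "A \<inter> C \<noteq> {}" "A \<inter> D \<noteq> {}"
  defines "p \<equiv> pinv \<sigma> \<circ> \<pi>"
  shows "(\<Union>x\<in>A. orbit p x) = C \<union> D" "\<And>x. x \<in> C \<union> D \<Longrightarrow> p x \<in> C \<union> D"
proof -
  have p: "permutation p"
    unfolding p_def by (rule permutation_comp_permutes[OF \<pi>(1) permutes_inv[OF \<sigma>(1)] \<sigma>(2)])
  show cl: "p x \<in> C \<union> D" if "x \<in> C \<union> D" for x
  proof -
    have "\<pi> x \<in> C \<union> D" using that cyclic_on_inI[OF \<pi>(2), of x] cyclic_on_inI[OF \<pi>(3), of x] by auto
    then show ?thesis
      using permutes_in_image[OF permutes_subset[OF permutes_inv[OF \<sigma>(1)] A(1)]] by (simp add: p_def)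
  qed
  show "(\<Union>x\<in>A. orbit p x) = C \<union> D"
  proof (intro equalityI subsetI)
    fix y assume "y \<in> (\<Union>x\<in>A. orbit p x)"
    then show "y \<in> C \<union> D" using closed_orbit_subset[of "C \<union> D" p] cl A(1) by blast
  next
    fix y assume y: "y \<in> C \<union> D"
    have "orbit p y \<inter> A \<noteq> {}"
    proof
      assume e: "orbit p y \<inter> A = {}"
      have "orbit (\<sigma> \<circ> p) y = orbit p y" by (rule orbit_comp_disjoint[OF p \<sigma>(1) e])
      moreover have "\<sigma> \<circ> p = \<pi>" unfolding p_def by (rule inv_comp_cancel[OF \<sigma>(1)])
      ultimately have "orbit p y = C \<or> orbit p y = D"
        using y orbit_cyclic_eq3[OF \<pi>(2)] orbit_cyclic_eq3[OF \<pi>(3)] by auto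
      then show False using e A by auto
    qed
    then obtain x where x: "x \<in> A" "x \<in> orbit p y" by auto
    then have "orbit p x = orbit p y" by (simp add: in_orbit_iff[OF p])
    then have "y \<in> orbit p x" using permutation_self_in_orbit[OF p] by auto
    then show "y \<in> (\<Union>x\<in>A. orbit p x)" using x by auto
  qed
qed

text \<open>The root varies, and the support may be a single point with \<open>\<rho>\<close> the
  identity: a factor that meets both cycles may move just one point of either.\<close>

definition rooted_arcs :: "'a set \<Rightarrow> ('a \<Rightarrow> 'a) \<Rightarrow> ('a \<times> 'a set \<times> ('a \<Rightarrow> 'a)) set" where
  "rooted_arcs C \<pi> = {(a, A, \<rho>). (A, \<rho>) \<in> arcs C \<pi> a (card A)}"

text \<open>A minimal step whose factor meets both cycles \<open>C\<close> and \<open>D\<close>: the factor is the product of two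
  first-return maps with the transposition of their roots, which joins the two rooted arcs.\<close>

definition glue :: "('a \<Rightarrow> 'a) \<Rightarrow> ('a \<times> 'a set \<times> ('a \<Rightarrow> 'a)) \<times> ('a \<times> 'a set \<times> ('a \<Rightarrow> 'a)) \<Rightarrow>
    ('a \<Rightarrow> 'a) \<times> 'a set set" where
  "glue \<pi> = (\<lambda>((a, A\<^sub>1, \<rho>\<^sub>1), (b, A\<^sub>2, \<rho>\<^sub>2)).
     (\<rho>\<^sub>1 \<circ> \<rho>\<^sub>2 \<circ> tau a b, orbit (pinv (\<rho>\<^sub>1 \<circ> \<rho>\<^sub>2 \<circ> tau a b) \<circ> \<pi>) ` (A\<^sub>1 \<union> A\<^sub>2)))"

text \<open>The transposition acts twice. Moved to the left of
  \<open>\<rho>\<^sub>1 \<circ> \<rho>\<^sub>2\<close>, it exchanges a point of each support and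
  joins the two cycles into the single cycle \<open>\<sigma>\<close>. In
  \<open>pinv \<sigma> \<circ> \<pi>\<close> it stands on the left and joins the arcs of
  \<open>a\<close> and \<open>b\<close>.\<close>

lemma glue_setup:
  assumes \<pi>: "permutation \<pi>" "cyclic_on \<pi> C" "cyclic_on \<pi> D" and CD: "C \<inter> D = {}"
    and 1: "(a, A\<^sub>1, \<rho>\<^sub>1) \<in> rooted_arcs C \<pi>" and 2: "(b, A\<^sub>2, \<rho>\<^sub>2) \<in> rooted_arcs D \<pi>"
  defines "\<sigma> \<equiv> \<rho>\<^sub>1 \<circ> \<rho>\<^sub>2 \<circ> tau a b" and "A \<equiv> A\<^sub>1 \<union> A\<^sub>2"
  defines "p \<equiv> pinv \<sigma> \<circ> \<pi>" and "p\<^sub>1 \<equiv> pinv \<rho>\<^sub>1 \<circ> \<pi>" and "p\<^sub>2 \<equiv> pinv \<rho>\<^sub>2 \<circ> \<pi>"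
  shows "is_cycle (C \<union> D) \<sigma>" "moved \<sigma> = A" "A\<^sub>1 = A \<inter> C" "A\<^sub>2 = A \<inter> D" "a \<in> A\<^sub>1" "b \<in> A\<^sub>2"
    "card A = card A\<^sub>1 + card A\<^sub>2"
    "permutation p" "orbit p a = orbit p\<^sub>1 a \<union> orbit p\<^sub>2 b" "orbit p b = orbit p\<^sub>1 a \<union> orbit p\<^sub>2 b"
    "\<And>x. x \<in> A\<^sub>1 - {a} \<Longrightarrow> orbit p x = orbit p\<^sub>1 x"
    "\<And>x. x \<in> A\<^sub>2 - {b} \<Longrightarrow> orbit p x = orbit p\<^sub>2 x"
    "\<And>x. x \<in> A\<^sub>1 \<Longrightarrow> orbit p\<^sub>1 x \<subseteq> C" "\<And>x. x \<in> A\<^sub>2 \<Longrightarrow> orbit p\<^sub>2 x \<subseteq> D"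
    "permutation p\<^sub>1" "permutation p\<^sub>2"
    "inj_on (orbit p) (A - {a})"
proof -
  have 1: "A\<^sub>1 \<subseteq> C" "a \<in> A\<^sub>1" "\<rho>\<^sub>1 permutes A\<^sub>1" "cyclic_on \<rho>\<^sub>1 A\<^sub>1" "inj_on (orbit p\<^sub>1) A\<^sub>1"
    using 1 by (auto simp: rooted_arcs_def arcs_def p\<^sub>1_def)
  have 2: "A\<^sub>2 \<subseteq> D" "b \<in> A\<^sub>2" "\<rho>\<^sub>2 permutes A\<^sub>2" "cyclic_on \<rho>\<^sub>2 A\<^sub>2" "inj_on (orbit p\<^sub>2) A\<^sub>2"
    using 2 by (auto simp: rooted_arcs_def arcs_def p\<^sub>2_def)
  show "a \<in> A\<^sub>1" "b \<in> A\<^sub>2" by (rule 1, rule 2)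
  have fin: "finite A\<^sub>1" "finite A\<^sub>2" using 1(4) 2(4) finite_cyclic_on by auto
  have dis: "A\<^sub>1 \<inter> A\<^sub>2 = {}" using 1(1) 2(1) CD by auto
  have finA: "finite A" using fin by (simp add: A_def)
  show cA: "card A = card A\<^sub>1 + card A\<^sub>2" unfolding A_def by (rule card_Un_disjoint[OF fin dis])
  show A1: "A\<^sub>1 = A \<inter> C" and A2: "A\<^sub>2 = A \<inter> D" using 1(1) 2(1) CD by (auto simp: A_def)
  have ab: "a \<noteq> b" using 1(2) 2(2) dis by auto
  define \<rho> where "\<rho> = \<rho>\<^sub>1 \<circ> \<rho>\<^sub>2"
  have r1: "\<rho>\<^sub>1 permutes A" and r2: "\<rho>\<^sub>2 permutes A"
    by (rule permutes_subset[OF 1(3)], simp add: A_def, rule permutes_subset[OF 2(3)], simp add: A_def)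
  have \<rho>: "\<rho> permutes A" unfolding \<rho>_def by (rule permutes_compose[OF r2 r1])
  have tp: "tau a b permutes A" by (rule permutes_swap_id) (use 1(2) 2(2) in \<open>auto simp: A_def\<close>)
  have \<sigma>: "\<sigma> permutes A" unfolding \<sigma>_def \<rho>_def[symmetric] by (rule permutes_compose[OF tp \<rho>])
  have \<rho>1: "\<rho> x = \<rho>\<^sub>1 x" if "x \<in> A\<^sub>1" for x
  proof -
    have "x \<notin> A\<^sub>2" using that dis by auto
    then show ?thesis using permutes_not_in[OF 2(3)] by (simp add: \<rho>_def)
  qed
  have \<rho>2: "\<rho> x = \<rho>\<^sub>2 x" if "x \<in> A\<^sub>2" for x
    using permutes_not_in[OF 1(3)] permutes_in_image[OF 2(3)] that dis by (auto simp: \<rho>_def)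
  have o1: "orbit \<rho> x = A\<^sub>1" if "x \<in> A\<^sub>1" for x
    using orbit_cong0[OF that, of \<rho> \<rho>\<^sub>1] \<rho>1 permutes_in_image[OF 1(3)] orbit_cyclic_eq3[OF 1(4) that] by auto
  have o2: "orbit \<rho> x = A\<^sub>2" if "x \<in> A\<^sub>2" for x
    using orbit_cong0[OF that, of \<rho> \<rho>\<^sub>2] \<rho>2 permutes_in_image[OF 2(3)] orbit_cyclic_eq3[OF 2(4) that] by auto
  have ra: "\<rho> a \<in> A\<^sub>1" and rb: "\<rho> b \<in> A\<^sub>2"
    using \<rho>1 \<rho>2 1(2) 2(2) permutes_in_image[OF 1(3)] permutes_in_image[OF 2(3)] by auto
  have permrho: "permutation \<rho>" using \<rho> finA permutation_permutes by auto
  \<comment> \<open>Conjugation by \<open>\<rho>\<close> carries the transposition to the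
    left.\<close>
  have sw: "\<sigma> = tau (\<rho> a) (\<rho> b) \<circ> \<rho>"
    unfolding \<sigma>_def \<rho>_def[symmetric] using permutes_inj[OF \<rho>]
    by (auto simp: fun_eq_iff Transposition.transpose_def inj_eq)
  have "orbit \<sigma> (\<rho> a) = A"
    unfolding sw A_def using orbit_transp_join(1)[OF permrho, of "\<rho> b" "\<rho> a"] o1[OF ra] o2[OF rb] rb dis by auto
  then have cyc: "cyclic_on \<sigma> A" using ra by (auto simp: cyclic_on_def A_def)
  have c1: "card A\<^sub>1 > 0" "card A\<^sub>2 > 0" using 1(2) 2(2) fin by (auto simp: card_gt_0_iff)
  show mv: "moved \<sigma> = A" by (rule moved_cyclic[OF \<sigma> cyc]) (use cA c1 in simp)
  show "is_cycle (C \<union> D) \<sigma>" using \<sigma> cyc 1(1) 2(1) unfolding is_cycle_def mv by (auto simp: A_def)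
  define p' where "p' = pinv \<rho> \<circ> \<pi>"
  have p': "permutation p'"
    unfolding p'_def by (rule permutation_comp_permutes[OF \<pi>(1) permutes_inv[OF \<rho>] finA])
  show p: "permutation p"
    unfolding p_def by (rule permutation_comp_permutes[OF \<pi>(1) permutes_inv[OF \<sigma>] finA])
  have pp: "p = tau a b \<circ> p'"
    unfolding p_def p'_def \<sigma>_def \<rho>_def[symmetric] pinv_comp[OF \<rho> tp] by (simp add: comp_assoc)
  note os = orbits_split[OF \<pi>(2,3,1) CD 1(3,1) 2(3,1), folded \<rho>_def, folded p'_def p\<^sub>1_def p\<^sub>2_def]
  have x1: "orbit p' x = orbit p\<^sub>1 x" "orbit p\<^sub>1 x \<subseteq> C" if "x \<in> A\<^sub>1" for x 
    using os(1)[of x] os(3)[of x] that 1(1) by auto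
  have x2: "orbit p' x = orbit p\<^sub>2 x" "orbit p\<^sub>2 x \<subseteq> D" if "x \<in> A\<^sub>2" for x 
    using os(2)[of x] os(4)[of x] that 2(1) by auto
  show "orbit p\<^sub>1 x \<subseteq> C" if "x \<in> A\<^sub>1" for x by (rule x1(2)[OF that])
  show "orbit p\<^sub>2 x \<subseteq> D" if "x \<in> A\<^sub>2" for x by (rule x2(2)[OF that])
  show "permutation p\<^sub>1" "permutation p\<^sub>2"
    unfolding p\<^sub>1_def p\<^sub>2_def
    by (rule permutation_comp_permutes[OF \<pi>(1) permutes_inv[OF 1(3)] fin(1)],
        rule permutation_comp_permutes[OF \<pi>(1) permutes_inv[OF 2(3)] fin(2)])
  have self: "x \<in> orbit p' x" for x by (rule permutation_self_in_orbit[OF p'])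
  have inj': "inj_on (orbit p') A"
  proof (rule inj_onI)
    fix x y assume xy: "x \<in> A" "y \<in> A" "orbit p' x = orbit p' y"
    have c: "x \<in> orbit p' y" "y \<in> orbit p' x" using self xy(3) by auto
    consider "x \<in> A\<^sub>1" "y \<in> A\<^sub>1" | "x \<in> A\<^sub>2" "y \<in> A\<^sub>2" | "x \<in> A\<^sub>1" "y \<in> A\<^sub>2" | "x \<in> A\<^sub>2" "y \<in> A\<^sub>1"
      using xy by (auto simp: A_def)
    then show "x = y"
    proof cases
      case 1 then show ?thesis using xy(3) x1 \<open>inj_on (orbit p\<^sub>1) A\<^sub>1\<close> by (auto dest: inj_onD)
    next
      case 2 then show ?thesis using xy(3) x2 \<open>inj_on (orbit p\<^sub>2) A\<^sub>2\<close> by (auto dest: inj_onD)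
    next
      case 3 then show ?thesis using c(2) x1[of x] 2(1) CD by auto
    next
      case 4 then show ?thesis using c(1) x1[of y] 2(1) CD by auto
    qed
  qed
  have aA: "a \<in> A" "b \<in> A" using 1(2) 2(2) by (auto simp: A_def)
  have nb: "b \<notin> orbit p' a"
    using inj_onD[OF inj' _ aA] ab in_orbit_iff[OF p'] by metis
  note join = orbit_transp_join[OF p' nb, folded pp]
  show oa: "orbit p a = orbit p\<^sub>1 a \<union> orbit p\<^sub>2 b" and ob: "orbit p b = orbit p\<^sub>1 a \<union> orbit p\<^sub>2 b"
    using join x1(1)[OF 1(2)] x2(1)[OF 2(2)] by simp_all
  have tab: "tau a b permutes {a, b}" by (rule permutes_swap_id) auto
  have other: "orbit p x = orbit p' x" if "x \<in> A - {a, b}" for x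
    unfolding pp
  proof (rule orbit_comp_disjoint[OF p' tab])
    have "a \<notin> orbit p' x" "b \<notin> orbit p' x"
      using that inj_onD[OF inj'] aA in_orbit_iff[OF p'] by (metis DiffD1 DiffD2 insertI1 insertI2)+
    then show "orbit p' x \<inter> {a, b} = {}" by simp
  qed
  show "orbit p x = orbit p\<^sub>1 x" if "x \<in> A\<^sub>1 - {a}" for x
    using other[of x] x1(1)[of x] that dis 2(2) by (auto simp: A_def)
  show "orbit p x = orbit p\<^sub>2 x" if "x \<in> A\<^sub>2 - {b}" for x
    using other[of x] x2(1)[of x] that dis 1(2) by (auto simp: A_def)
  show "inj_on (orbit p) (A - {a})"
  proof (rule inj_onI)
    fix x y assume xy: "x \<in> A - {a}" "y \<in> A - {a}" "orbit p x = orbit p y"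
    have in_b: "u = b" if "u \<in> A - {a}" "orbit p u = orbit p b" for u
    proof (rule ccontr)
      assume "u \<noteq> b"
      then have "orbit p' u = orbit p' a \<union> orbit p' b" using other[of u] that join by auto
      then have "b \<in> orbit p' u" using self by auto
      then have "orbit p' b = orbit p' u" by (simp add: in_orbit_iff[OF p'])
      then show False using inj_onD[OF inj'] that aA \<open>u \<noteq> b\<close> by (metis DiffD1)
    qed
    show "x = y"
    proof (cases "x = b \<or> y = b")
      case True then show ?thesis using in_b xy by metis
    next
      case False
      then have "orbit p' x = orbit p' y" using other xy by auto
      then show ?thesis using inj_onD[OF inj'] xy by blast
    qed
  qed
qed

text \<open>Both cycles of \<open>\<pi>\<close> meet the support, and the common orbit of
  \<open>a\<close> and \<open>b\<close> is the only one with two points of the support. The required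
  count is thus 2 + (\<open>card A\<close> - 1) = \<open>card A\<close> + 1.\<close>

lemma glue_in_steps:
  assumes \<pi>: "permutation \<pi>" "cyclic_on \<pi> C" "cyclic_on \<pi> D" and CD: "C \<inter> D = {}"
    and 1: "(a, A\<^sub>1, \<rho>\<^sub>1) \<in> rooted_arcs C \<pi>" and 2: "(b, A\<^sub>2, \<rho>\<^sub>2) \<in> rooted_arcs D \<pi>"
  shows "glue \<pi> ((a, A\<^sub>1, \<rho>\<^sub>1), (b, A\<^sub>2, \<rho>\<^sub>2)) \<in> steps \<pi> (C \<union> D)"
proof -
  define \<sigma> A p where "\<sigma> = \<rho>\<^sub>1 \<circ> \<rho>\<^sub>2 \<circ> tau a b" and "A = A\<^sub>1 \<union> A\<^sub>2" and "p = pinv \<sigma> \<circ> \<pi>"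
  note s = glue_setup[OF \<pi> CD 1 2, folded \<sigma>_def A_def, folded p_def]
  note f = is_cycle_facts[OF s(1), unfolded s(2)]
  have ab: "a \<in> A" "b \<in> A" "a \<noteq> b" using s(3-6) CD by auto
  have ACD: "A \<inter> C \<noteq> {}" "A \<inter> D \<noteq> {}" using s(3-6) by auto
  note cov = orbits_cover_two[OF \<pi> f(2,5,1) ACD, folded p_def]
  have "orbit p ` A = orbit p ` (A - {a})"
  proof -
    have "orbit p a = orbit p b" using s(9,10) by simp
    then have "orbit p a \<in> orbit p ` (A - {a})" using ab by auto
    moreover have "A = insert a (A - {a})" using ab by auto
    ultimately show ?thesis by (metis image_insert insert_absorb)
  qed
  then have cp: "card (orbit p ` A) + 1 = card A"
    using card_image[OF s(17)] card_Suc_Diff1[OF f(5) ab(1)] by simp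
  have "orbit \<pi> x \<in> {C, D}" if "x \<in> A" for x
    using that f(1) orbit_cyclic_eq3[OF \<pi>(2)] orbit_cyclic_eq3[OF \<pi>(3)] by auto
  moreover have "orbit \<pi> a = C" "orbit \<pi> b = D"
    using s(3-6) orbit_cyclic_eq3[OF \<pi>(2)] orbit_cyclic_eq3[OF \<pi>(3)] by auto
  ultimately have "orbit \<pi> ` A = {C, D}" using ab(1,2) by blast
  moreover have "C \<noteq> D" using CD ACD by auto
  ultimately have c2: "card (orbit \<pi> ` A) = 2" by simp
  have "X \<inter> A \<noteq> {}" "\<forall>x\<in>X. p x \<in> X" if "X \<in> orbit p ` A" for X
    using that permutation_self_in_orbit[OF s(8)] orbit.step[of _ p] by auto
  then have "(\<sigma>, orbit p ` A) \<in> steps \<pi> (C \<union> D)"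
    using s(1) partition_orbits[OF s(8) cov(1)] cp c2
    unfolding steps_def mem_Collect_eq prod.case s(2) p_def[symmetric] by (auto simp: p_def)
  then show ?thesis by (simp add: glue_def \<sigma>_def p_def A_def)
qed

text \<open>There is one orbit of \<open>p\<close> fewer than points in the support, so
  \<open>a\<close> and \<open>b\<close> are the only coincidence. Cutting their common orbit by the
  transposition makes \<open>\<sigma> \<circ> tau a b\<close> a first-return map.\<close>

lemma step_pair:
  assumes \<pi>: "permutation \<pi>" "cyclic_on \<pi> C" "cyclic_on \<pi> D" and CD: "C \<inter> D = {}"
    and \<sigma>: "is_cycle (C \<union> D) \<sigma>" and ACD: "moved \<sigma> \<inter> C \<noteq> {}" "moved \<sigma> \<inter> D \<noteq> {}"
    and c: "card (orbit (pinv \<sigma> \<circ> \<pi>) ` moved \<sigma>) + 1 = card (moved \<sigma>)"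
    and ab: "a \<in> moved \<sigma>" "b \<in> moved \<sigma>" "a \<noteq> b" "orbit (pinv \<sigma> \<circ> \<pi>) a = orbit (pinv \<sigma> \<circ> \<pi>) b"
  shows "inj_on (orbit (pinv (\<sigma> \<circ> tau a b) \<circ> \<pi>)) (moved \<sigma>)" "\<not> (a \<in> C \<and> b \<in> C)" "\<not> (a \<in> D \<and> b \<in> D)"
    "\<sigma> \<circ> tau a b permutes moved \<sigma>"
proof -
  define A p where "A = moved \<sigma>" and "p = pinv \<sigma> \<circ> \<pi>"
  note f = is_cycle_facts[OF \<sigma>, folded A_def]
  have p: "permutation p"
    unfolding p_def by (rule permutation_comp_permutes[OF \<pi>(1) permutes_inv[OF f(2)] f(5)])
  have ab: "a \<in> A" "b \<in> A" "a \<noteq> b" "orbit p a = orbit p b" and c: "card (orbit p ` A) + 1 = card A"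
    using ab c by (simp_all add: A_def p_def)
  define p' where "p' = tau a b \<circ> p"
  have tab: "tau a b permutes {a, b}" by (rule permutes_swap_id) auto
  have tA: "tau a b permutes A" by (rule permutes_swap_id[OF ab(1,2)])
  show \<rho>A: "\<sigma> \<circ> tau a b permutes moved \<sigma>"
    using permutes_compose[OF tA f(2)] by (simp add: A_def)
  have pp: "pinv (\<sigma> \<circ> tau a b) \<circ> \<pi> = p'"
    unfolding p'_def p_def pinv_comp[OF f(2) tA] by (simp add: comp_assoc)
  have p': "permutation p'" unfolding p'_def by (rule permutation_comp_permutes[OF p tab]) simp
  have "orbit p ` A = orbit p ` (A - {a})"
  proof -
    have "orbit p a \<in> orbit p ` (A - {a})" using ab by auto
    moreover have "A = insert a (A - {a})" using ab by auto
    ultimately show ?thesis by (metis image_insert insert_absorb)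
  qed
  then have "card (orbit p ` (A - {a})) = card (A - {a})"
    using c card_Suc_Diff1[OF f(5) ab(1)] by simp
  then have inj: "inj_on (orbit p) (A - {a})" using f(5) by (intro eq_card_imp_inj_on) auto
  have ne: "orbit p x \<noteq> orbit p a" if "x \<in> A - {a, b}" for x
    using inj_onD[OF inj, of x b] that ab by auto
  have other: "orbit p' x = orbit p x" if "x \<in> A - {a, b}" for x
    unfolding p'_def
  proof (rule orbit_comp_disjoint[OF p tab])
    have "a \<notin> orbit p x" "b \<notin> orbit p x" using ne[OF that] ab(4) in_orbit_iff[OF p] by metis+
    then show "orbit p x \<inter> {a, b} = {}" by simp
  qed
  have "b \<in> orbit p a" using ab(4) permutation_self_in_orbit[OF p] by auto
  note cut = orbit_transp_cut[OF p this ab(3), folded p'_def]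
  have sep: "orbit p' x \<noteq> orbit p' y" if "x \<in> A - {a, b}" "y \<in> {a, b}" for x y
  proof
    assume "orbit p' x = orbit p' y"
    then have "orbit p x \<subseteq> orbit p a" using other[OF that(1)] that(2) cut(2) by auto
    then have "x \<in> orbit p a" using permutation_self_in_orbit[OF p] by auto
    then show False using ne[OF that(1)] in_orbit_iff[OF p] by simp
  qed
  have sepab: "orbit p' a \<noteq> orbit p' b" using cut(1) permutation_self_in_orbit[OF p'] by auto
  have inj': "inj_on (orbit p') A"
  proof (rule inj_onI)
    fix x y assume xy: "x \<in> A" "y \<in> A" "orbit p' x = orbit p' y"
    show "x = y"
    proof (cases "x \<in> {a, b} \<or> y \<in> {a, b}")
      case True
      then have "x \<in> {a, b}" "y \<in> {a, b}" using sep xy by (metis Diff_iff)+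
      then show ?thesis using sepab xy(3) by auto
    next
      case False
      then have "orbit p x = orbit p y" using other xy by auto
      then show ?thesis using inj_onD[OF inj] xy False by blast
    qed
  qed
  then show inj'': "inj_on (orbit (pinv (\<sigma> \<circ> tau a b) \<circ> \<pi>)) (moved \<sigma>)" unfolding pp A_def .
  have tr: "orbit (\<sigma> \<circ> tau a b) x = A \<inter> orbit \<pi> x" if "x \<in> A" for x
    using orbit_first_return[OF \<pi>(1) \<rho>A _ inj''] that f(5) by (simp add: A_def)
  \<comment> \<open>If \<open>a\<close> and \<open>b\<close> lay in the same cycle of
    \<open>\<pi>\<close>, then \<open>\<sigma>\<close> would agree with the first-return map on the
    support points of the other cycle and preserve them as a set, although \<open>\<sigma>\<close>
    is a single cycle on the whole support.\<close>
  have noboth: "\<not> (a \<in> E \<and> b \<in> E)"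
    if E: "cyclic_on \<pi> E'" "E \<inter> E' = {}" "A \<inter> E' \<noteq> {}" for E E'
  proof
    assume abE: "a \<in> E \<and> b \<in> E"
    obtain d where d: "d \<in> A" "d \<in> E'" using E(3) by auto
    have "orbit \<sigma> d \<subseteq> A \<inter> E'"
    proof (rule orbit_subset_closed)
      fix x assume x: "x \<in> A \<inter> E'"
      then have "tau a b x = x" using abE E(2) by (auto simp: Transposition.transpose_def)
      then have "\<sigma> x = (\<sigma> \<circ> tau a b) x" by simp
      also have "\<dots> \<in> orbit (\<sigma> \<circ> tau a b) x" by (rule orbit.base)
      also have "\<dots> = A \<inter> E'" using tr[of x] x orbit_cyclic_eq3[OF E(1)] by auto
      finally show "\<sigma> x \<in> A \<inter> E'" .
    qed (use d in simp)
    moreover have "orbit \<sigma> d = A" using orbit_cyclic_eq3[OF f(3) d(1)] .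
    ultimately show False using ab(1) abE E(2) by auto
  qed
  show "\<not> (a \<in> C \<and> b \<in> C)" using noboth[OF \<pi>(3) CD] ACD(2) by (simp add: A_def)
  show "\<not> (a \<in> D \<and> b \<in> D)" using noboth[OF \<pi>(2), of D] CD ACD(1) by (simp add: A_def Int_commute)
qed

lemma restrict_cycle:
  assumes \<rho>: "\<rho> permutes A" and o: "\<And>x. x \<in> A\<^sub>1 \<Longrightarrow> orbit \<rho> x = A\<^sub>1" and ne: "A\<^sub>1 \<noteq> {}"
  shows "perm_restrict \<rho> A\<^sub>1 permutes A\<^sub>1" "cyclic_on (perm_restrict \<rho> A\<^sub>1) A\<^sub>1"
proof -
  have cyc: "cyclic_on \<rho> A\<^sub>1" using o ne by (auto simp: cyclic_on_alldef)
  then show "cyclic_on (perm_restrict \<rho> A\<^sub>1) A\<^sub>1" by (simp add: cyclic_on_perm_restrict)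
  have "bij_betw (perm_restrict \<rho> A\<^sub>1) A\<^sub>1 A\<^sub>1"
    unfolding bij_betw_def
  proof
    show i: "inj_on (perm_restrict \<rho> A\<^sub>1) A\<^sub>1"
      using permutes_inj[OF \<rho>] by (auto simp: inj_on_def perm_restrict_def)
    show "perm_restrict \<rho> A\<^sub>1 ` A\<^sub>1 = A\<^sub>1"
      by (rule endo_inj_surj[OF finite_cyclic_on[OF cyc] _ i])
        (use cyclic_on_inI[OF cyc] in \<open>auto simp: perm_restrict_def\<close>)
  qed
  then show "perm_restrict \<rho> A\<^sub>1 permutes A\<^sub>1"
    by (rule bij_imp_permutes) (simp add: perm_restrict_def)
qed

text \<open>When both cycles are met, the counts leave exactly one coincidence among the orbits of
  \<open>p\<close> through the support. Undoing it by a transposition gives a first-return map of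
  \<open>\<pi>\<close>, which splits into its restrictions to \<open>C\<close> and to
  \<open>D\<close>.\<close>

lemma steps_glue:
  assumes \<pi>: "permutation \<pi>" "cyclic_on \<pi> C" "cyclic_on \<pi> D" and CD: "C \<inter> D = {}"
    and st: "(\<sigma>, Q) \<in> steps \<pi> (C \<union> D)" and n: "\<not> moved \<sigma> \<subseteq> C" "\<not> moved \<sigma> \<subseteq> D"
  obtains a A\<^sub>1 \<rho>\<^sub>1 b A\<^sub>2 \<rho>\<^sub>2 where "(a, A\<^sub>1, \<rho>\<^sub>1) \<in> rooted_arcs C \<pi>" "(b, A\<^sub>2, \<rho>\<^sub>2) \<in> rooted_arcs D \<pi>"
    "(\<sigma>, Q) = glue \<pi> ((a, A\<^sub>1, \<rho>\<^sub>1), (b, A\<^sub>2, \<rho>\<^sub>2))"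
proof -
  define A p where "A = moved \<sigma>" and "p = pinv \<sigma> \<circ> \<pi>"
  have cyc: "is_cycle (C \<union> D) \<sigma>" using st by (auto simp: steps_def)
  note f = is_cycle_facts[OF cyc, folded A_def]
  have p: "permutation p"
    unfolding p_def by (rule permutation_comp_permutes[OF \<pi>(1) permutes_inv[OF f(2)] f(5)])
  have Q: "partition_on (C \<union> D) Q" and cl: "\<And>X x. X \<in> Q \<Longrightarrow> x \<in> X \<Longrightarrow> p x \<in> X"
    and meet: "\<And>X. X \<in> Q \<Longrightarrow> X \<inter> A \<noteq> {}"
    and c: "card Q = card (orbit p ` A)" "card (orbit \<pi> ` A) + card Q = card A + 1"
    using st by (auto simp: steps_def A_def p_def)
  have ACD: "A \<inter> C \<noteq> {}" "A \<inter> D \<noteq> {}" using n f(1) by (auto simp: A_def)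
  note cov = orbits_cover_two[OF \<pi> f(2,5,1) ACD, folded p_def]
  have Qo: "Q = orbit p ` A" by (rule invariant_partition_eq_orbits[OF p Q f(5) cl meet cov(1) c(1)])
  have "orbit \<pi> x \<in> {C, D}" if "x \<in> A" for x
    using that f(1) orbit_cyclic_eq3[OF \<pi>(2)] orbit_cyclic_eq3[OF \<pi>(3)] by auto
  moreover have "C \<in> orbit \<pi> ` A" "D \<in> orbit \<pi> ` A"
    using ACD orbit_cyclic_eq3[OF \<pi>(2)] orbit_cyclic_eq3[OF \<pi>(3)] by blast+
  ultimately have "orbit \<pi> ` A = {C, D}" by blast
  moreover have "C \<noteq> D" using CD ACD by auto
  ultimately have cp: "card (orbit p ` A) + 1 = card A" using c by simp
  have "\<not> inj_on (orbit p) A" using card_image[of "orbit p" A] cp by auto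
  then obtain a0 b0 where ab0: "a0 \<in> A" "b0 \<in> A" "a0 \<noteq> b0" "orbit p a0 = orbit p b0"
    by (auto simp: inj_on_def)
  note sp0 = step_pair[OF \<pi> CD cyc ACD[unfolded A_def] cp[unfolded A_def p_def] ab0[unfolded A_def p_def]]
  obtain a b where ab: "a \<in> A" "b \<in> A" "a \<noteq> b" "orbit p a = orbit p b" and aC: "a \<in> C" and bD: "b \<in> D"
    using ab0 sp0(2,3) f(1) by (metis (no_types, lifting) UnE subsetD)
  note sp = step_pair[OF \<pi> CD cyc ACD[unfolded A_def] cp[unfolded A_def p_def] ab[unfolded A_def p_def],
      folded A_def]
  define \<rho> where "\<rho> = \<sigma> \<circ> tau a b"
  define A\<^sub>1 A\<^sub>2 where "A\<^sub>1 = A \<inter> C" and "A\<^sub>2 = A \<inter> D"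
  define \<rho>\<^sub>1 \<rho>\<^sub>2 where "\<rho>\<^sub>1 = perm_restrict \<rho> A\<^sub>1" and "\<rho>\<^sub>2 = perm_restrict \<rho> A\<^sub>2"
  note inj = sp(1)[folded \<rho>_def] and \<rho> = sp(4)[folded \<rho>_def]
  have A12: "A\<^sub>1 \<union> A\<^sub>2 = A" "A\<^sub>1 \<inter> A\<^sub>2 = {}" using f(1) CD by (auto simp: A\<^sub>1_def A\<^sub>2_def)
  have tr: "orbit \<rho> x = A \<inter> orbit \<pi> x" if "x \<in> A" for x
    by (rule orbit_first_return[OF \<pi>(1) \<rho> f(5) inj that])
  have o1: "orbit \<rho> x = A\<^sub>1" if "x \<in> A\<^sub>1" for x
    using tr[of x] that orbit_cyclic_eq3[OF \<pi>(2)] by (auto simp: A\<^sub>1_def)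
  have o2: "orbit \<rho> x = A\<^sub>2" if "x \<in> A\<^sub>2" for x
    using tr[of x] that orbit_cyclic_eq3[OF \<pi>(3)] by (auto simp: A\<^sub>2_def)
  have ne: "A\<^sub>1 \<noteq> {}" "A\<^sub>2 \<noteq> {}" using ACD by (auto simp: A\<^sub>1_def A\<^sub>2_def)
  note r1 = restrict_cycle[OF \<rho> o1 ne(1), folded \<rho>\<^sub>1_def]
  note r2 = restrict_cycle[OF \<rho> o2 ne(2), folded \<rho>\<^sub>2_def]
  have comp: "\<rho>\<^sub>1 \<circ> \<rho>\<^sub>2 = \<rho>"
  proof
    fix x
    have "\<rho> x \<in> A\<^sub>2" if "x \<in> A\<^sub>2" using o2[OF that] orbit.base[of \<rho> x] by simp
    then show "(\<rho>\<^sub>1 \<circ> \<rho>\<^sub>2) x = \<rho> x"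
      using A12 permutes_not_in[OF \<rho>, of x] unfolding \<rho>\<^sub>1_def \<rho>\<^sub>2_def perm_restrict_def by auto
  qed
  have sub: "A\<^sub>1 \<subseteq> C" "A\<^sub>2 \<subseteq> D" by (auto simp: A\<^sub>1_def A\<^sub>2_def)
  note os = orbits_split[OF \<pi>(2,3,1) CD r1(1) sub(1) r2(1) sub(2), unfolded comp]
  have "inj_on (orbit (pinv \<rho>\<^sub>1 \<circ> \<pi>)) A\<^sub>1"
    using inj os(1) sub(1) A12(1) unfolding inj_on_def by (metis UnI1 subsetD)
  then have 1: "(a, A\<^sub>1, \<rho>\<^sub>1) \<in> rooted_arcs C \<pi>"
    using r1 sub ab aC by (simp add: rooted_arcs_def arcs_def A\<^sub>1_def)
  have "inj_on (orbit (pinv \<rho>\<^sub>2 \<circ> \<pi>)) A\<^sub>2"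
    using inj os(2) sub(2) A12(1) unfolding inj_on_def by (metis UnI2 subsetD)
  then have 2: "(b, A\<^sub>2, \<rho>\<^sub>2) \<in> rooted_arcs D \<pi>"
    using r2 sub ab bD by (simp add: rooted_arcs_def arcs_def A\<^sub>2_def)
  have "\<rho>\<^sub>1 \<circ> \<rho>\<^sub>2 \<circ> tau a b = \<sigma>" unfolding comp \<rho>_def by (simp add: comp_assoc)
  then have "(\<sigma>, Q) = glue \<pi> ((a, A\<^sub>1, \<rho>\<^sub>1), (b, A\<^sub>2, \<rho>\<^sub>2))"
    unfolding glue_def prod.case A12(1) Qo p_def by simp
  with 1 2 show ?thesis by (rule that)
qed

text \<open>The roots are recovered from \<open>\<sigma>\<close> as the only two moved points in a
  common orbit of \<open>p\<close>, told apart by the cycle in which they lie. Undoing the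
  transposition leaves a product of maps with disjoint supports, which determines both of
  them.\<close>

lemma inj_on_glue:
  assumes \<pi>: "permutation \<pi>" "cyclic_on \<pi> C" "cyclic_on \<pi> D" and CD: "C \<inter> D = {}"
  shows "inj_on (glue \<pi>) (rooted_arcs C \<pi> \<times> rooted_arcs D \<pi>)"
proof (rule inj_onI)
  fix s t assume s: "s \<in> rooted_arcs C \<pi> \<times> rooted_arcs D \<pi>" and t: "t \<in> rooted_arcs C \<pi> \<times> rooted_arcs D \<pi>"
    and eq: "glue \<pi> s = glue \<pi> t"
  obtain a A\<^sub>1 \<rho>\<^sub>1 b A\<^sub>2 \<rho>\<^sub>2 where [simp]: "s = ((a, A\<^sub>1, \<rho>\<^sub>1), (b, A\<^sub>2, \<rho>\<^sub>2))" by (metis surj_pair)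
  obtain a' B\<^sub>1 \<tau>\<^sub>1 b' B\<^sub>2 \<tau>\<^sub>2 where [simp]: "t = ((a', B\<^sub>1, \<tau>\<^sub>1), (b', B\<^sub>2, \<tau>\<^sub>2))" by (metis surj_pair)
  have 1: "(a, A\<^sub>1, \<rho>\<^sub>1) \<in> rooted_arcs C \<pi>" "(b, A\<^sub>2, \<rho>\<^sub>2) \<in> rooted_arcs D \<pi>" using s by auto
  have 2: "(a', B\<^sub>1, \<tau>\<^sub>1) \<in> rooted_arcs C \<pi>" "(b', B\<^sub>2, \<tau>\<^sub>2) \<in> rooted_arcs D \<pi>" using t by auto
  define \<sigma> where "\<sigma> = \<rho>\<^sub>1 \<circ> \<rho>\<^sub>2 \<circ> tau a b"
  have \<sigma>': "\<sigma> = \<tau>\<^sub>1 \<circ> \<tau>\<^sub>2 \<circ> tau a' b'" using eq by (simp add: glue_def \<sigma>_def)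
  note s1 = glue_setup[OF \<pi> CD 1, folded \<sigma>_def] and s2 = glue_setup[OF \<pi> CD 2, folded \<sigma>']
  define p where "p = pinv \<sigma> \<circ> \<pi>"
  have A: "A\<^sub>1 = moved \<sigma> \<inter> C" "A\<^sub>2 = moved \<sigma> \<inter> D" using s1(2,3,4) by simp_all
  have B: "B\<^sub>1 = moved \<sigma> \<inter> C" "B\<^sub>2 = moved \<sigma> \<inter> D" using s2(2,3,4) by simp_all
  have o1: "orbit p a = orbit p b" using s1(9,10) unfolding p_def by simp
  have o2: "orbit p a' = orbit p b'" using s2(9,10) unfolding p_def by simp
  have mem: "a \<in> A\<^sub>1" "b \<in> A\<^sub>2" "a' \<in> A\<^sub>1" "b' \<in> A\<^sub>2" using s1(5,6) s2(5,6) A B by simp_all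
  have i: "inj_on (orbit p) (moved \<sigma> - {a})" using s1(17) s1(2) unfolding p_def by simp
  have i': "inj_on (orbit p) (moved \<sigma> - {a'})" using s2(17) s2(2) unfolding p_def by simp
  have aa: "a' = a"
  proof (rule ccontr)
    assume "a' \<noteq> a"
    then have "a' = b'" using inj_onD[OF i o2] mem A CD by auto
    then show False using mem A CD by auto
  qed
  have "b = b'"
    by (rule inj_onD[OF i]) (use o1 o2 aa mem A CD in auto)
  then have "\<rho>\<^sub>1 \<circ> \<rho>\<^sub>2 = \<tau>\<^sub>1 \<circ> \<tau>\<^sub>2"
  proof -
    have "\<rho>\<^sub>1 \<circ> \<rho>\<^sub>2 = \<sigma> \<circ> tau a b" unfolding \<sigma>_def by (simp add: comp_assoc)
    also have "\<dots> = \<tau>\<^sub>1 \<circ> \<tau>\<^sub>2" unfolding \<sigma>' aa \<open>b = b'\<close> by (simp add: comp_assoc)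
    finally show ?thesis .
  qed
  then have eqf: "\<rho>\<^sub>1 (\<rho>\<^sub>2 x) = \<tau>\<^sub>1 (\<tau>\<^sub>2 x)" for x by (metis o_apply)
  have perm: "\<rho>\<^sub>1 permutes A\<^sub>1" "\<rho>\<^sub>2 permutes A\<^sub>2" "\<tau>\<^sub>1 permutes A\<^sub>1" "\<tau>\<^sub>2 permutes A\<^sub>2"
    using 1 2 A B by (auto simp: rooted_arcs_def arcs_def)
  have dis: "x \<notin> A\<^sub>1 \<or> x \<notin> A\<^sub>2" for x using A CD by auto
  have "\<rho>\<^sub>1 = \<tau>\<^sub>1"
  proof
    fix x show "\<rho>\<^sub>1 x = \<tau>\<^sub>1 x"
      using eqf[of x] dis[of x] permutes_not_in[OF perm(1), of x] permutes_not_in[OF perm(2), of x]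
        permutes_not_in[OF perm(3), of x] permutes_not_in[OF perm(4), of x] by (cases "x \<in> A\<^sub>1") auto
  qed
  moreover have "\<rho>\<^sub>2 = \<tau>\<^sub>2"
  proof
    fix x show "\<rho>\<^sub>2 x = \<tau>\<^sub>2 x"
      using eqf[of x] \<open>\<rho>\<^sub>1 = \<tau>\<^sub>1\<close> permutes_inj[OF perm(1)] by (simp add: inj_eq)
  qed
  ultimately show "s = t" using aa \<open>b = b'\<close> A B by simp
qed

section \<open>Summation over all steps and the differential system for block weights\<close>

section \<open>The differential equations\<close>

lemma finite_arcs: "finite C \<Longrightarrow> finite (arcs C \<pi> a k)"
  by (rule finite_subset[of _ "Pow C \<times> {\<rho>. \<rho> permutes C}"])
    (auto simp: arcs_def finite_permutations intro: permutes_subset)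

text \<open>In contrast to \<open>rooted_sum\<close> the lengths start at 1, since one point of a
  cycle may be all that the factor moves there.\<close>

lemma rooted_arcs_sum:
  fixes \<Phi> W :: "'c::comm_ring_1 fps"
  assumes \<pi>: "permutation \<pi>" "cyclic_on \<pi> C" and z: "\<Phi> $ 0 = 0" "W $ 0 = 0"
  shows "(\<Sum>(a, A, \<rho>)\<in>rooted_arcs C \<pi>. q (card A) * (\<Phi> $ card (orbit (pinv \<rho> \<circ> \<pi>) a) *
      (\<Prod>x\<in>A - {a}. W $ card (orbit (pinv \<rho> \<circ> \<pi>) x))))
    = of_nat (card C) * (\<Sum>k=1..card C. q k * (\<Phi> * W ^ (k - 1)) $ card C)"
proof -
  have finC: "finite C" using \<pi>(2) by (rule finite_cyclic_on)
  define G where "G = (\<lambda>a A \<rho>. \<Phi> $ card (orbit (pinv \<rho> \<circ> \<pi>) a) *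
      (\<Prod>x\<in>A - {a}. W $ card (orbit (pinv \<rho> \<circ> \<pi>) x)))"
  have rng: "card A \<in> {1..card C}" if "A \<subseteq> C" "a \<in> A" for a A
    using that finC card_mono[of C A] finite_subset[of A C] by (auto simp: Suc_le_eq card_gt_0_iff)
  have key: "(\<Sum>(A, \<rho>)\<in>arcs C \<pi> a k. q k * G a A \<rho>) = q k * (\<Phi> * W ^ (k - 1)) $ card C"
    if "a \<in> C" "1 \<le> k" for a k
  proof -
    have "(\<Sum>(A, \<rho>)\<in>arcs C \<pi> a k. G a A \<rho>) = (\<Phi> * W ^ (k - 1)) $ card C"
      using sum_arcs[OF \<pi> that(1) z, of "k - 1"] that(2) unfolding G_def by simp
    then have "q k * (\<Sum>(A, \<rho>)\<in>arcs C \<pi> a k. G a A \<rho>) = q k * (\<Phi> * W ^ (k - 1)) $ card C" by simp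
    then show ?thesis by (simp add: sum_distrib_left split_def)
  qed
  have "(\<Sum>(a, A, \<rho>)\<in>rooted_arcs C \<pi>. q (card A) * G a A \<rho>)
    = (\<Sum>(a, k, A, \<rho>)\<in>(SIGMA a:C. SIGMA k:{1..card C}. arcs C \<pi> a k). q k * G a A \<rho>)"
    by (rule sum.reindex_bij_witness[where i = "\<lambda>(a, k, A, \<rho>). (a, A, \<rho>)" and j = "\<lambda>(a, A, \<rho>). (a, card A, A, \<rho>)"])
      (use rng in \<open>auto simp: rooted_arcs_def arcs_def\<close>)
  also have "\<dots> = (\<Sum>a\<in>C. \<Sum>(k, A, \<rho>)\<in>(SIGMA k:{1..card C}. arcs C \<pi> a k). q k * G a A \<rho>)"
    by (rule sum.Sigma[symmetric]) (use finC in \<open>auto intro: finite_arcs\<close>)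
  also have "\<dots> = (\<Sum>a\<in>C. \<Sum>k=1..card C. \<Sum>(A, \<rho>)\<in>arcs C \<pi> a k. q k * G a A \<rho>)"
    by (intro sum.cong refl sum.Sigma[symmetric]) (use finC in \<open>auto intro: finite_arcs\<close>)
  also have "\<dots> = (\<Sum>a\<in>C. \<Sum>k=1..card C. q k * (\<Phi> * W ^ (k - 1)) $ card C)"
    by (intro sum.cong refl key) auto
  also have "\<dots> = of_nat (card C) * (\<Sum>k=1..card C. q k * (\<Phi> * W ^ (k - 1)) $ card C)" by simp
  finally show ?thesis unfolding G_def .
qed

text \<open>For fixed roots, the weight of \<open>i\<close> arcs on a cycle of length
  \<open>a\<close> and \<open>j\<close> arcs on a cycle of length \<open>b\<close> whose rooted
  arcs, of lengths \<open>g\<close> and \<open>g'\<close>, are joined into one cycle of length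
  \<open>g + g'\<close>. The weight of the joined arc is not a product in \<open>g\<close> and
  \<open>g'\<close>, which forces the nested series.\<close>

definition glued_coeff :: "'c::comm_ring_1 fps \<Rightarrow> nat \<Rightarrow> nat \<Rightarrow> nat \<Rightarrow> nat \<Rightarrow> 'c" where
  "glued_coeff W a b i j = (Abs_fps (\<lambda>g'. if g' = 0 then 0
     else (Abs_fps (\<lambda>g. if g = 0 then 0 else W $ (g + g')) * W ^ (i - 1)) $ a) * W ^ (j - 1)) $ b"

lemma glue_weight:
  fixes W :: "'c::comm_ring_1 fps"
  assumes \<pi>: "permutation \<pi>" "cyclic_on \<pi> C" "cyclic_on \<pi> D" and CD: "C \<inter> D = {}"
    and 1: "(a, A\<^sub>1, \<rho>\<^sub>1) \<in> rooted_arcs C \<pi>" and 2: "(b, A\<^sub>2, \<rho>\<^sub>2) \<in> rooted_arcs D \<pi>"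
  shows "(case glue \<pi> ((a, A\<^sub>1, \<rho>\<^sub>1), (b, A\<^sub>2, \<rho>\<^sub>2)) of (\<sigma>, Q) \<Rightarrow>
      q (card (moved \<sigma>)) * (\<Prod>X\<in>Q. block_weight W h (pinv \<sigma> \<circ> \<pi>) X))
    = q (card A\<^sub>1 + card A\<^sub>2) *
      (W $ (card (orbit (pinv \<rho>\<^sub>1 \<circ> \<pi>) a) + card (orbit (pinv \<rho>\<^sub>2 \<circ> \<pi>) b)) *
       (\<Prod>x\<in>A\<^sub>1 - {a}. W $ card (orbit (pinv \<rho>\<^sub>1 \<circ> \<pi>) x)) *
       (\<Prod>x\<in>A\<^sub>2 - {b}. W $ card (orbit (pinv \<rho>\<^sub>2 \<circ> \<pi>) x)))"
proof -
  define \<sigma> A where "\<sigma> = \<rho>\<^sub>1 \<circ> \<rho>\<^sub>2 \<circ> tau a b" and "A = A\<^sub>1 \<union> A\<^sub>2"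
  define p p\<^sub>1 p\<^sub>2 where "p = pinv \<sigma> \<circ> \<pi>" and "p\<^sub>1 = pinv \<rho>\<^sub>1 \<circ> \<pi>" and "p\<^sub>2 = pinv \<rho>\<^sub>2 \<circ> \<pi>"
  note s = glue_setup[OF \<pi> CD 1 2, folded \<sigma>_def A_def, folded p_def p\<^sub>1_def p\<^sub>2_def]
  have fin: "finite A" using is_cycle_facts(5)[OF s(1)] s(2) by simp
  then have fin12: "finite A\<^sub>1" "finite A\<^sub>2" by (simp_all add: A_def)
  have ab: "a \<in> A" "b \<in> A" "a \<noteq> b" using s(3-6) CD by auto
  have nab: "a \<notin> A\<^sub>2" "b \<notin> A\<^sub>1" using s(3-6) CD by auto
  have "orbit p ` A = orbit p ` (A - {a})"
  proof -
    have "orbit p a = orbit p b" using s(9,10) by simp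
    then have "orbit p a \<in> orbit p ` (A - {a})" using ab by auto
    moreover have "A = insert a (A - {a})" using ab by auto
    ultimately show ?thesis by (metis image_insert insert_absorb)
  qed
  \<comment> \<open>\<open>a\<close> and \<open>b\<close> lie in the same orbit, so with
    \<open>a\<close> dropped the remaining points index the parts without repetition.\<close>
  then have "(\<Prod>X\<in>orbit p ` A. block_weight W h p X) = (\<Prod>x\<in>A - {a}. W $ card (orbit p x))"
    using prod.reindex[OF s(17), of "block_weight W h p"] by (simp add: block_weight_orbit[OF s(8)])
  also have "A - {a} = insert b ((A\<^sub>1 - {a}) \<union> (A\<^sub>2 - {b}))"
    using s(5,6) nab by (auto simp: A_def)
  also have "(\<Prod>x\<in>insert b ((A\<^sub>1 - {a}) \<union> (A\<^sub>2 - {b})). W $ card (orbit p x)) =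
      W $ card (orbit p b) * ((\<Prod>x\<in>A\<^sub>1 - {a}. W $ card (orbit p x)) * (\<Prod>x\<in>A\<^sub>2 - {b}. W $ card (orbit p x)))"
  proof (subst prod.insert)
    show "b \<notin> A\<^sub>1 - {a} \<union> (A\<^sub>2 - {b})" using s(3-6) CD by auto
    show "W $ card (orbit p b) * prod (\<lambda>x. W $ card (orbit p x)) (A\<^sub>1 - {a} \<union> (A\<^sub>2 - {b})) =
      W $ card (orbit p b) * ((\<Prod>x\<in>A\<^sub>1 - {a}. W $ card (orbit p x)) * (\<Prod>x\<in>A\<^sub>2 - {b}. W $ card (orbit p x)))"
      by (subst prod.union_disjoint) (use fin12 s(3,4) CD in auto)
  qed (use fin12 in simp)
  also have "card (orbit p b) = card (orbit p\<^sub>1 a) + card (orbit p\<^sub>2 b)"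
  proof -
    have "orbit p\<^sub>1 a \<inter> orbit p\<^sub>2 b = {}" using s(13)[OF s(5)] s(14)[OF s(6)] CD by auto
    moreover have "finite (orbit p\<^sub>1 a)" "finite (orbit p\<^sub>2 b)"
      using finite_orbit permutation_self_in_orbit s(15,16) by metis+
    ultimately show ?thesis unfolding s(10) by (intro card_Un_disjoint)
  qed
  also have "(\<Prod>x\<in>A\<^sub>1 - {a}. W $ card (orbit p x)) = (\<Prod>x\<in>A\<^sub>1 - {a}. W $ card (orbit p\<^sub>1 x))"
    by (intro prod.cong refl) (simp only: s(11))
  also have "(\<Prod>x\<in>A\<^sub>2 - {b}. W $ card (orbit p x)) = (\<Prod>x\<in>A\<^sub>2 - {b}. W $ card (orbit p\<^sub>2 x))"
    by (intro prod.cong refl) (simp only: s(12))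
  finally have e: "(\<Prod>X\<in>orbit p ` A. block_weight W h p X) = W $ (card (orbit p\<^sub>1 a) + card (orbit p\<^sub>2 b)) *
    ((\<Prod>x\<in>A\<^sub>1 - {a}. W $ card (orbit p\<^sub>1 x)) * (\<Prod>x\<in>A\<^sub>2 - {b}. W $ card (orbit p\<^sub>2 x)))" .
  have g: "glue \<pi> ((a, A\<^sub>1, \<rho>\<^sub>1), (b, A\<^sub>2, \<rho>\<^sub>2)) = (\<sigma>, orbit p ` A)"
    unfolding glue_def prod.case \<sigma>_def p_def A_def ..
  show ?thesis
    unfolding g prod.case p_def[symmetric] p\<^sub>1_def[symmetric] p\<^sub>2_def[symmetric] e s(2) s(7)
    by (simp only: mult.assoc)
qed

text \<open>With the rooted arcs on \<open>D\<close> fixed, the joined weight depends on those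
  choices only through \<open>g t\<close>. The inner sum is therefore a rooted sum for the series
  \<open>\<Phi> (g t)\<close>, and its value as a function of \<open>g t\<close> is the series
  \<open>\<Psi> i\<close> used in the outer rooted sum.\<close>

lemma glue_sum:
  fixes W :: "'c::comm_ring_1 fps"
  assumes \<pi>: "permutation \<pi>" "cyclic_on \<pi> C" "cyclic_on \<pi> D" and CD: "C \<inter> D = {}"
    and W0: "W $ 0 = 0"
  shows "(\<Sum>(\<sigma>, Q) | (\<sigma>, Q) \<in> steps \<pi> (C \<union> D) \<and> \<not> moved \<sigma> \<subseteq> C \<and> \<not> moved \<sigma> \<subseteq> D.
      q (card (moved \<sigma>)) * (\<Prod>X\<in>Q. block_weight W h (pinv \<sigma> \<circ> \<pi>) X))
    = of_nat (card C) * of_nat (card D) *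
      (\<Sum>i=1..card C. \<Sum>j=1..card D. q (i + j) * glued_coeff W (card C) (card D) i j)"
proof -
  let ?RC = "rooted_arcs C \<pi>" and ?RD = "rooted_arcs D \<pi>"
  define g where "g = (\<lambda>(a, A :: 'a set, \<rho>). card (orbit (pinv \<rho> \<circ> \<pi>) a))"
  define P where "P = (\<lambda>(a, A, \<rho>). \<Prod>x\<in>A - {a}. W $ card (orbit (pinv \<rho> \<circ> \<pi>) x))"
  define n where "n = (\<lambda>(a :: 'a, A :: 'a set, \<rho> :: 'a \<Rightarrow> 'a). card A)"
  define \<Phi> where "\<Phi> = (\<lambda>g'. Abs_fps (\<lambda>g. if g = 0 then 0 else W $ (g + g')))"
  define \<Psi> where "\<Psi> = (\<lambda>i. Abs_fps (\<lambda>g'. if g' = 0 then 0 else (\<Phi> g' * W ^ (i - 1)) $ card C))"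
  have pos: "0 < g s" if "s \<in> rooted_arcs E \<pi>" for s E
  proof -
    obtain a A \<rho> where [simp]: "s = (a, A, \<rho>)" by (metis surj_pair)
    have "\<rho> permutes A" "finite A" using that finite_cyclic_on by (auto simp: rooted_arcs_def arcs_def)
    then have "permutation (pinv \<rho> \<circ> \<pi>)"
      using permutation_comp_permutes[OF \<pi>(1) permutes_inv] by metis
    from card_orbit(2)[OF this] show ?thesis by (simp add: g_def)
  qed
  have rs: "(\<Sum>s\<in>rooted_arcs E \<pi>. r (n s) * (F $ g s * P s)) = of_nat (card E) * (\<Sum>k=1..card E. r k * (F * W ^ (k - 1)) $ card E)"
    if "cyclic_on \<pi> E" "F $ 0 = 0" for E r F
    using rooted_arcs_sum[OF \<pi>(1) that W0, of r] unfolding g_def P_def n_def by (simp only: split_def)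
  have im: "{(\<sigma>, Q). (\<sigma>, Q) \<in> steps \<pi> (C \<union> D) \<and> \<not> moved \<sigma> \<subseteq> C \<and> \<not> moved \<sigma> \<subseteq> D} = glue \<pi> ` (?RC \<times> ?RD)"
  proof (intro equalityI subsetI)
    fix s assume "s \<in> {(\<sigma>, Q). (\<sigma>, Q) \<in> steps \<pi> (C \<union> D) \<and> \<not> moved \<sigma> \<subseteq> C \<and> \<not> moved \<sigma> \<subseteq> D}"
    then obtain \<sigma> Q where s: "s = (\<sigma>, Q)" "(\<sigma>, Q) \<in> steps \<pi> (C \<union> D)" "\<not> moved \<sigma> \<subseteq> C" "\<not> moved \<sigma> \<subseteq> D" by auto
    show "s \<in> glue \<pi> ` (?RC \<times> ?RD)"
      by (rule steps_glue[OF \<pi> CD s(2-4)]) (use s(1) in blast)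
  next
    fix s assume "s \<in> glue \<pi> ` (?RC \<times> ?RD)"
    then obtain a A\<^sub>1 \<rho>\<^sub>1 b A\<^sub>2 \<rho>\<^sub>2 where s: "s = glue \<pi> ((a, A\<^sub>1, \<rho>\<^sub>1), (b, A\<^sub>2, \<rho>\<^sub>2))"
      and 1: "(a, A\<^sub>1, \<rho>\<^sub>1) \<in> ?RC" and 2: "(b, A\<^sub>2, \<rho>\<^sub>2) \<in> ?RD" by auto
    note gs = glue_setup[OF \<pi> CD 1 2]
    have "a \<notin> D" "b \<notin> C" "a \<in> moved (\<rho>\<^sub>1 \<circ> \<rho>\<^sub>2 \<circ> tau a b)" "b \<in> moved (\<rho>\<^sub>1 \<circ> \<rho>\<^sub>2 \<circ> tau a b)"
      using gs(2-6) CD by auto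
    then have "\<not> moved (fst s) \<subseteq> C" "\<not> moved (fst s) \<subseteq> D" unfolding s glue_def by auto
    moreover have "s \<in> steps \<pi> (C \<union> D)" unfolding s by (rule glue_in_steps[OF \<pi> CD 1 2])
    ultimately show "s \<in> {(\<sigma>, Q). (\<sigma>, Q) \<in> steps \<pi> (C \<union> D) \<and> \<not> moved \<sigma> \<subseteq> C \<and> \<not> moved \<sigma> \<subseteq> D}"
      by (simp add: split_def)
  qed
  have "(\<Sum>(\<sigma>, Q) | (\<sigma>, Q) \<in> steps \<pi> (C \<union> D) \<and> \<not> moved \<sigma> \<subseteq> C \<and> \<not> moved \<sigma> \<subseteq> D.
      q (card (moved \<sigma>)) * (\<Prod>X\<in>Q. block_weight W h (pinv \<sigma> \<circ> \<pi>) X))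
    = (\<Sum>(s, t)\<in>?RC \<times> ?RD. q (n s + n t) * (W $ (g s + g t) * P s * P t))"
    unfolding im
  proof (subst sum.reindex[OF inj_on_glue[OF \<pi> CD]], rule sum.cong[OF refl])
    fix st assume "st \<in> ?RC \<times> ?RD"
    then obtain a A\<^sub>1 \<rho>\<^sub>1 b A\<^sub>2 \<rho>\<^sub>2 where st: "st = ((a, A\<^sub>1, \<rho>\<^sub>1), (b, A\<^sub>2, \<rho>\<^sub>2))"
      and 1: "(a, A\<^sub>1, \<rho>\<^sub>1) \<in> ?RC" and 2: "(b, A\<^sub>2, \<rho>\<^sub>2) \<in> ?RD" by auto
    show "((\<lambda>(\<sigma>, Q). q (card (moved \<sigma>)) * (\<Prod>X\<in>Q. block_weight W h (pinv \<sigma> \<circ> \<pi>) X)) \<circ> glue \<pi>) st =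
      (case st of (s, t) \<Rightarrow> q (n s + n t) * (W $ (g s + g t) * P s * P t))"
      unfolding comp_def[of _ "glue \<pi>"] st glue_weight[OF \<pi> CD 1 2]
      by (simp only: prod.case n_def g_def P_def)
  qed
  also have "\<dots> = (\<Sum>s\<in>?RC. \<Sum>t\<in>?RD. q (n s + n t) * (W $ (g s + g t) * P s * P t))"
    by (rule sum.cartesian_product[symmetric])
  also have "\<dots> = (\<Sum>t\<in>?RD. \<Sum>s\<in>?RC. q (n s + n t) * (W $ (g s + g t) * P s * P t))"
    by (rule sum.swap)
  also have "\<dots> = (\<Sum>t\<in>?RD. \<Sum>i=1..card C. of_nat (card C) * (q (i + n t) * (\<Psi> i $ g t * P t)))"
  proof (rule sum.cong[OF refl])
    fix t assume t: "t \<in> ?RD"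
    have "(\<Sum>s\<in>?RC. q (n s + n t) * (W $ (g s + g t) * P s * P t))
      = P t * (\<Sum>s\<in>?RC. q (n s + n t) * (\<Phi> (g t) $ g s * P s))"
      unfolding sum_distrib_left
    proof (rule sum.cong[OF refl])
      fix s assume "s \<in> ?RC"
      then have "0 < g s" by (rule pos)
      then show "q (n s + n t) * (W $ (g s + g t) * P s * P t) = P t * (q (n s + n t) * (\<Phi> (g t) $ g s * P s))"
        by (simp add: \<Phi>_def mult_ac)
    qed
    also have "\<dots> = P t * (of_nat (card C) * (\<Sum>k=1..card C. q (k + n t) * (\<Phi> (g t) * W ^ (k - 1)) $ card C))"
      by (subst rs[OF \<pi>(2), of "\<Phi> (g t)" "\<lambda>k. q (k + n t)"]) (simp_all add: \<Phi>_def)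
    also have "\<dots> = (\<Sum>i=1..card C. of_nat (card C) * (q (i + n t) * (\<Psi> i $ g t * P t)))"
      unfolding sum_distrib_left by (rule sum.cong) (use pos[OF t] in \<open>auto simp: \<Psi>_def mult_ac\<close>)
    finally show "(\<Sum>s\<in>?RC. q (n s + n t) * (W $ (g s + g t) * P s * P t)) = \<dots>" .
  qed
  also have "\<dots> = (\<Sum>i=1..card C. of_nat (card C) * (\<Sum>t\<in>?RD. q (i + n t) * (\<Psi> i $ g t * P t)))"
    by (subst sum.swap) (simp only: sum_distrib_left)
  also have "\<dots> = (\<Sum>i=1..card C. of_nat (card C) * (of_nat (card D) * (\<Sum>j=1..card D. q (i + j) * (\<Psi> i * W ^ (j - 1)) $ card D)))"
    by (intro sum.cong refl arg_cong2[where f = times] rs[OF \<pi>(3)]) (simp add: \<Psi>_def)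
  also have "\<dots> = of_nat (card C) * of_nat (card D) *
      (\<Sum>i=1..card C. \<Sum>j=1..card D. q (i + j) * glued_coeff W (card C) (card D) i j)"
    unfolding glued_coeff_def \<Psi>_def \<Phi>_def by (simp only: sum_distrib_left mult.assoc)
  finally show ?thesis .
qed

lemma adm_cases:
  assumes "adm \<pi> B"
  obtains "cyclic_on \<pi> B" | C D where "orbit \<pi> ` B = {C, D}" "C \<inter> D = {}" "C \<union> D = B"
    "cyclic_on \<pi> C" "cyclic_on \<pi> D"
proof -
  have \<pi>: "permutation \<pi>" "\<And>x. x \<in> B \<Longrightarrow> \<pi> x \<in> B" and B: "finite B" "B \<noteq> {}" and c: "card (orbit \<pi> ` B) \<le> 2"
    using assms by (auto simp: adm_def)
  have "0 < card (orbit \<pi> ` B)" using B by (simp add: card_gt_0_iff)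
  then consider "card (orbit \<pi> ` B) = 1" | "card (orbit \<pi> ` B) = 2" using c by linarith
  then show ?thesis
  proof cases
    case 1 then show ?thesis using that(1) cyclic_on_of_single_orbit[OF \<pi>] by blast
  next
    case 2
    then show ?thesis using two_orbits[OF \<pi> 2] that(2) by blast
  qed
qed

text \<open>Arcs are single orbits, glued arcs are single orbits too, and only an arc with an
  attached second cycle has two. A part with three cycles never appears.\<close>

lemma block_orbits_le_2:
  assumes a: "adm \<pi> B" and st: "(\<sigma>, Q) \<in> steps \<pi> B" and X: "X \<in> Q"
  shows "card (orbit (pinv \<sigma> \<circ> \<pi>) ` X) \<le> 2"
proof -
  have \<pi>: "permutation \<pi>" using a by (simp add: adm_def)
  have cyc: "is_cycle B \<sigma>" using st by (simp add: steps_def)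
  define p where "p = pinv \<sigma> \<circ> \<pi>"
  have p: "permutation p"
    unfolding p_def by (rule permutation_comp_permutes[OF \<pi> permutes_inv[OF is_cycle_facts(2)[OF cyc]] is_cycle_facts(5)[OF cyc]])
  have one: "card (orbit p ` X) \<le> 2" if "X \<in> orbit p ` A" for A
    using that orbit_image_orbit[OF p] by auto
  from a show ?thesis
  proof (cases rule: adm_cases)
    case 1
    then have "Q = orbit p ` moved \<sigma>" using st single_cycle_steps[OF \<pi> 1] by (auto simp: p_def)
    then show ?thesis using one[of "moved \<sigma>"] X by (simp add: p_def)
  next
    case (2 C D)
    have DC: "D \<inter> C = {}" using 2 by auto
    have att: ?thesis if EF: "cyclic_on \<pi> E" "cyclic_on \<pi> E'" "E \<inter> E' = {}" "E \<union> E' = B" "moved \<sigma> \<subseteq> E" for E E'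
    proof -
      obtain x where ic: "is_cycle E \<sigma>" and att: "(\<sigma>, Q) = attach \<pi> E' (x, \<sigma>)"
        using steps_attach[OF \<pi> EF(1-3) st[folded EF(4)] EF(5)] by metis
      have "Q = insert (orbit p x \<union> E') (orbit p ` (moved \<sigma> - {x}))"
        using att by (simp add: attach_def p_def)
      then consider "X = orbit p x \<union> E'" | "X \<in> orbit p ` (moved \<sigma> - {x})" using X by blast
      then show ?thesis
      proof cases
        case 1
        have "orbit p ` E' \<subseteq> {E'}" using attach_setup(5)[OF \<pi> EF(1-3) ic] by (auto simp: p_def)
        then have "orbit p ` X \<subseteq> {orbit p x, E'}" unfolding 1 image_Un orbit_image_orbit[OF p] by auto
        then have "card (orbit p ` X) \<le> card {orbit p x, E'}" by (intro card_mono) auto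
        also have "\<dots> \<le> 2" using card_insert_le_Suc[of "orbit p x" "{E'}"] by simp
        finally show ?thesis by (simp add: p_def)
      qed (use one[of "moved \<sigma> - {x}"] in \<open>simp add: p_def\<close>)
    qed
    consider (inC) "moved \<sigma> \<subseteq> C" | (inD) "moved \<sigma> \<subseteq> D" | (neither) "\<not> moved \<sigma> \<subseteq> C" "\<not> moved \<sigma> \<subseteq> D" by blast
    then show ?thesis
    proof cases
      case inC
      then show ?thesis using att[OF 2(4,5,2,3)] by simp
    next
      case inD
      then show ?thesis using att[OF 2(5,4) DC] 2(3) by (simp add: Un_commute)
    next
      case neither
      obtain x A\<^sub>1 \<rho>\<^sub>1 y A\<^sub>2 \<rho>\<^sub>2 where "(\<sigma>, Q) = glue \<pi> ((x, A\<^sub>1, \<rho>\<^sub>1), (y, A\<^sub>2, \<rho>\<^sub>2))"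
        using steps_glue[OF \<pi> 2(4,5,2) st[folded 2(3)] neither] by metis
      then have "Q = orbit p ` (A\<^sub>1 \<union> A\<^sub>2)" unfolding glue_def prod.case p_def by blast
      then show ?thesis using one[of "A\<^sub>1 \<union> A\<^sub>2"] X by (simp add: p_def)
    qed
  qed
qed

text \<open>For two cycles the steps split according to whether the support lies in
  \<open>C\<close>, in \<open>D\<close>, or in neither, and the three sums are the three terms of
  \<open>hode\<close>.\<close>

lemma block_ode:
  fixes W :: "'c::{idom, ring_char_0} poly fps" and \<pi> :: "'a \<Rightarrow> 'a"
  assumes W0: "W $ 0 = 0" and h0: "\<And>b. h 0 b = 0" and hsym: "\<And>a b. h a b = h b a"
    and Wode: "\<And>n. pderiv (W $ n) = (\<Sum>k=2..n. [:q k:] * Y n k)"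
    and Y: "\<And>n k. of_nat k * Y n k = of_nat n * (W ^ k) $ n"
    and hode: "\<And>a b. pderiv (h a b) =
        of_nat a * (\<Sum>k=2..a. [:q k:] * (Abs_fps (\<lambda>g. h g b) * W ^ (k - 1)) $ a)
      + of_nat b * (\<Sum>k=2..b. [:q k:] * (Abs_fps (\<lambda>g. h g a) * W ^ (k - 1)) $ b)
      + of_nat a * of_nat b * (\<Sum>i=1..a. \<Sum>j=1..b. [:q (i + j):] * glued_coeff W a b i j)"
    and a: "adm \<pi> B"
  shows "pderiv (block_weight W h \<pi> B) =
    (\<Sum>(\<sigma>, Q)\<in>steps \<pi> B. [:q (card (moved \<sigma>)):] * (\<Prod>X\<in>Q. block_weight W h (pinv \<sigma> \<circ> \<pi>) X))"
proof -
  have \<pi>: "permutation \<pi>" and finB: "finite B" using a by (simp_all add: adm_def)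
  define F where "F = (\<lambda>(\<sigma> :: 'a \<Rightarrow> 'a, Q). [:q (card (moved \<sigma>)):] * (\<Prod>X\<in>Q. block_weight W h (pinv \<sigma> \<circ> \<pi>) X))"
  from a show ?thesis
  proof (cases rule: adm_cases)
    case 1
    define \<Sigma> where "\<Sigma> = {\<sigma>. is_cycle B \<sigma> \<and> inj_on (orbit (pinv \<sigma> \<circ> \<pi>)) (moved \<sigma>)}"
    have "(\<Sum>s\<in>steps \<pi> B. F s) = (\<Sum>\<sigma>\<in>\<Sigma>. [:q (card (moved \<sigma>)):] * (\<Prod>x\<in>moved \<sigma>. W $ card (orbit (pinv \<sigma> \<circ> \<pi>) x)))"
      unfolding single_cycle_steps[OF \<pi> 1] \<Sigma>_def[symmetric]
    proof (subst sum.reindex, force simp: inj_on_def, rule sum.cong[OF refl])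
      fix \<sigma> assume "\<sigma> \<in> \<Sigma>"
      then have cyc: "is_cycle B \<sigma>" and inj: "inj_on (orbit (pinv \<sigma> \<circ> \<pi>)) (moved \<sigma>)" by (auto simp: \<Sigma>_def)
      define p where "p = pinv \<sigma> \<circ> \<pi>"
      have p: "permutation p"
        unfolding p_def by (rule permutation_comp_permutes[OF \<pi> permutes_inv[OF is_cycle_facts(2)[OF cyc]] is_cycle_facts(5)[OF cyc]])
      show "(F \<circ> (\<lambda>\<sigma>. (\<sigma>, orbit (pinv \<sigma> \<circ> \<pi>) ` moved \<sigma>))) \<sigma> =
        [:q (card (moved \<sigma>)):] * (\<Prod>x\<in>moved \<sigma>. W $ card (orbit (pinv \<sigma> \<circ> \<pi>) x))"
        unfolding o_apply F_def prod.case p_def[symmetric] prod.reindex[OF inj[folded p_def]] o_apply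
          block_weight_orbit[OF p] ..
    qed
    also have "\<dots> = (\<Sum>k=2..card B. [:q k:] * Y (card B) k)"
      unfolding \<Sigma>_def using single_cycle_sum[where W = W and q = "\<lambda>k. [:q k:]" and Y = "Y (card B)", OF \<pi> 1 W0 Y] .
    finally show ?thesis unfolding F_def block_weight_one[OF 1] Wode by simp
  next
    case (2 C D)
    have DC: "D \<inter> C = {}" using 2 by auto
    have ne: "C \<noteq> D" using 2(2,4) by (auto simp: cyclic_on_def)
    let ?S = "steps \<pi> (C \<union> D)"
    define S1 S2 S3 where "S1 = {(\<sigma>, Q). (\<sigma>, Q) \<in> ?S \<and> moved \<sigma> \<subseteq> C}"
      and "S2 = {(\<sigma>, Q). (\<sigma>, Q) \<in> ?S \<and> moved \<sigma> \<subseteq> D}"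
      and "S3 = {(\<sigma>, Q). (\<sigma>, Q) \<in> ?S \<and> \<not> moved \<sigma> \<subseteq> C \<and> \<not> moved \<sigma> \<subseteq> D}"
    have fin: "finite ?S" using finB 2(3) by (intro finite_steps) simp
    have mvne: "moved \<sigma> \<noteq> {}" if "(\<sigma>, Q) \<in> ?S" for \<sigma> Q
      using that is_cycle_facts(4) by (auto simp: steps_def)
    have S: "?S = (S1 \<union> S2) \<union> S3" by (auto simp: S1_def S2_def S3_def)
    \<comment> \<open>A common element would have an empty support.\<close>
    have d12: "S1 \<inter> S2 = {}" using mvne 2(2) unfolding S1_def S2_def by blast
    have d3: "(S1 \<union> S2) \<inter> S3 = {}" unfolding S1_def S2_def S3_def by blast
    have f: "finite S1" "finite S2" "finite S3" using fin unfolding S by simp_all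
    have "(\<Sum>s\<in>?S. F s) = (\<Sum>s\<in>S1. F s) + (\<Sum>s\<in>S2. F s) + (\<Sum>s\<in>S3. F s)"
      unfolding S using sum.union_disjoint[of "S1 \<union> S2" S3 F] sum.union_disjoint[of S1 S2 F] f d12 d3 by simp
    also have "(\<Sum>s\<in>S1. F s) = of_nat (card C) *
        (\<Sum>k=2..card C. [:q k:] * (Abs_fps (\<lambda>g. h g (card D)) * W ^ (k - 1)) $ card C)"
      unfolding S1_def F_def using attach_sum[where h = h and W = W and q = "\<lambda>k. [:q k:]", OF \<pi> 2(4,5,2) W0 h0 hsym] .
    also have "(\<Sum>s\<in>S2. F s) = of_nat (card D) *
        (\<Sum>k=2..card D. [:q k:] * (Abs_fps (\<lambda>g. h g (card C)) * W ^ (k - 1)) $ card D)"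
      unfolding S2_def F_def Un_commute[of C D]
      using attach_sum[where h = h and W = W and q = "\<lambda>k. [:q k:]", OF \<pi> 2(5,4) DC W0 h0 hsym] .
    also have "(\<Sum>s\<in>S3. F s) = of_nat (card C) * of_nat (card D) *
      (\<Sum>i=1..card C. \<Sum>j=1..card D. [:q (i + j):] * glued_coeff W (card C) (card D) i j)"
      unfolding S3_def F_def using glue_sum[where h = h and W = W and q = "\<lambda>k. [:q k:]", OF \<pi> 2(4,5,2) W0] .
    finally have "(\<Sum>s\<in>?S. F s) = pderiv (h (card C) (card D))" unfolding hode .
    then show ?thesis
      unfolding block_weight_two[of h, OF hsym 2(1) ne] F_def 2(3) by simp
  qed
qed

text \<open>The transitive case: the partition has the single block \<open>S\<close>, and its weight
  is the value of \<open>h\<close> at the two cycle lengths.\<close>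

theorem facs_sum_two_cycles:
  fixes W :: "'c::{idom, ring_char_0} poly fps" and \<pi> :: "'a \<Rightarrow> 'a"
  assumes W0: "W $ 0 = 0" and h0: "\<And>b. h 0 b = 0" and hsym: "\<And>a b. h a b = h b a"
    and Wode: "\<And>n. pderiv (W $ n) = (\<Sum>k=2..n. [:q k:] * Y n k)"
    and Y: "\<And>n k. of_nat k * Y n k = of_nat n * (W ^ k) $ n"
    and hode: "\<And>a b. pderiv (h a b) =
        of_nat a * (\<Sum>k=2..a. [:q k:] * (Abs_fps (\<lambda>g. h g b) * W ^ (k - 1)) $ a)
      + of_nat b * (\<Sum>k=2..b. [:q k:] * (Abs_fps (\<lambda>g. h g a) * W ^ (k - 1)) $ b)
      + of_nat a * of_nat b * (\<Sum>i=1..a. \<Sum>j=1..b. [:q (i + j):] * glued_coeff W a b i j)"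
    and Winit: "\<And>n. coeff (W $ n) 0 = (if n = 1 then 1 else 0)"
    and hinit: "\<And>a b. coeff (h a b) 0 = 0"
    and S: "finite S" and \<pi>: "\<pi> permutes S" and CD: "orbit \<pi> ` S = {C, D}" "C \<noteq> D"
  shows "(\<Sum>F\<in>facs S r {S} \<pi>. wt q F) = fact r * coeff (h (card C) (card D)) r"
proof -
  have perm: "permutation \<pi>" using S \<pi> permutation_permutes by auto
  have "S \<noteq> {}" using CD(1) by auto
  have adm: "adm \<pi> S"
    using S \<open>S \<noteq> {}\<close> perm permutes_in_image[OF \<pi>] CD by (simp add: adm_def card_insert_if)
  have init: "coeff (block_weight W h \<pi>' B) 0 = (if card B = 1 then 1 else 0)"
    if a: "adm \<pi>' B" for \<pi>' :: "'a \<Rightarrow> 'a" and B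
    using a
  proof (cases rule: adm_cases)
    case 1
    then show ?thesis by (simp add: block_weight_one Winit)
  next
    case (2 C D)
    have ne: "C \<noteq> D" "C \<noteq> {}" "D \<noteq> {}" using 2(2,4,5) by (auto simp: cyclic_on_def)
    have fin: "finite C" "finite D" by (rule finite_cyclic_on[OF 2(4)], rule finite_cyclic_on[OF 2(5)])
    \<comment> \<open>Two cycles need at least two points, so the required initial value is 0, as
      \<open>hinit\<close> provides.\<close>
    have "card B = card C + card D"
      unfolding 2(3)[symmetric] by (rule card_Un_disjoint[OF fin 2(2)])
    moreover have "0 < card C" "0 < card D" using ne fin by (auto simp: card_gt_0_iff)
    ultimately show ?thesis
      using block_weight_two[of h, OF hsym 2(1) ne(1), of W] hinit by simp
  qed
  have "fact r * coeff (\<Prod>B\<in>{S}. block_weight W h \<pi> B) r = (\<Sum>F\<in>facs S r {S} \<pi>. wt q F)"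
  proof (rule facs_sum_eq_coeff[OF _ block_orbits_le_2 _ init S \<pi> partition_on_space[OF \<open>S \<noteq> {}\<close>]])
    show "pderiv (block_weight W h \<pi>' B) =
      (\<Sum>(\<sigma>, Q)\<in>steps \<pi>' B. [:q (card (moved \<sigma>)):] * (\<Prod>X\<in>Q. block_weight W h (pinv \<sigma> \<circ> \<pi>') X))"
      if "adm \<pi>' B" for \<pi>' :: "'a \<Rightarrow> 'a" and B
      by (rule block_ode[OF W0 h0 hsym Wode Y hode that])
    show "block_weight W h \<pi>'' X = block_weight W h \<pi>' X"
      if "\<And>x. x \<in> X \<Longrightarrow> \<pi>' x \<in> X" "\<And>x. x \<in> X \<Longrightarrow> \<pi>'' x = \<pi>' x" for \<pi>' \<pi>'' :: "'a \<Rightarrow> 'a" and X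
    proof -
      have "orbit \<pi>'' ` X = orbit \<pi>' ` X" by (rule orbit_image_cong) (use that in auto)
      then show ?thesis by (simp only: block_weight_def)
    qed
  qed (use adm in simp_all)
  moreover have "(\<Prod>B\<in>{S}. block_weight W h \<pi> B) = h (card C) (card D)"
    using block_weight_two[where h = h and W = W, OF hsym CD] by simp
  ultimately show ?thesis by (simp only:)
qed

section \<open>Derivations of power series, the chain rule, and the equation for w\<close>

section \<open>Derivations and the tree series\<close>

text \<open>Additivity and the Leibniz rule are what all operators used here have in common; which
  constants are annihilated is established for each of them separately.\<close>

definition derivation :: "('a::comm_ring_1 \<Rightarrow> 'a) \<Rightarrow> bool" where
  "derivation \<delta> \<longleftrightarrow> (\<forall>x y. \<delta> (x + y) = \<delta> x + \<delta> y) \<and> (\<forall>x y. \<delta> (x * y) = \<delta> x * y + x * \<delta> y)"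

lemma derivation_add: "derivation \<delta> \<Longrightarrow> \<delta> (x + y) = \<delta> x + \<delta> y"
  and derivation_mult: "derivation \<delta> \<Longrightarrow> \<delta> (x * y) = \<delta> x * y + x * \<delta> y"
  by (simp_all add: derivation_def)

lemma derivation_0: "derivation \<delta> \<Longrightarrow> \<delta> 0 = 0"
  using derivation_add[of \<delta> 0 0] by simp

lemma derivation_1: "derivation \<delta> \<Longrightarrow> \<delta> 1 = 0"
  using derivation_mult[of \<delta> 1 1] by simp

lemma derivation_minus: "derivation \<delta> \<Longrightarrow> \<delta> (- x) = - \<delta> x"
  using derivation_add[of \<delta> x "- x"] derivation_0[of \<delta>] by (simp add: eq_neg_iff_add_eq_0 add.commute)

lemma derivation_diff: "derivation \<delta> \<Longrightarrow> \<delta> (x - y) = \<delta> x - \<delta> y"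
  using derivation_add[of \<delta> x "- y"] derivation_minus[of \<delta> y] by simp

lemma derivation_sum: "derivation \<delta> \<Longrightarrow> \<delta> (\<Sum>i\<in>I. f i) = (\<Sum>i\<in>I. \<delta> (f i))"
  by (induction I rule: infinite_finite_induct) (simp_all add: derivation_0 derivation_add)

lemma derivation_power: "derivation \<delta> \<Longrightarrow> \<delta> (x ^ Suc n) = of_nat (Suc n) * x ^ n * \<delta> x"
proof (induction n)
  case (Suc n)
  have "\<delta> (x ^ Suc (Suc n)) = \<delta> x * x ^ Suc n + x * \<delta> (x ^ Suc n)"
    using Suc(2) by (simp add: derivation_mult)
  then show ?case using Suc by (simp add: algebra_simps)
qed simp

definition map_fps :: "('a::zero \<Rightarrow> 'b::zero) \<Rightarrow> 'a fps \<Rightarrow> 'b fps" where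
  "map_fps g f = Abs_fps (\<lambda>n. g (f $ n))"

text \<open>The operator x d/dx. It preserves the degree in x, which the locality arguments
  use.\<close>

definition euler :: "'a::comm_ring_1 fps \<Rightarrow> 'a fps" where
  "euler f = Abs_fps (\<lambda>n. of_nat n * f $ n)"

lemma map_fps_nth [simp]: "map_fps g f $ n = g (f $ n)"
  by (simp add: map_fps_def)

lemma euler_nth [simp]: "euler f $ n = of_nat n * f $ n"
  by (simp add: euler_def)

lemma derivation_map_fps: "derivation \<delta> \<Longrightarrow> derivation (map_fps \<delta>)"
  unfolding derivation_def[of "map_fps \<delta>"]
  by (auto simp: fps_eq_iff fps_mult_nth derivation_add derivation_sum derivation_mult sum.distrib)

lemma derivation_euler: "derivation euler"
  unfolding derivation_def
proof (intro conjI allI)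
  fix x y :: "'a fps"
  show "euler (x + y) = euler x + euler y" by (simp add: fps_eq_iff algebra_simps)
  show "euler (x * y) = euler x * y + x * euler y"
  proof (rule fps_ext)
    fix n
    have "euler (x * y) $ n = (\<Sum>i=0..n. of_nat n * (x $ i * y $ (n - i)))"
      by (simp add: fps_mult_nth sum_distrib_left)
    also have "\<dots> = (\<Sum>i=0..n. of_nat i * x $ i * y $ (n - i) + x $ i * (of_nat (n - i) * y $ (n - i)))"
      by (rule sum.cong) (auto simp: of_nat_diff algebra_simps)
    also have "\<dots> = (euler x * y + x * euler y) $ n"
      by (simp add: fps_mult_nth sum.distrib)
    finally show "euler (x * y) $ n = (euler x * y + x * euler y) $ n" .
  qed
qed

lemma derivation_pderiv: "derivation (pderiv :: 'a::idom poly \<Rightarrow> 'a poly)"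
  by (simp add: derivation_def pderiv_add pderiv_mult algebra_simps)

lemma derivation_lincomb:
  assumes "derivation \<delta>" "derivation \<epsilon>"
  shows "derivation (\<lambda>x. \<delta> x - c * \<epsilon> x)"
  unfolding derivation_def
  by (auto simp: derivation_add[OF assms(1)] derivation_add[OF assms(2)] derivation_mult[OF assms(1)]
      derivation_mult[OF assms(2)] algebra_simps)

lemma power_nth_zero:
  fixes w :: "'a::comm_ring_1 fps"
  assumes "w $ 0 = 0" "n < i"
  shows "(w ^ i) $ n = 0"
  using assms startsby_zero_power_prefix[of w i] by simp

text \<open>\<open>w ^ i\<close> has order at least \<open>i\<close>, so the summation may run up to
  any \<open>N \<ge> n\<close>; a common bound allows sums to be exchanged.\<close>

lemma compose_mult_nth:
  fixes w :: "'a::comm_ring_1 fps"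
  assumes w: "w $ 0 = 0" and N: "n \<le> N"
  shows "(g * (a oo w)) $ n = (\<Sum>i=0..N. a $ i * (g * w ^ i) $ n)"
proof -
  have "(g * (a oo w)) $ n = (\<Sum>m=0..n. g $ (n - m) * (\<Sum>i=0..m. a $ i * (w ^ i) $ m))"
    unfolding mult.commute[of g] fps_mult_nth fps_compose_nth by (simp add: mult.commute)
  also have "\<dots> = (\<Sum>m=0..n. \<Sum>i=0..N. a $ i * ((w ^ i) $ m * g $ (n - m)))"
  proof (rule sum.cong[OF refl])
    fix m assume m: "m \<in> {0..n}"
    have "(\<Sum>i=0..m. a $ i * (w ^ i) $ m) = (\<Sum>i=0..N. a $ i * (w ^ i) $ m)"
      by (rule sum.mono_neutral_left) (use m N power_nth_zero[OF w] in auto)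
    then show "g $ (n - m) * (\<Sum>i=0..m. a $ i * (w ^ i) $ m) = (\<Sum>i=0..N. a $ i * ((w ^ i) $ m * g $ (n - m)))"
      by (simp add: sum_distrib_left mult.commute mult.left_commute)
  qed
  also have "\<dots> = (\<Sum>i=0..N. \<Sum>m=0..n. a $ i * ((w ^ i) $ m * g $ (n - m)))"
    by (rule sum.swap)
  also have "\<dots> = (\<Sum>i=0..N. a $ i * (g * w ^ i) $ n)"
    unfolding mult.commute[of g] fps_mult_nth by (simp add: sum_distrib_left)
  finally show ?thesis .
qed

text \<open>By the locality premise the chain rule can be checked on polynomial truncations.\<close>

lemma derivation_compose:
  fixes w :: "'a::comm_ring_1 fps"
  assumes d: "derivation \<delta>" and loc: "\<And>f g n. f $ n = g $ n \<Longrightarrow> \<delta> f $ n = \<delta> g $ n"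
    and const: "\<And>i. \<delta> (fps_const (a $ i)) = 0" and w: "w $ 0 = 0"
  shows "\<delta> (a oo w) = (fps_deriv a oo w) * \<delta> w"
proof (rule fps_ext)
  fix n
  have z: "\<delta> f $ m = 0" if "f $ m = 0" for f m
    using loc[of f m 0] that derivation_0[OF d] by simp
  have "\<delta> (a oo w) $ n = \<delta> (\<Sum>i=0..n. fps_const (a $ i) * w ^ i) $ n"
    by (rule loc) (simp add: fps_compose_nth fps_sum_nth)
  also have "\<dots> = (\<Sum>i=0..n. (fps_const (a $ i) * \<delta> (w ^ i)) $ n)"
    by (simp add: derivation_sum[OF d] derivation_mult[OF d] const fps_sum_nth)
  also have "\<dots> = (\<Sum>i=0..n. a $ i * \<delta> (w ^ i) $ n)" by simp
  \<comment> \<open>The term with exponent 0 vanishes, and the one with exponent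
    \<open>Suc n\<close> has too high an order to matter; after this shift the coefficients of the
    derivative of \<open>a\<close> appear.\<close>
  also have "\<dots> = (\<Sum>i=1..Suc n. a $ i * \<delta> (w ^ i) $ n)"
  proof -
    have "(\<Sum>i=0..n. a $ i * \<delta> (w ^ i) $ n) = (\<Sum>i=0..Suc n. a $ i * \<delta> (w ^ i) $ n)"
      using z power_nth_zero[OF w, of n "Suc n"] by simp
    also have "\<dots> = (\<Sum>i=1..Suc n. a $ i * \<delta> (w ^ i) $ n)"
      by (rule sum.mono_neutral_right) (auto simp: not_less_eq_eq derivation_1[OF d] le_Suc_eq)
    finally show ?thesis .
  qed
  also have "\<dots> = (\<Sum>i=0..n. a $ Suc i * \<delta> (w ^ Suc i) $ n)"
    by (simp only: One_nat_def sum.shift_bounds_cl_Suc_ivl)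
  also have "\<dots> = (\<Sum>i=0..n. fps_deriv a $ i * (\<delta> w * w ^ i) $ n)"
  proof (rule sum.cong[OF refl])
    fix i
    have e: "\<delta> (w ^ Suc i) = fps_const (of_nat (Suc i)) * (\<delta> w * w ^ i)"
      unfolding derivation_power[OF d] fps_of_nat by (simp only: mult_ac)
    show "a $ Suc i * \<delta> (w ^ Suc i) $ n = fps_deriv a $ i * (\<delta> w * w ^ i) $ n"
      unfolding e fps_mult_left_const_nth by (simp add: mult_ac)
  qed
  also have "\<dots> = (\<delta> w * (fps_deriv a oo w)) $ n" by (rule compose_mult_nth[OF w, symmetric]) simp
  finally show "\<delta> (a oo w) $ n = ((fps_deriv a oo w) * \<delta> w) $ n" by (simp only: mult.commute)
qed

lemma scalar_simps:
  "scalar 0 = 0" "scalar 1 = 1" "scalar (a + b) = scalar a + scalar b" "scalar (a * b) = scalar a * scalar b"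
  "scalar (- a) = - scalar a" "scalar (of_nat n) = of_nat n" "pderiv (scalar a) = 0"
proof -
  show 0: "scalar 0 = 0" and 1: "scalar 1 = 1" by (simp_all add: scalar_def single_one)
  show add: "scalar (a + b) = scalar a + scalar b" for a b by (simp add: scalar_def single_add)
  show "scalar (a * b) = scalar a * scalar b" by (simp add: scalar_def mult_single mult.commute[of a b])
  show "scalar (- a) = - scalar a" by (simp add: scalar_def single_uminus)
  show "scalar (of_nat n) = of_nat n" by (induction n) (simp_all add: 0 1 add)
  show "pderiv (scalar a) = 0" by (simp add: scalar_def pderiv_pCons)
qed

lemma scalar_inverse_nat: "n \<noteq> 0 \<Longrightarrow> of_nat n * scalar (c / of_nat n) = scalar c"
  by (subst scalar_simps(6)[symmetric], subst scalar_simps(4)[symmetric]) simp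

definition tree_rhs :: "series1 \<Rightarrow> series1" where
  "tree_rhs w = fps_X * (exp_ser oo (fps_const uvar * (Qser oo w)))"

definition agree :: "nat \<Rightarrow> 'a fps \<Rightarrow> 'a fps \<Rightarrow> bool" where
  "agree n f g \<longleftrightarrow> (\<forall>k\<le>n. f $ k = g $ k)"

lemma agree_mult: "agree n f f' \<Longrightarrow> agree n g g' \<Longrightarrow> agree n (f * g) (f' * g')" for f :: "'a::comm_ring_1 fps"
  by (auto simp: agree_def fps_mult_nth intro!: sum.cong)

lemma agree_power: "agree n f f' \<Longrightarrow> agree n (f ^ i) (f' ^ i)" for f :: "'a::comm_ring_1 fps"
  by (induction i) (auto intro: agree_mult simp: agree_def[of n 1 1])

lemma agree_compose: "agree n f f' \<Longrightarrow> agree n (a oo f) (a oo f')" for f :: "'a::comm_ring_1 fps"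
  using agree_power[of n f f'] by (auto simp: agree_def fps_compose_nth intro!: sum.cong)

text \<open>The factor \<open>fps_X\<close> gains one degree of agreement, so
  \<open>tree_rhs\<close> is a contraction in the x-adic metric.\<close>

lemma agree_tree_rhs: "agree n f g \<Longrightarrow> agree (Suc n) (tree_rhs f) (tree_rhs g)"
proof -
  assume "agree n f g"
  then have "agree n (exp_ser oo (fps_const uvar * (Qser oo f))) (exp_ser oo (fps_const uvar * (Qser oo g)))"
    by (intro agree_compose agree_mult) (simp_all add: agree_def)
  then show ?thesis by (auto simp: agree_def tree_rhs_def)
qed

lemma tree_rhs_0: "tree_rhs w $ 0 = 0"
  by (simp add: tree_rhs_def)

text \<open>Fixed point of a contraction: coefficient \<open>n\<close> of the iterates is stationary
  from iterate \<open>Suc n\<close> on, and the diagonal of these coefficients is the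
  solution.\<close>

lemma ex1_tree_equation: "\<exists>!w. tree_equation w"
proof -
  have eq: "tree_equation w \<longleftrightarrow> w = tree_rhs w" for w by (simp add: tree_equation_def tree_rhs_def)
  define it where "it = (\<lambda>k. (tree_rhs ^^ k) 0)"
  have it: "it (Suc k) = tree_rhs (it k)" for k by (simp add: it_def funpow.simps(2))
  have a: "agree k (it (Suc k)) (it (Suc (Suc k)))" for k
  proof (induction k)
    case 0
    then show ?case using tree_rhs_0 by (simp add: agree_def it[of 0] it[of "Suc 0"])
  next
    case (Suc k)
    then show ?case using agree_tree_rhs by (metis it)
  qed
  have b: "it (Suc k) $ k = it (Suc n) $ k" if "k \<le> n" for k n
    using that
  proof (induction n)
    case (Suc n)
    then show ?case using a[of n] by (cases "k = Suc n") (auto simp: agree_def)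
  qed simp
  define w where "w = Abs_fps (\<lambda>n. it (Suc n) $ n)"
  have w: "agree n w (it (Suc n))" for n using b by (auto simp: agree_def w_def)
  have "w = tree_rhs w"
  proof (rule fps_ext)
    fix n
    have "agree (Suc n) (tree_rhs w) (it (Suc (Suc n)))"
      using agree_tree_rhs[OF w[of n]] it by simp
    moreover have "agree (Suc n) w (it (Suc (Suc n)))" by (rule w)
    ultimately show "w $ n = tree_rhs w $ n" by (simp add: agree_def)
  qed
  moreover have "v = w" if "v = tree_rhs v" "w = tree_rhs w" for v w
  proof (rule fps_ext)
    fix n
    have "agree n v w"
    proof (induction n)
      case 0
      then show ?case using that tree_rhs_0 by (metis agree_def le_0_eq)
    next
      case (Suc n)
      then show ?case using agree_tree_rhs that by metis
    qed
    then show "v $ n = w $ n" by (simp add: agree_def)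
  qed
  ultimately show ?thesis unfolding eq by blast
qed

lemma derivation_du: "derivation (map_fps pderiv :: series1 \<Rightarrow> series1)"
  by (rule derivation_map_fps[OF derivation_pderiv])

lemma map_fps_const [simp]: "g 0 = 0 \<Longrightarrow> map_fps g (fps_const c) = fps_const (g c)"
  by (simp add: fps_eq_iff)

lemma euler_const [simp]: "euler (fps_const c) = 0"
  by (simp add: fps_eq_iff)

lemma du_compose:
  fixes w :: series1
  assumes "\<And>i. pderiv (a $ i) = 0" "w $ 0 = 0"
  shows "map_fps pderiv (a oo w) = (fps_deriv a oo w) * map_fps pderiv w"
  by (rule derivation_compose[OF derivation_du _ _ assms(2)]) (simp_all add: assms(1))

lemma euler_compose:
  fixes w :: "'a::comm_ring_1 fps"
  assumes "w $ 0 = 0"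
  shows "euler (a oo w) = (fps_deriv a oo w) * euler w"
  by (rule derivation_compose[OF derivation_euler _ _ assms]) simp_all

lemma exp_ser_deriv: "fps_deriv exp_ser = exp_ser"
proof (rule fps_ext)
  fix n
  have "fps_deriv exp_ser $ n = of_nat (Suc n) * scalar ((1 / fact n) / of_nat (Suc n))"
    by (simp add: exp_ser_def field_simps)
  also have "\<dots> = scalar (1 / fact n)" by (rule scalar_inverse_nat) simp
  finally show "fps_deriv exp_ser $ n = exp_ser $ n" by (simp add: exp_ser_def)
qed

lemma pderiv_qvar: "pderiv (qvar k) = 0"
  by (simp add: qvar_def pderiv_pCons)

lemma pderiv_uvar: "pderiv uvar = 1"
  by (simp add: uvar_def pderiv_pCons)

context
  fixes w :: series1
  assumes tree: "tree_equation w"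
begin

lemma w0: "w $ 0 = 0"
  using tree tree_rhs_0[of w] by (metis tree_equation_def tree_rhs_def)

lemma Qw0: "(Qser oo w) $ 0 = 0"
  by (simp add: Qser_def)

text \<open>Differentiating w = x exp(u Q(w)) by u and by D = x d/dx gives two linear equations with
  the same factor Z = 1 - u w Q'(w), namely Z times the u-derivative of w equals w Q(w), and Z Dw =
  w. Since Z has constant term 1, it cancels.\<close>

lemma du_w: "map_fps pderiv w = (Qser oo w) * euler w"
proof -
  define Qw where "Qw = Qser oo w"
  define Q' where "Q' = fps_deriv Qser oo w"
  define G where "G = fps_const uvar * Qw"
  define E where "E = exp_ser oo G"
  have w: "w = fps_X * E" using tree by (simp add: tree_equation_def E_def G_def Qw_def)
  have G0: "G $ 0 = 0" using Qw0 by (simp add: G_def Qw_def)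
  have dE: "map_fps pderiv E = E * map_fps pderiv G" "euler E = E * euler G"
    unfolding E_def using du_compose[OF _ G0, of exp_ser] euler_compose[OF G0, of exp_ser]
    by (simp_all add: exp_ser_deriv) (simp_all add: exp_ser_def scalar_simps)
  have duQ: "map_fps pderiv Qw = Q' * map_fps pderiv w" and eQ: "euler Qw = Q' * euler w"
    unfolding Qw_def Q'_def using du_compose[OF _ w0, of Qser] euler_compose[OF w0, of Qser]
    by (simp_all add: Qser_def pderiv_qvar)
  have dX: "map_fps pderiv fps_X = (0 :: series1)" "euler fps_X = (fps_X :: series1)"
    by (simp_all add: fps_eq_iff fps_X_def)
  have dG: "map_fps pderiv G = Qw + fps_const uvar * map_fps pderiv Qw" "euler G = fps_const uvar * euler Qw"
    unfolding G_def by (simp_all add: derivation_mult[OF derivation_du] derivation_mult[OF derivation_euler] pderiv_uvar)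
  have 1: "map_fps pderiv w = w * (Qw + fps_const uvar * (Q' * map_fps pderiv w))"
  proof -
    have "map_fps pderiv w = map_fps pderiv (fps_X * E)" by (rule arg_cong[OF w])
    also have "\<dots> = fps_X * E * (Qw + fps_const uvar * (Q' * map_fps pderiv w))"
      by (simp add: derivation_mult[OF derivation_du] dX dE dG duQ mult_ac)
    finally show ?thesis by (simp only: w[symmetric])
  qed
  have 2: "euler w = w * (1 + fps_const uvar * (Q' * euler w))"
  proof -
    have "euler w = euler (fps_X * E)" by (rule arg_cong[OF w])
    also have "\<dots> = fps_X * E * (1 + fps_const uvar * (Q' * euler w))"
      by (simp add: derivation_mult[OF derivation_euler] dX dE dG eQ algebra_simps)
    finally show ?thesis by (simp only: w[symmetric])
  qed
  define Z where "Z = 1 - w * fps_const uvar * Q'"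
  have "Z * map_fps pderiv w = w * Qw" using 1 unfolding Z_def by (simp add: algebra_simps)
  moreover have "Z * euler w = w" using 2 unfolding Z_def by (simp add: algebra_simps)
  ultimately have "Z * (map_fps pderiv w - Qw * euler w) = 0"
    by (simp add: right_diff_distrib mult.left_commute mult.commute)
  moreover have "Z $ 0 = 1" unfolding Z_def using w0 by simp
  then have "Z \<noteq> 0" by auto
  ultimately show ?thesis by (simp add: Qw_def)
qed

lemma du_Qw: "map_fps pderiv (Qser oo w) = (Qser oo w) * euler (Qser oo w)"
  using du_compose[OF _ w0, of Qser] euler_compose[OF w0, of Qser]
  by (simp add: Qser_def pderiv_qvar du_w mult_ac)

text \<open>At u = 0 the tree equation reads w = x.\<close>

lemma coeff_w_0: "coeff (w $ n) 0 = (if n = 1 then 1 else 0)"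
proof (cases n)
  case (Suc m)
  define G where "G = fps_const uvar * (Qser oo w)"
  have u: "coeff ((G ^ Suc i) $ m) 0 = 0" for i
  proof -
    have "(G ^ Suc i) $ m = uvar * (((Qser oo w) * G ^ i) $ m)"
      by (simp add: G_def mult.assoc)
    then show ?thesis by (simp add: uvar_def coeff_mult)
  qed
  have "w = fps_X * (exp_ser oo G)" using tree by (simp add: tree_equation_def G_def)
  then have "w $ n = (exp_ser oo G) $ m" unfolding Suc by (metis fps_X_mult_nth diff_Suc_1 nat.distinct(1))
  also have "\<dots> = (\<Sum>i=0..m. exp_ser $ i * (G ^ i) $ m)" by (rule fps_compose_nth)
  finally have "coeff (w $ n) 0 = (\<Sum>i=0..m. coeff (exp_ser $ i) 0 * coeff ((G ^ i) $ m) 0)"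
    by (simp add: coeff_sum coeff_mult)
  also have "\<dots> = (\<Sum>i\<in>{0}. coeff (exp_ser $ i) 0 * coeff ((G ^ i) $ m) 0)"
  proof (rule sum.mono_neutral_right)
    show "\<forall>i\<in>{0..m} - {0}. coeff (exp_ser $ i) 0 * coeff ((G ^ i) $ m) 0 = 0"
      using u by (metis DiffD2 insertI1 mult_zero_right not0_implies_Suc)
  qed auto
  also have "\<dots> = (if n = 1 then 1 else 0)"
    by (simp add: exp_ser_def scalar_simps Suc)
  finally show ?thesis .
qed (simp add: w0)

end

section \<open>Two variables: derivations, total degree, logarithm and divided differences\<close>

section \<open>Series in two variables\<close>

lemma at_x1_hom:
  "at_x1 (f + g) = at_x1 f + at_x1 g" "at_x1 (f - g) = at_x1 f - at_x1 g" "at_x1 (f * g) = at_x1 f * at_x1 g"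
  by (simp_all add: at_x1_def)

lemma at_x2_eq: "at_x2 f = map_fps fps_const f"
  by (simp add: at_x2_def map_fps_def)

lemma at_x2_hom:
  "at_x2 (f + g) = at_x2 f + at_x2 g" "at_x2 (f - g) = at_x2 f - at_x2 g" "at_x2 (f * g) = at_x2 f * at_x2 g"
proof -
  show "at_x2 (f * g) = at_x2 f * at_x2 g"
    by (rule fps_ext, rule fps_ext) (simp add: at_x2_def fps_mult_nth fps_sum_nth)
qed (simp_all add: at_x2_def fps_eq_iff)

lemma mult_at_x1_nth: "(F * at_x1 f) $ b = F $ b * f"
  by (simp add: at_x1_def)

lemma mult_at_x2_nth: "(F * at_x2 f) $ b $ a = (\<Sum>j=0..b. F $ j $ a * f $ (b - j))"
  by (simp add: at_x2_def fps_mult_nth[of F] fps_sum_nth)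

lemma x1_mult_nth: "(x1 * F) $ b $ a = (if a = 0 then 0 else F $ b $ (a - 1))"
  by (simp add: at_x1_def)

lemma x2_mult_nth: "(x2 * F) $ b $ a = (if b = 0 then 0 else F $ (b - 1) $ a)"
proof -
  have "x2 = fps_X" by (rule fps_ext) (simp add: at_x2_def fps_X_def)
  then show ?thesis by simp
qed

lemma fps2_ext: "(\<And>b a. F $ b $ a = G $ b $ a) \<Longrightarrow> F = G" for F G :: "'a::zero fps fps"
  by (intro fps_ext)

abbreviation du :: "series2 \<Rightarrow> series2" where "du \<equiv> map_fps (map_fps pderiv)"
abbreviation d1 :: "series2 \<Rightarrow> series2" where "d1 \<equiv> map_fps euler"
abbreviation d2 :: "series2 \<Rightarrow> series2" where "d2 \<equiv> euler"

lemma derivations: "derivation du" "derivation d1" "derivation d2"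
  by (rule derivation_map_fps[OF derivation_du] derivation_map_fps[OF derivation_euler] derivation_euler)+

lemma derivations_at:
  "du (at_x1 f) = at_x1 (map_fps pderiv f)" "du (at_x2 f) = at_x2 (map_fps pderiv f)"
  "d1 (at_x1 f) = at_x1 (euler f)" "d1 (at_x2 f) = 0"
  "d2 (at_x1 f) = 0" "d2 (at_x2 f) = at_x2 (euler f)"
proof -
  have "map_fps pderiv (0 :: series1) = 0" "euler (0 :: series1) = 0" by (simp_all add: fps_eq_iff)
  then show "du (at_x1 f) = at_x1 (map_fps pderiv f)" "d1 (at_x1 f) = at_x1 (euler f)"
    by (simp_all add: at_x1_def)
  show "du (at_x2 f) = at_x2 (map_fps pderiv f)" "d1 (at_x2 f) = 0"
    by (auto intro!: fps_ext simp: at_x2_def)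
  show "d2 (at_x1 f) = 0" by (simp add: at_x1_def)
  show "d2 (at_x2 f) = at_x2 (euler f)"
    by (rule fps2_ext) (simp add: at_x2_def fps_of_nat[symmetric] del: fps_of_nat)
qed

text \<open>Filtration by total degree, for which the partial sums of the logarithm series
  converge.\<close>

definition deg_ge :: "nat \<Rightarrow> series2 \<Rightarrow> bool" where
  "deg_ge N f \<longleftrightarrow> (\<forall>a b. a + b < N \<longrightarrow> f $ b $ a = 0)"

lemma mult_nth2: "(f * g) $ b $ a = (\<Sum>j=0..b. \<Sum>i=0..a. f $ j $ i * g $ (b - j) $ (a - i))" for f g :: series2
  by (simp add: fps_mult_nth fps_sum_nth)

lemma deg_ge_mult:
  assumes "deg_ge N f" "deg_ge M g"
  shows "deg_ge (N + M) (f * g)"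
  unfolding deg_ge_def
proof (intro allI impI)
  fix a b assume ab: "a + b < N + M"
  show "(f * g) $ b $ a = 0"
    unfolding mult_nth2
  proof (intro sum.neutral ballI)
    fix j i assume ij: "j \<in> {0..b}" "i \<in> {0..a}"
    then have "i + j < N \<or> (a - i) + (b - j) < M" using ab by auto
    then show "f $ j $ i * g $ (b - j) $ (a - i) = 0" using assms by (auto simp: deg_ge_def)
  qed
qed

lemma deg_ge_0 [simp]: "deg_ge 0 f"
  by (simp add: deg_ge_def)

lemma deg_ge_power: "deg_ge 1 f \<Longrightarrow> deg_ge m (f ^ m)"
proof (induction m)
  case (Suc m)
  then show ?case using deg_ge_mult[of 1 f m "f ^ m"] by simp
qed simp

lemma deg_ge_mult_left: "deg_ge N f \<Longrightarrow> deg_ge N (g * f)"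
  using deg_ge_mult[of 0 g N f] by simp

lemma deg_ge_diff: "deg_ge N f \<Longrightarrow> deg_ge N g \<Longrightarrow> deg_ge N (f - g)"
  by (simp add: deg_ge_def)

lemma deg_ge_all_imp_0: "(\<And>N. deg_ge N f) \<Longrightarrow> f = 0"
  by (rule fps2_ext) (metis deg_ge_def fps_zero_nth lessI)

definition const2 :: "rat \<Rightarrow> series2" where
  "const2 c = fps_const (fps_const (scalar c))"

definition log_trunc :: "nat \<Rightarrow> series2 \<Rightarrow> series2" where
  "log_trunc N S = (\<Sum>m=1..N. const2 ((-1) ^ (m + 1) / of_nat m) * (S - 1) ^ m)"

text \<open>\<open>(S - 1) ^ m\<close> starts in total degree \<open>m\<close>, so the terms beyond
  \<open>N\<close> do not reach total degree \<open>N\<close>.\<close>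

lemma series_log_trunc:
  assumes "deg_ge 1 (S - 1)"
  shows "deg_ge (Suc N) (series_log S - log_trunc N S)"
  unfolding deg_ge_def
proof (intro allI impI)
  fix a b assume ab: "a + b < Suc N"
  have "log_trunc N S $ b $ a = (\<Sum>m=1..N. scalar ((-1) ^ (m + 1) / of_nat m) * ((S - 1) ^ m $ b $ a))"
    by (simp add: log_trunc_def const2_def fps_sum_nth)
  also have "\<dots> = (\<Sum>m=1..a + b. scalar ((-1) ^ (m + 1) / of_nat m) * ((S - 1) ^ m $ b $ a))"
  proof (rule sum.mono_neutral_right)
    show "\<forall>m\<in>{1..N} - {1..a + b}. scalar ((-1) ^ (m + 1) / of_nat m) * ((S - 1) ^ m $ b $ a) = 0"
    proof
      fix m assume "m \<in> {1..N} - {1..a + b}"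
      then have "a + b < m" by auto
      then have "(S - 1) ^ m $ b $ a = 0" using deg_ge_power[OF assms, of m] by (simp add: deg_ge_def)
      then show "scalar ((-1) ^ (m + 1) / of_nat m) * ((S - 1) ^ m $ b $ a) = 0" by simp
    qed
  qed (use ab in auto)
  finally show "(series_log S - log_trunc N S) $ b $ a = 0" by (simp add: series_log_def)
qed

lemma const2_nat: "m \<noteq> 0 \<Longrightarrow> of_nat m * const2 (c / of_nat m) = const2 c"
proof -
  assume "m \<noteq> 0"
  have "(of_nat m :: series2) = fps_const (fps_const (of_nat m))" by (simp add: fps_of_nat)
  then show ?thesis using scalar_inverse_nat[OF \<open>m \<noteq> 0\<close>, of c] by (simp add: const2_def)
qed

lemma const2_sign: "const2 ((-1) ^ m) = (-1) ^ m"
proof (induction m)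
  case 0
  show ?case by (simp add: const2_def scalar_simps)
next
  case (Suc m)
  have "const2 ((-1) ^ Suc m) = - const2 ((-1) ^ m)" by (simp add: const2_def scalar_simps)
  then show ?case using Suc by simp
qed

text \<open>On truncations a geometric sum gives the rule up to the error
  \<open>(1 - S) ^ N * \<delta> S\<close>. By \<open>loc\<close> the derivative of the omitted terms
  stays in high degree, so the two sides differ by a series of arbitrarily high total degree, which
  is 0.\<close>

lemma derivation_log:
  assumes d: "derivation \<delta>" and loc: "\<And>N f. deg_ge N f \<Longrightarrow> deg_ge N (\<delta> f)"
    and const: "\<And>c. \<delta> (const2 c) = 0" and S: "deg_ge 1 (S - 1)"
  shows "S * \<delta> (series_log S) = \<delta> S"
proof -
  \<comment> \<open>The summands have derivatives \<open>(1 - S) ^ m * \<delta> S\<close>, and the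
    factor \<open>S = 1 - (1 - S)\<close> telescopes their sum.\<close>
  have trunc: "S * \<delta> (log_trunc N S) = (1 - (1 - S) ^ N) * \<delta> S" for N
  proof (induction N)
    case 0
    show ?case by (simp add: log_trunc_def derivation_0[OF d])
  next
    case (Suc N)
    have dS: "\<delta> (S - 1) = \<delta> S" by (simp add: derivation_diff[OF d] derivation_1[OF d])
    have "\<delta> (const2 ((-1) ^ (Suc N + 1) / of_nat (Suc N)) * (S - 1) ^ Suc N)
        = const2 ((-1) ^ (Suc N + 1) / of_nat (Suc N)) * (of_nat (Suc N) * (S - 1) ^ N * \<delta> S)"
      unfolding derivation_mult[OF d] const derivation_power[OF d] dS by simp
    also have "\<dots> = (of_nat (Suc N) * const2 ((-1) ^ (Suc N + 1) / of_nat (Suc N))) * ((S - 1) ^ N * \<delta> S)"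
      by (simp only: mult_ac)
    also have "\<dots> = (-1) ^ N * ((S - 1) ^ N * \<delta> S)"
      unfolding const2_nat[OF nat.simps(3)] const2_sign by simp
    also have "\<dots> = (1 - S) ^ N * \<delta> S"
      by (simp add: mult.assoc[symmetric] power_mult_distrib[symmetric])
    finally have step: "\<delta> (const2 ((-1) ^ (Suc N + 1) / of_nat (Suc N)) * (S - 1) ^ Suc N) = (1 - S) ^ N * \<delta> S" .
    have "log_trunc (Suc N) S = log_trunc N S + const2 ((-1) ^ (Suc N + 1) / of_nat (Suc N)) * (S - 1) ^ Suc N"
      by (simp add: log_trunc_def)
    then have "S * \<delta> (log_trunc (Suc N) S) = S * \<delta> (log_trunc N S) + S * ((1 - S) ^ N * \<delta> S)"
      by (simp only: derivation_add[OF d] step distrib_left)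
    also have "\<dots> = (1 - (1 - S) ^ Suc N) * \<delta> S"
      unfolding Suc by (simp add: algebra_simps)
    finally show ?case .
  qed
  have "S * \<delta> (series_log S) - \<delta> S = 0"
  proof (rule deg_ge_all_imp_0)
    fix N
    have "deg_ge 1 (1 - S)" using S by (simp add: deg_ge_def)
    then have "deg_ge N (\<delta> S * (1 - S) ^ N)" by (intro deg_ge_mult_left deg_ge_power)
    moreover have "deg_ge N (S * \<delta> (series_log S - log_trunc N S))"
      using loc[OF series_log_trunc[OF S, of N]] by (intro deg_ge_mult_left) (simp add: deg_ge_def)
    ultimately have "deg_ge N (S * \<delta> (series_log S - log_trunc N S) - \<delta> S * (1 - S) ^ N)"
      by (intro deg_ge_diff)
    also have "S * \<delta> (series_log S - log_trunc N S) - \<delta> S * (1 - S) ^ N = S * \<delta> (series_log S) - \<delta> S"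
      using trunc[of N] by (simp add: derivation_diff[OF d] algebra_simps)
    finally show "deg_ge N (S * \<delta> (series_log S) - \<delta> S)" .
  qed
  then show ?thesis by simp
qed

definition swap2 :: "series2 \<Rightarrow> series2" where
  "swap2 F = Abs_fps (\<lambda>b. Abs_fps (\<lambda>a. F $ a $ b))"

lemma swap2_nth [simp]: "swap2 F $ b $ a = F $ a $ b"
  by (simp add: swap2_def)

lemma swap2_hom:
  "swap2 (f + g) = swap2 f + swap2 g" "swap2 (f - g) = swap2 f - swap2 g" "swap2 1 = 1"
  "swap2 (f * g) = swap2 f * swap2 g"
proof -
  show "swap2 (f * g) = swap2 f * swap2 g"
  proof (rule fps2_ext)
    fix b a
    have "(f * g) $ a $ b = (\<Sum>i=0..b. \<Sum>j=0..a. f $ j $ i * g $ (a - j) $ (b - i))"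
      unfolding mult_nth2 by (rule sum.swap)
    then show "swap2 (f * g) $ b $ a = (swap2 f * swap2 g) $ b $ a"
      unfolding mult_nth2[of "swap2 f"] by simp
  qed
  show "swap2 1 = 1" by (rule fps2_ext) auto
qed (auto intro!: fps2_ext)

lemma swap2_power: "swap2 (f ^ n) = swap2 f ^ n"
  by (induction n) (simp_all add: swap2_hom)

lemma swap2_at: "swap2 (at_x1 f) = at_x2 f" "swap2 (at_x2 f) = at_x1 f"
  by (rule fps2_ext, simp add: at_x1_def at_x2_def)+

lemma swap2_log: "swap2 (series_log S) = series_log (swap2 S)"
proof (rule fps2_ext)
  fix b a
  have "((swap2 S - 1) ^ m) $ b $ a = ((S - 1) ^ m) $ a $ b" for m
    by (metis swap2_hom(2,3) swap2_nth swap2_power)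
  then show "swap2 (series_log S) $ b $ a = series_log (swap2 S) $ b $ a"
    by (simp add: series_log_def add.commute)
qed

lemma exact_quot_eqI: "g \<noteq> 0 \<Longrightarrow> f = g * h \<Longrightarrow> exact_quot f g = h" for f g h :: "'a::idom"
  unfolding exact_quot_def by (rule the_equality) auto

lemma x1_minus_x2_nonzero: "x1 - x2 \<noteq> 0"
proof
  assume "x1 - x2 = 0"
  then have "(x1 - x2) $ 0 $ 1 = 0" by simp
  then show False by (simp add: at_x1_def at_x2_def)
qed

text \<open>The quotient (f(x_1) - f(x_2))/(x_1 - x_2): the power x^n contributes every monomial of
  total degree n - 1 once.\<close>

definition divided_diff :: "series1 \<Rightarrow> series2" where
  "divided_diff f = Abs_fps (\<lambda>b. Abs_fps (\<lambda>a. f $ (a + b + 1)))"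

lemma divided_diff: "at_x1 f - at_x2 f = (x1 - x2) * divided_diff f"
proof (rule fps2_ext)
  fix b a
  have "at_x1 f $ b $ a = (if b = 0 then f $ a else 0)" "at_x2 f $ b $ a = (if a = 0 then f $ b else 0)"
    by (simp_all add: at_x1_def at_x2_def)
  then show "(at_x1 f - at_x2 f) $ b $ a = ((x1 - x2) * divided_diff f) $ b $ a"
    by (simp add: left_diff_distrib x1_mult_nth x2_mult_nth divided_diff_def)
qed

text \<open>The quotient (x_2 f(x_1) - x_1 f(x_2))/(x_1 - x_2) for f(0) = 0. For f = w its
  coefficients are the weights of two arcs of positive lengths joined into one.\<close>

definition cross_quot :: "series1 \<Rightarrow> series2" where
  "cross_quot f = Abs_fps (\<lambda>b. Abs_fps (\<lambda>a. if a = 0 \<or> b = 0 then 0 else f $ (a + b)))"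

lemma cross_quot:
  assumes "f $ 0 = 0"
  shows "x2 * at_x1 f - x1 * at_x2 f = (x1 - x2) * cross_quot f"
proof (rule fps2_ext)
  fix b a
  have "at_x1 f $ b $ a = (if b = 0 then f $ a else 0)" "at_x2 f $ b $ a = (if a = 0 then f $ b else 0)" for a b
    by (simp_all add: at_x1_def at_x2_def)
  then show "(x2 * at_x1 f - x1 * at_x2 f) $ b $ a = ((x1 - x2) * cross_quot f) $ b $ a"
    using assms by (cases a; cases b) (auto simp: left_diff_distrib x1_mult_nth x2_mult_nth cross_quot_def simp del: fps_mult_nth_0)
qed

context
  fixes w :: series1
  assumes tree: "tree_equation w"
begin

text \<open>The quotient (Q(w_1) - Q(w_2))/(w_1 - w_2) written out: the term z^(k-1) of Q
  contributes all products w_1^i w_2^j with i + j = k - 2. Finite ranges suffice, as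
  \<open>w ^ i\<close> has order at least \<open>i\<close>.\<close>

definition Uq :: series2 where
  "Uq = Abs_fps (\<lambda>b. Abs_fps (\<lambda>a. \<Sum>i=0..a. \<Sum>j=0..b. qvar (i + j + 2) * ((w ^ i) $ a * (w ^ j) $ b)))"

text \<open>One bound \<open>N\<close> for all coefficients makes the summation independent of the
  coefficient indices, so that multiplication by \<open>G\<close> acts termwise.\<close>

lemma Uq_mult_nth:
  assumes "a \<le> N" "b \<le> N"
  shows "(G * Uq) $ b $ a = (\<Sum>i=0..N. \<Sum>j=0..N. qvar (i + j + 2) * (G * at_x1 (w ^ i) * at_x2 (w ^ j)) $ b $ a)"
proof -
  have U: "Uq $ y $ x = (\<Sum>i=0..N. \<Sum>j=0..N. qvar (i + j + 2) * (at_x1 (w ^ i) * at_x2 (w ^ j)) $ y $ x)"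
    if "x \<le> N" "y \<le> N" for x y
  proof -
    have e: "(at_x1 (w ^ i) * at_x2 (w ^ j)) $ y $ x = (w ^ i) $ x * (w ^ j) $ y" for i j
      unfolding mult.commute[of "at_x1 (w ^ i)"] mult_at_x1_nth
      by (simp add: at_x2_def mult.commute)
    have "Uq $ y $ x = (\<Sum>i=0..x. \<Sum>j=0..N. qvar (i + j + 2) * ((w ^ i) $ x * (w ^ j) $ y))"
      unfolding Uq_def fps_nth_Abs_fps
      by (intro sum.cong refl sum.mono_neutral_left) (use that power_nth_zero[OF w0[OF tree]] in auto)
    also have "\<dots> = (\<Sum>i=0..N. \<Sum>j=0..N. qvar (i + j + 2) * ((w ^ i) $ x * (w ^ j) $ y))"
      by (rule sum.mono_neutral_left) (use that power_nth_zero[OF w0[OF tree]] in auto)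
    finally show ?thesis unfolding e .
  qed
  have "(G * Uq) $ b $ a = (\<Sum>y=0..b. \<Sum>x=0..a. \<Sum>i=0..N. \<Sum>j=0..N.
      G $ y $ x * (qvar (i + j + 2) * (at_x1 (w ^ i) * at_x2 (w ^ j)) $ (b - y) $ (a - x)))"
    unfolding mult_nth2[of G] using assms by (intro sum.cong refl) (simp add: U sum_distrib_left)
  also have "\<dots> = (\<Sum>y=0..b. \<Sum>i=0..N. \<Sum>x=0..a. \<Sum>j=0..N.
      G $ y $ x * (qvar (i + j + 2) * (at_x1 (w ^ i) * at_x2 (w ^ j)) $ (b - y) $ (a - x)))"
    by (rule sum.cong[OF refl], rule sum.swap)
  also have "\<dots> = (\<Sum>i=0..N. \<Sum>y=0..b. \<Sum>x=0..a. \<Sum>j=0..N.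
      G $ y $ x * (qvar (i + j + 2) * (at_x1 (w ^ i) * at_x2 (w ^ j)) $ (b - y) $ (a - x)))"
    by (rule sum.swap)
  also have "\<dots> = (\<Sum>i=0..N. \<Sum>y=0..b. \<Sum>j=0..N. \<Sum>x=0..a.
      G $ y $ x * (qvar (i + j + 2) * (at_x1 (w ^ i) * at_x2 (w ^ j)) $ (b - y) $ (a - x)))"
    by (rule sum.cong[OF refl], rule sum.cong[OF refl], rule sum.swap)
  also have "\<dots> = (\<Sum>i=0..N. \<Sum>j=0..N. \<Sum>y=0..b. \<Sum>x=0..a.
      G $ y $ x * (qvar (i + j + 2) * (at_x1 (w ^ i) * at_x2 (w ^ j)) $ (b - y) $ (a - x)))"
    by (rule sum.cong[OF refl], rule sum.swap)
  also have "\<dots> = (\<Sum>i=0..N. \<Sum>j=0..N. qvar (i + j + 2) * (G * at_x1 (w ^ i) * at_x2 (w ^ j)) $ b $ a)"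
    by (intro sum.cong refl) (simp only: mult.assoc mult_nth2[of G] sum_distrib_left mult.left_commute)
  finally show ?thesis .
qed

text \<open>Multiplication by w_1 or w_2 shifts \<open>i\<close> or \<open>j\<close> in the double
  sum. The two shifted sums differ only in the edges \<open>j = 0\<close> and \<open>i = 0\<close>,
  which are the two values of Q.\<close>

lemma Uq: "at_x1 (Qser oo w) - at_x2 (Qser oo w) = (at_x1 w - at_x2 w) * Uq"
proof (rule fps2_ext)
  fix b a :: nat
  define N where "N = a + b"
  define P where "P = (\<lambda>i j. (w ^ i) $ a * (w ^ j) $ b)"
  have z: "P i j = 0" if "a < i \<or> b < j" for i j
    using that power_nth_zero[OF w0[OF tree]] by (auto simp: P_def)
  have e: "(at_x1 f * at_x2 g) $ b $ a = f $ a * g $ b" for f g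
    unfolding mult.commute[of "at_x1 f"] mult_at_x1_nth by (simp add: at_x2_def mult.commute)
  have L: "(at_x1 w * Uq) $ b $ a = (\<Sum>i=0..N. \<Sum>j=0..N. qvar (i + j + 2) * P (Suc i) j)"
    by (subst Uq_mult_nth[of a N b]) (simp_all add: N_def at_x1_hom(3)[symmetric] e P_def)
  have "(at_x2 w * Uq) $ b $ a = (\<Sum>i=0..N. \<Sum>j=0..N. qvar (i + j + 2) * (at_x1 (w ^ i) * (at_x2 w * at_x2 (w ^ j))) $ b $ a)"
    by (subst Uq_mult_nth[of a N b]) (simp_all add: N_def mult.assoc mult.left_commute)
  then have R: "(at_x2 w * Uq) $ b $ a = (\<Sum>i=0..N. \<Sum>j=0..N. qvar (i + j + 2) * P i (Suc j))"
    by (simp add: at_x2_hom(3)[symmetric] e P_def)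
  define T where "T = (\<lambda>i j. qvar (i + j + 1) * P i j)"
  have zT: "T i j = 0" if "a < i \<or> b < j" for i j using z[OF that] by (simp add: T_def)
  have sh1: "(\<Sum>i=0..N. T (Suc i) j) + T 0 j = (\<Sum>i=0..N. T i j)" for j
  proof -
    have "(\<Sum>i=0..Suc N. T i j) = T 0 j + (\<Sum>i=0..N. T (Suc i) j)"
      by (simp only: sum.atLeast0_atMost_Suc_shift o_def)
    then show ?thesis using zT[of "Suc N" j] by (simp add: N_def add.commute)
  qed
  have sh2: "(\<Sum>j=0..N. T i (Suc j)) + T i 0 = (\<Sum>j=0..N. T i j)" for i
  proof -
    have "(\<Sum>j=0..Suc N. T i j) = T i 0 + (\<Sum>j=0..N. T i (Suc j))"
      by (simp only: sum.atLeast0_atMost_Suc_shift o_def)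
    then show ?thesis using zT[of i "Suc N"] by (simp add: N_def add.commute)
  qed
  have L': "(at_x1 w * Uq) $ b $ a + (\<Sum>j=0..N. T 0 j) = (\<Sum>i=0..N. \<Sum>j=0..N. T i j)"
  proof -
    have "(at_x1 w * Uq) $ b $ a = (\<Sum>j=0..N. \<Sum>i=0..N. T (Suc i) j)"
      unfolding L by (subst sum.swap) (simp add: T_def)
    then have "(at_x1 w * Uq) $ b $ a + (\<Sum>j=0..N. T 0 j) = (\<Sum>j=0..N. \<Sum>i=0..N. T i j)"
      by (simp only: sum.distrib[symmetric] sh1)
    then show ?thesis by (simp only: sum.swap[of "\<lambda>j i. T i j"])
  qed
  have R': "(at_x2 w * Uq) $ b $ a + (\<Sum>i=0..N. T i 0) = (\<Sum>i=0..N. \<Sum>j=0..N. T i j)"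
  proof -
    have "(at_x2 w * Uq) $ b $ a = (\<Sum>i=0..N. \<Sum>j=0..N. T i (Suc j))"
      unfolding R by (simp add: T_def)
    then show ?thesis by (simp only: sum.distrib[symmetric] sh2)
  qed
  \<comment> \<open>The edge sums start at exponent 0 and so carry \<open>qvar 1\<close>, whereas Q
    starts with \<open>qvar 2\<close>; the surplus is the same in both edges and cancels.\<close>
  have Q: "(Qser oo w) $ n + qvar 1 * 1 $ n = (\<Sum>i=0..N. qvar (i + 1) * (w ^ i) $ n)" if "n \<le> N" for n
  proof -
    have "(Qser oo w) $ n = (\<Sum>i=0..N. Qser $ i * (w ^ i) $ n)"
      using compose_mult_nth[OF w0[OF tree] that, of 1 Qser] by simp
    also have "\<dots> = (\<Sum>i=1..N. qvar (i + 1) * (w ^ i) $ n)"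
      unfolding Qser_def by (simp add: sum.atLeast_Suc_atMost)
    finally show ?thesis by (simp add: sum.atLeast_Suc_atMost)
  qed
  have T0: "(\<Sum>i=0..N. T i 0) = ((Qser oo w) $ a + qvar 1 * 1 $ a) * 1 $ b"
    using Q[of a] by (simp add: T_def P_def N_def sum_distrib_right mult.assoc)
  have T1: "(\<Sum>j=0..N. T 0 j) = ((Qser oo w) $ b + qvar 1 * 1 $ b) * 1 $ a"
    using Q[of b] by (simp add: T_def P_def N_def sum_distrib_left sum_distrib_right mult_ac)
  have "((at_x1 w - at_x2 w) * Uq) $ b $ a = (\<Sum>i=0..N. T i 0) - (\<Sum>j=0..N. T 0 j)"
    using L' R' by (simp add: left_diff_distrib algebra_simps)
  also have "\<dots> = (at_x1 (Qser oo w) - at_x2 (Qser oo w)) $ b $ a"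
    unfolding T0 T1 by (simp add: at_x1_def at_x2_def)
  finally show "(at_x1 (Qser oo w) - at_x2 (Qser oo w)) $ b $ a = ((at_x1 w - at_x2 w) * Uq) $ b $ a" by simp
qed

end

section \<open>The closed form solves the same differential system\<close>

section \<open>The differential equation of the closed form\<close>

lemma coeff_mult_zero:
  assumes "\<And>s. s \<le> r \<Longrightarrow> coeff p s = 0"
  shows "coeff (p * q) r = 0"
  unfolding coeff_mult by (rule sum.neutral) (use assms in auto)

context
  fixes w :: series1
  assumes tree: "tree_equation w"
begin

text \<open>Division-free form of the exact quotient: (w_1 Q_1 - w_2 Q_2)/(w_1 - w_2) = Q_1 + w_2
  (Q_1 - Q_2)/(w_1 - w_2).\<close>

definition w_quot :: series2 where
  "w_quot = at_x1 (Qser oo w) + at_x2 w * Uq w"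

definition closed_form :: series2 where
  "closed_form = series_log (divided_diff w) - u2 * w_quot"

lemma w1: "w $ 1 = 1"
proof -
  define G where "G = fps_const uvar * (Qser oo w)"
  have "w = fps_X * (exp_ser oo G)" using tree by (simp add: tree_equation_def G_def)
  then have "w $ 1 = (exp_ser oo G) $ 0" by (metis fps_X_mult_nth diff_self_eq_0 zero_neq_one)
  then show ?thesis by (simp add: exp_ser_def scalar_simps)
qed

lemma w_diff_nonzero: "at_x1 w - at_x2 w \<noteq> 0"
proof
  assume "at_x1 w - at_x2 w = 0"
  then have "(at_x1 w - at_x2 w) $ 0 $ 1 = 0" by simp
  then show False using w1 by (simp add: at_x1_def at_x2_def)
qed

lemma w_quot: "at_x1 w * at_x1 (Qser oo w) - at_x2 w * at_x2 (Qser oo w) = (at_x1 w - at_x2 w) * w_quot"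
proof -
  have "at_x1 w * at_x1 (Qser oo w) - at_x2 w * at_x2 (Qser oo w) =
      (at_x1 w - at_x2 w) * at_x1 (Qser oo w) + at_x2 w * (at_x1 (Qser oo w) - at_x2 (Qser oo w))"
    by (simp add: algebra_simps)
  also have "\<dots> = (at_x1 w - at_x2 w) * w_quot"
    unfolding Uq[OF tree] w_quot_def by (simp add: algebra_simps)
  finally show ?thesis .
qed

lemma closed_form_eq:
  "series_log (exact_quot (at_x1 w - at_x2 w) (x1 - x2)) -
     u2 * exact_quot (at_x1 w * at_x1 (Qser oo w) - at_x2 w * at_x2 (Qser oo w)) (at_x1 w - at_x2 w) = closed_form"
  unfolding closed_form_def exact_quot_eqI[OF x1_minus_x2_nonzero divided_diff]
    exact_quot_eqI[OF w_diff_nonzero w_quot] ..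

text \<open>\<open>w_quot\<close> is written asymmetrically. Numerator and denominator of the
  quotient it represents both change sign under the exchange of the variables, and cancelling w_1 -
  w_2 gives the symmetry.\<close>

lemma swap2_closed_form: "swap2 closed_form = closed_form"
proof -
  have "swap2 (divided_diff w) = divided_diff w"
    by (rule fps2_ext) (simp add: divided_diff_def add.commute)
  moreover have "swap2 w_quot = w_quot"
  proof -
    have "swap2 (at_x1 w * at_x1 (Qser oo w) - at_x2 w * at_x2 (Qser oo w)) = swap2 ((at_x1 w - at_x2 w) * w_quot)"
      by (simp only: w_quot)
    then have "at_x2 w * at_x2 (Qser oo w) - at_x1 w * at_x1 (Qser oo w) = (at_x2 w - at_x1 w) * swap2 w_quot"
      by (simp only: swap2_hom swap2_at)
    then have "(at_x1 w - at_x2 w) * swap2 w_quot = (at_x1 w - at_x2 w) * w_quot"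
      unfolding w_quot[symmetric] by (simp add: algebra_simps)
    then show ?thesis using w_diff_nonzero by simp
  qed
  moreover have "swap2 u2 = u2"
    by (rule fps2_ext) simp
  ultimately show ?thesis by (simp add: closed_form_def swap2_hom swap2_log)
qed

lemma closed_form_sym: "closed_form $ b $ a = closed_form $ a $ b"
  by (metis swap2_closed_form swap2_nth)

text \<open>Writing \<open>Q\<^sub>i\<close> for \<open>Q(w\<^sub>i)\<close>, the derivation \<open>\<partial>\<^sub>u - Q\<^sub>1 x\<^sub>1\<partial>\<^sub>1 - Q\<^sub>2 x\<^sub>2\<partial>\<^sub>2\<close> annihilates \<open>w\<^sub>1\<close> and \<open>w\<^sub>2\<close>.\<close>

lemma closed_form_pde:
  "du closed_form = at_x1 (Qser oo w) * d1 closed_form + at_x2 (Qser oo w) * d2 closed_form + cross_quot w * Uq w"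
proof -
  define Q1 Q2 w1 w2 where "Q1 = at_x1 (Qser oo w)" and "Q2 = at_x2 (Qser oo w)"
    and "w1 = at_x1 w" and "w2 = at_x2 w"
  define L where "L = (\<lambda>F. (du F - Q1 * d1 F) - Q2 * d2 F)"
  have L: "derivation L"
    unfolding L_def
    by (rule derivation_lincomb[OF derivation_lincomb[OF derivations(1,2)] derivations(3)])
  have Lx1: "L (at_x1 f) = at_x1 (map_fps pderiv f - (Qser oo w) * euler f)" for f
    by (simp add: L_def derivations_at Q1_def at_x1_hom)
  have Lx2: "L (at_x2 f) = at_x2 (map_fps pderiv f - (Qser oo w) * euler f)" for f
    by (simp add: L_def derivations_at Q2_def at_x2_hom)
  have z: "at_x1 0 = 0" "at_x2 0 = 0" by (simp_all add: at_x1_def at_x2_eq fps_eq_iff)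
  have Lw: "L w1 = 0" "L w2 = 0" unfolding w1_def w2_def Lx1 Lx2 by (simp_all add: du_w[OF tree] z)
  have LQ: "L Q1 = 0" "L Q2 = 0" unfolding Q1_def Q2_def Lx1 Lx2 by (simp_all add: du_Qw[OF tree] z)
  have dX: "map_fps pderiv fps_X = (0 :: series1)" "euler fps_X = (fps_X :: series1)"
    by (simp_all add: fps_eq_iff fps_X_def)
  have m: "at_x1 (- f) = - at_x1 f" "at_x2 (- f) = - at_x2 f" for f
    using at_x1_hom(2)[of 0 f] at_x2_hom(2)[of 0 f] by (simp_all add: z)
  have z0: "map_fps pderiv (0 :: series1) = 0" "euler (0 :: series1) = 0" by (simp_all add: fps_eq_iff)
  have LX: "L x1 = - (Q1 * x1)" "L x2 = - (Q2 * x2)"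
    unfolding Lx1 Lx2 dX Q1_def Q2_def by (simp_all add: m at_x1_hom at_x2_hom)
  have Lc: "L (fps_const (fps_const c)) = fps_const (fps_const (pderiv c))" for c
    by (simp add: L_def z0)
  have Lu: "L u2 = 1" unfolding Lc by (simp add: pderiv_uvar)
  have Lconst: "L (const2 c) = 0" for c unfolding const2_def Lc by (simp add: scalar_simps)
  have Lloc: "deg_ge N (L F)" if "deg_ge N F" for N F
  proof -
    have "deg_ge N (du F)" "deg_ge N (d1 F)" "deg_ge N (d2 F)"
      using that by (simp_all add: deg_ge_def fps_of_nat[symmetric] del: fps_of_nat)
    then show ?thesis unfolding L_def by (intro deg_ge_diff deg_ge_mult_left)
  qed
  define S where "S = divided_diff w"
  have S1: "deg_ge 1 (S - 1)" using w1 by (simp add: deg_ge_def S_def divided_diff_def)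
  have "S $ 0 $ 0 = 1" using w1 by (simp add: S_def divided_diff_def)
  then have S0: "S \<noteq> 0" by auto
  \<comment> \<open>The product is w_1 - w_2, which \<open>L\<close> annihilates; this yields the
    derivative of \<open>S\<close> from that of x_1 - x_2.\<close>
  have "L ((x1 - x2) * S) = 0"
    using Lw unfolding S_def divided_diff[symmetric] w1_def w2_def by (simp add: derivation_diff[OF L])
  then have LS: "(x1 - x2) * L S = (Q1 * x1 - Q2 * x2) * S"
    by (simp add: derivation_mult[OF L] derivation_diff[OF L] LX algebra_simps)
  have "S * L (series_log S) = L S" by (rule derivation_log[OF L Lloc Lconst S1])
  then have "S * ((x1 - x2) * L (series_log S)) = (x1 - x2) * L S"
    by (simp only: mult.left_commute[of S])
  also have "\<dots> = S * (Q1 * x1 - Q2 * x2)" unfolding LS by (rule mult.commute)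
  finally have Llog: "(x1 - x2) * L (series_log S) = Q1 * x1 - Q2 * x2" using S0 by simp
  have e: "(w1 - w2) * w_quot = w1 * Q1 - w2 * Q2"
    unfolding w1_def w2_def Q1_def Q2_def by (rule w_quot[symmetric])
  have "L ((w1 - w2) * w_quot) = 0"
    unfolding e by (simp add: derivation_diff[OF L] derivation_mult[OF L] Lw LQ)
  then have "(w1 - w2) * L w_quot = 0"
    using Lw by (simp add: derivation_mult[OF L] derivation_diff[OF L])
  then have LT: "L w_quot = 0" using w_diff_nonzero by (simp add: w1_def w2_def)
  \<comment> \<open>\<open>L\<close> sends u to 1 and annihilates \<open>w_quot\<close>, so the
    second summand contributes just \<open>- w_quot\<close>.\<close>
  have LR: "L closed_form = L (series_log S) - w_quot"
    by (simp add: closed_form_def S_def derivation_diff[OF L] derivation_mult[OF L] Lu LT)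
  have "((x1 - x2) * (w1 - w2)) * L closed_form
      = (w1 - w2) * ((x1 - x2) * L (series_log S)) - (x1 - x2) * ((w1 - w2) * w_quot)"
    unfolding LR by (simp add: algebra_simps)
  also have "\<dots> = (w1 - w2) * (Q1 * x1 - Q2 * x2) - (x1 - x2) * (w1 * Q1 - w2 * Q2)"
    unfolding Llog w1_def w2_def Q1_def Q2_def w_quot ..
  \<comment> \<open>The products of Q_i, x_i and w_i with equal indices cancel; the remainder
    factors into the numerators of the two quotients in the inhomogeneous term.\<close>
  also have "\<dots> = (Q1 - Q2) * (x2 * w1 - x1 * w2)" by (simp add: algebra_simps)
  also have "\<dots> = ((w1 - w2) * Uq w) * ((x1 - x2) * cross_quot w)"
    unfolding Q1_def Q2_def w1_def w2_def Uq[OF tree] cross_quot[of w, OF w0[OF tree]] ..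
  also have "\<dots> = ((x1 - x2) * (w1 - w2)) * (cross_quot w * Uq w)" by (simp only: mult_ac)
  finally have "L closed_form = cross_quot w * Uq w"
    using w_diff_nonzero x1_minus_x2_nonzero by (simp add: w1_def w2_def)
  then show ?thesis unfolding L_def Q1_def Q2_def by (simp add: algebra_simps)
qed

text \<open>At u = 0 one has w = x, so the divided difference is 1 and its logarithm
  vanishes.\<close>

lemma coeff_closed_form_0: "coeff (closed_form $ b $ a) 0 = 0"
proof -
  have S: "coeff ((divided_diff w - 1) $ b $ a) 0 = 0" for a b
    by (simp add: divided_diff_def coeff_w_0[OF tree])
  have pw: "coeff (((divided_diff w - 1) ^ Suc m) $ b $ a) 0 = 0" for m a b
    unfolding power_Suc mult_nth2 by (simp add: coeff_sum coeff_mult S del: fps_sub_nth)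
  have "coeff (series_log (divided_diff w) $ b $ a) 0 =
      (\<Sum>m=1..a + b. coeff (scalar ((-1) ^ (m + 1) / of_nat m) * ((divided_diff w - 1) ^ m $ b $ a)) 0)"
    by (simp only: series_log_def fps_nth_Abs_fps coeff_sum)
  also have "\<dots> = 0"
  proof (intro sum.neutral ballI)
    fix m assume "m \<in> {1..a + b}"
    then obtain m' where m: "m = Suc m'" by (cases m) auto
    show "coeff (scalar ((-1) ^ (m + 1) / of_nat m) * ((divided_diff w - 1) ^ m $ b $ a)) 0 = 0"
      using pw[of m' b a] unfolding m by (simp add: coeff_mult del: power_Suc)
  qed
  finally have "coeff (series_log (divided_diff w) $ b $ a) 0 = 0" .
  then show ?thesis by (simp add: closed_form_def coeff_mult uvar_def)
qed

text \<open>\<open>Psi2\<close> has positive exponents only, so the closed form must have the same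
  property. In the differential equation such coefficients depend only on each other: all other
  contributions are killed by the Euler operators, and \<open>cross_quot\<close> has no terms of
  this kind. The claim follows by induction on the power of u, starting from u = 0.\<close>

lemma closed_form_boundary:
  assumes "a = 0 \<or> b = 0"
  shows "closed_form $ b $ a = 0"
proof (rule poly_eqI)
  fix r
  have "coeff (closed_form $ b $ a) r = 0" if "a = 0 \<or> b = 0" for a b r
    using that
  proof (induction r arbitrary: a b rule: less_induct)
    case (less r)
    show ?case
    proof (cases r)
      case 0
      then show ?thesis by (simp add: coeff_closed_form_0)
    next
      case (Suc s)
      have IH: "coeff (closed_form $ y $ x) t = 0" if "x = 0 \<or> y = 0" "t \<le> s" for x y t
        using less.IH[of t x y] that Suc by simp
      have 1: "coeff ((at_x1 (Qser oo w) * d1 closed_form) $ b $ a) s = 0"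
      proof -
        have "coeff ((of_nat i * closed_form $ b $ i) * (Qser oo w) $ (a - i)) s = 0" if "i \<le> a" for i
        proof (cases "i = 0")
          case False
          then have "b = 0" using less.prems that by auto
          then have "coeff (closed_form $ b $ i * (of_nat i * (Qser oo w) $ (a - i))) s = 0"
            by (intro coeff_mult_zero) (use IH in auto)
          then show ?thesis by (simp only: mult_ac)
        qed simp
        then show ?thesis
          unfolding mult.commute[of "at_x1 (Qser oo w)"] mult_at_x1_nth
          by (simp add: fps_mult_nth coeff_sum)
      qed
      have 2: "coeff ((at_x2 (Qser oo w) * d2 closed_form) $ b $ a) s = 0"
      proof -
        have "coeff ((of_nat j * closed_form $ j $ a) * (Qser oo w) $ (b - j)) s = 0" if "j \<le> b" for j
        proof (cases "j = 0")
          case False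
          then have "a = 0" using less.prems that by auto
          then have "coeff (closed_form $ j $ a * (of_nat j * (Qser oo w) $ (b - j))) s = 0"
            by (intro coeff_mult_zero) (use IH in auto)
          then show ?thesis by (simp only: mult_ac)
        qed simp
        then show ?thesis
          unfolding mult.commute[of "at_x2 (Qser oo w)"] mult_at_x2_nth
          by (simp add: coeff_sum fps_of_nat[symmetric] del: fps_of_nat)
      qed
      have 3: "(cross_quot w * Uq w) $ b $ a = 0"
        unfolding mult_nth2 by (intro sum.neutral ballI) (use less.prems in \<open>auto simp: cross_quot_def\<close>)
      have "of_nat (Suc s) * coeff (closed_form $ b $ a) (Suc s) = coeff (du closed_form $ b $ a) s"
        by (simp add: coeff_pderiv)
      also have "\<dots> = 0" unfolding closed_form_pde using 1 2 3 by simp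
      finally show ?thesis using Suc by (simp del: of_nat_Suc)
    qed
  qed
  then show "coeff (closed_form $ b $ a) r = coeff 0 r" using assms by simp
qed

text \<open>The factor cancels the denominators \<open>a\<close> and \<open>b\<close> in
  \<open>Psi2\<close>, so this is to become the exponential series in u for the factorizations of
  one fixed permutation.\<close>

definition cycle_pair_series :: "nat \<Rightarrow> nat \<Rightarrow> coeff_ring" where
  "cycle_pair_series a b = of_nat a * of_nat b * closed_form $ b $ a"

text \<open>Exponent \<open>m\<close> in Q belongs to \<open>qvar (m + 1)\<close>; indexing by the
  cycle length \<open>k\<close> shifts the power of w to \<open>k - 1\<close>.\<close>

lemma mult_Qser_compose_nth:
  assumes "\<Phi> $ 0 = 0"
  shows "(\<Phi> * (Qser oo w)) $ n = (\<Sum>k=2..n. qvar k * (\<Phi> * w ^ (k - 1)) $ n)"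
proof (cases n)
  case 0
  then show ?thesis using assms by simp
next
  case (Suc m)
  \<comment> \<open>\<open>\<Phi>\<close> has order at least 1 and \<open>w ^ n\<close> order at
    least \<open>n\<close>, so the last term drops out and \<open>k\<close> stops at
    \<open>n\<close>.\<close>
  have last: "(\<Phi> * w ^ n) $ n = 0"
    unfolding fps_mult_nth
  proof (intro sum.neutral ballI)
    fix i assume "i \<in> {0..n}"
    then show "\<Phi> $ i * (w ^ n) $ (n - i) = 0"
      using assms power_nth_zero[OF w0[OF tree], of "n - i" n] by (cases "i = 0") auto
  qed
  have "(\<Phi> * (Qser oo w)) $ n = (\<Sum>i=0..n. Qser $ i * (\<Phi> * w ^ i) $ n)"
    by (rule compose_mult_nth[OF w0[OF tree]]) simp
  also have "\<dots> = (\<Sum>i=0..m. Qser $ i * (\<Phi> * w ^ i) $ n)" using last Suc by simp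
  also have "\<dots> = (\<Sum>i=1..m. qvar (Suc i) * (\<Phi> * w ^ (Suc i - 1)) $ n)"
    unfolding Qser_def by (simp add: sum.atLeast_Suc_atMost)
  also have "\<dots> = (\<Sum>k=Suc 1..Suc m. qvar k * (\<Phi> * w ^ (k - 1)) $ n)"
    by (rule sum.shift_bounds_cl_Suc_ivl[symmetric])
  finally show ?thesis by (simp add: Suc numeral_2_eq_2)
qed

lemma w_ode: "pderiv (w $ n) = (\<Sum>k=2..n. qvar k * (euler w * w ^ (k - 1)) $ n)"
proof -
  have "pderiv (w $ n) = map_fps pderiv w $ n" by simp
  also have "\<dots> = (euler w * (Qser oo w)) $ n" by (simp only: du_w[OF tree] mult.commute)
  finally show ?thesis by (simp add: mult_Qser_compose_nth)
qed

text \<open>This is D(w^k) = k w^(k-1) Dw, the property demanded of \<open>Y\<close> in the block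
  equations.\<close>

lemma euler_w_power: "of_nat k * (euler w * w ^ (k - 1)) $ n = of_nat n * (w ^ k) $ n"
proof (cases k)
  case 0
  then show ?thesis by simp
next
  case (Suc j)
  have "of_nat n * (w ^ k) $ n = euler (w ^ Suc j) $ n" using Suc by simp
  also have "\<dots> = (fps_const (of_nat (Suc j)) * (euler w * w ^ j)) $ n"
    unfolding derivation_power[OF derivation_euler] fps_of_nat by (simp only: mult_ac)
  also have "\<dots> = of_nat k * (euler w * w ^ (k - 1)) $ n"
    unfolding fps_mult_left_const_nth Suc by simp
  finally show ?thesis by simp
qed

text \<open>The powers of w belong to the arcs other than the rooted ones, so exponents
  \<open>i\<close> and \<open>j\<close> mean \<open>Suc i\<close> and \<open>Suc j\<close>
  arcs.\<close>

lemma glued_coeff_eq: "(cross_quot w * at_x1 (w ^ i) * at_x2 (w ^ j)) $ b $ a = glued_coeff w a b (Suc i) (Suc j)"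
proof -
  have "cross_quot w $ y * w ^ i = (if y = 0 then 0 else Abs_fps (\<lambda>g. if g = 0 then 0 else w $ (g + y)) * w ^ i)" for y
  proof -
    have "cross_quot w $ y = (if y = 0 then 0 else Abs_fps (\<lambda>g. if g = 0 then 0 else w $ (g + y)))"
      by (rule fps_ext) (simp add: cross_quot_def)
    then show ?thesis by simp
  qed
  then have "(cross_quot w $ y * w ^ i) $ a =
      (if y = 0 then 0 else (Abs_fps (\<lambda>g. if g = 0 then 0 else w $ (g + y)) * w ^ i) $ a)" for y
    by simp
  moreover have "glued_coeff w a b (Suc i) (Suc j) = (\<Sum>y=0..b.
      (if y = 0 then 0 else (Abs_fps (\<lambda>g. if g = 0 then 0 else w $ (g + y)) * w ^ i) $ a) * (w ^ j) $ (b - y))"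
    unfolding glued_coeff_def diff_Suc_1 by (rule trans[OF fps_mult_nth]) (simp only: fps_nth_Abs_fps)
  ultimately show ?thesis by (simp only: mult_at_x2_nth mult_at_x1_nth)
qed

lemma glued_coeff_zero:
  assumes "a \<le> i \<or> b \<le> j"
  shows "glued_coeff w a b (Suc i) (Suc j) = 0"
proof -
  have z: "(\<Phi> * w ^ i) $ n = 0" if "n \<le> i" "\<Phi> $ 0 = 0" for \<Phi> n i
    unfolding fps_mult_nth
  proof (intro sum.neutral ballI)
    fix l assume "l \<in> {0..n}"
    then show "\<Phi> $ l * (w ^ i) $ (n - l) = 0"
      using that power_nth_zero[OF w0[OF tree], of "n - l" i] by (cases "l = 0") auto
  qed
  show ?thesis
  proof (cases "b \<le> j")
    case True
    then show ?thesis unfolding glued_coeff_def diff_Suc_1 by (rule z) simp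
  next
    case False
    then have "a \<le> i" using assms by simp
    then have "(Abs_fps (\<lambda>g. if g = 0 then 0 else w $ (g + g')) * w ^ i) $ a = 0" for g' by (rule z) simp
    then show ?thesis
      unfolding glued_coeff_def diff_Suc_1
      by (intro trans[OF fps_mult_nth]) (simp only: fps_nth_Abs_fps if_cancel mult_zero_left sum.neutral_const)
  qed
qed

lemma cross_quot_Uq_nth:
  "(cross_quot w * Uq w) $ b $ a = (\<Sum>i=1..a. \<Sum>j=1..b. qvar (i + j) * glued_coeff w a b i j)"
proof -
  define N where "N = a + b"
  define f where "f = (\<lambda>i j. qvar (Suc i + Suc j) * glued_coeff w a b (Suc i) (Suc j))"
  have z: "f i j = 0" if "a \<le> i \<or> b \<le> j" for i j
    using glued_coeff_zero[OF that] by (simp add: f_def)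
  have "(cross_quot w * Uq w) $ b $ a = (\<Sum>i=0..N. \<Sum>j=0..N. f i j)"
    by (subst Uq_mult_nth[OF tree, of a N b]) (simp_all add: N_def f_def glued_coeff_eq)
  also have "\<dots> = (\<Sum>i<a. \<Sum>j=0..N. f i j)"
    by (rule sum.mono_neutral_right) (use z in \<open>auto simp: N_def\<close>)
  also have "\<dots> = (\<Sum>i<a. \<Sum>j<b. f i j)"
    by (intro sum.cong refl sum.mono_neutral_right) (use z in \<open>auto simp: N_def\<close>)
  finally show ?thesis by (simp only: f_def sum.atLeast1_atMost_eq One_nat_def)
qed

text \<open>Of the factor \<open>a b\<close>, one half merges with the Euler operator into
  \<open>cycle_pair_series\<close> inside the convolution, and the other stays outside as the number
  of possible roots. The second sum also uses the symmetry of the closed form.\<close>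

lemma cycle_pair_series_ode:
  "pderiv (cycle_pair_series a b) =
      of_nat a * (\<Sum>k=2..a. qvar k * (Abs_fps (\<lambda>g. cycle_pair_series g b) * w ^ (k - 1)) $ a)
    + of_nat b * (\<Sum>k=2..b. qvar k * (Abs_fps (\<lambda>g. cycle_pair_series g a) * w ^ (k - 1)) $ b)
    + of_nat a * of_nat b * (\<Sum>i=1..a. \<Sum>j=1..b. qvar (i + j) * glued_coeff w a b i j)"
proof -
  have z: "Abs_fps (\<lambda>g. cycle_pair_series g c) $ 0 = 0" for c by (simp add: cycle_pair_series_def)
  have 1: "of_nat b * (at_x1 (Qser oo w) * d1 closed_form) $ b $ a
      = (Abs_fps (\<lambda>g. cycle_pair_series g b) * (Qser oo w)) $ a"
    unfolding mult.commute[of "at_x1 (Qser oo w)"] mult_at_x1_nth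
    by (simp add: fps_mult_nth sum_distrib_left cycle_pair_series_def mult_ac)
  have 2: "cycle_pair_series j a = of_nat a * (of_nat j * closed_form $ j $ a)" for j
    unfolding cycle_pair_series_def closed_form_sym[of a j] by (simp only: mult_ac)
  have d2n: "d2 closed_form $ j $ a = of_nat j * closed_form $ j $ a" for j
    by (simp add: fps_of_nat[symmetric] del: fps_of_nat)
  have "of_nat a * (at_x2 (Qser oo w) * d2 closed_form) $ b $ a
      = (\<Sum>j=0..b. of_nat a * (of_nat j * closed_form $ j $ a) * (Qser oo w) $ (b - j))"
    by (simp only: mult.commute[of "at_x2 (Qser oo w)"] mult_at_x2_nth d2n sum_distrib_left mult.assoc)
  also have "\<dots> = (Abs_fps (\<lambda>g. cycle_pair_series g a) * (Qser oo w)) $ b"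
    by (rule sym, rule trans[OF fps_mult_nth]) (simp only: fps_nth_Abs_fps 2)
  finally have 2: "of_nat a * (at_x2 (Qser oo w) * d2 closed_form) $ b $ a
      = (Abs_fps (\<lambda>g. cycle_pair_series g a) * (Qser oo w)) $ b" .
  have "pderiv (cycle_pair_series a b) = of_nat a * of_nat b * (du closed_form $ b $ a)"
    unfolding cycle_pair_series_def by (simp add: pderiv_mult pderiv_of_nat)
  also have "\<dots> = of_nat a * (of_nat b * (at_x1 (Qser oo w) * d1 closed_form) $ b $ a)
      + of_nat b * (of_nat a * (at_x2 (Qser oo w) * d2 closed_form) $ b $ a)
      + of_nat a * of_nat b * (cross_quot w * Uq w) $ b $ a"
    unfolding closed_form_pde by (simp add: algebra_simps)
  finally show ?thesis
    unfolding 1 2 mult_Qser_compose_nth[OF z] cross_quot_Uq_nth .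
qed

end

section \<open>Translation between cycle factorizations and tight lists of cycles\<close>

section \<open>Cycle factorizations as lists of cycles\<close>

lemma product_foldr: "product F = foldr (\<circ>) F id"
  by (induction F) simp_all

lemma cycle_type_orbits:
  fixes n :: nat
  shows "set_mset (mset_set (orbit \<sigma> ` {1..n})) = orbit \<sigma> ` {1..n}"
  by simp

lemma num_cycles_eq: "num_cycles n \<sigma> = card (orbit \<sigma> ` {1..n})"
  by (simp add: num_cycles_def cycle_type_def)

lemma is_cycle_imp_cycle_type:
  assumes "is_cycle {1..n} \<sigma>"
  shows "cycle_type n \<sigma> = add_mset (card (moved \<sigma>)) (replicate_mset (n - card (moved \<sigma>)) 1)"
proof -
  note f = is_cycle_facts[OF assms]
  let ?A = "moved \<sigma>" and ?R = "(\<lambda>x. {x}) ` ({1..n} - moved \<sigma>)"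
  obtain x where x: "x \<in> ?A" using f(4) by auto
  have "orbit \<sigma> ` {1..n} = insert ?A ?R"
  proof -
    have "{1..n} = ?A \<union> ({1..n} - ?A)" using f(1) by auto
    then have "orbit \<sigma> ` {1..n} = orbit \<sigma> ` ?A \<union> orbit \<sigma> ` ({1..n} - ?A)" by (metis image_Un)
    moreover have "orbit \<sigma> ` ?A = {?A}" using orbit_cyclic_eq3[OF f(3)] x by (auto simp: image_def)
    moreover have "orbit \<sigma> ` ({1..n} - ?A) = ?R"
      by (rule image_cong) (auto simp: orbit_eq_singleton_iff moved_def)
    ultimately show ?thesis by simp
  qed
  moreover have "?A \<notin> ?R" by auto
  moreover have "image_mset card (mset_set ?R) = replicate_mset (n - card ?A) 1"
  proof -
    have "image_mset card (mset_set ?R) = image_mset (\<lambda>_. 1) (mset_set ?R)"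
      by (rule image_mset_cong) auto
    also have "\<dots> = replicate_mset (card ?R) 1" by (simp add: image_mset_const_eq)
    also have "card ?R = n - card ?A"
      using f(1,5) by (simp add: card_image card_Diff_subset)
    finally show ?thesis .
  qed
  ultimately show ?thesis by (simp add: cycle_type_def)
qed

text \<open>One orbit of size \<open>k \<ge> 2\<close> and otherwise orbits of size 1: the large
  orbit is then exactly the set of moved points.\<close>

lemma is_k_cycle_iff:
  assumes k: "2 \<le> k"
  shows "is_k_cycle n k \<sigma> \<longleftrightarrow> is_cycle {1..n} \<sigma> \<and> card (moved \<sigma>) = k"
proof
  assume "is_cycle {1..n} \<sigma> \<and> card (moved \<sigma>) = k"
  then show "is_k_cycle n k \<sigma>"
    using is_cycle_imp_cycle_type[of n \<sigma>] is_cycle_facts(6) by (auto simp: is_k_cycle_def)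
next
  assume "is_k_cycle n k \<sigma>"
  then have \<sigma>: "\<sigma> permutes {1..n}"
    and ct: "image_mset card (mset_set (orbit \<sigma> ` {1..n})) = add_mset k (replicate_mset (n - k) 1)"
    by (simp_all add: is_k_cycle_def cycle_type_def)
  have p: "permutation \<sigma>" using \<sigma> permutation_permutes by auto
  obtain M X where M: "mset_set (orbit \<sigma> ` {1..n}) = add_mset X M" and X: "card X = k"
    and rest: "image_mset card M = replicate_mset (n - k) 1"
    using msed_map_invR[OF ct] by auto
  have XO: "X \<in> orbit \<sigma> ` {1..n}"
    using arg_cong[OF M, of set_mset] by (simp add: cycle_type_orbits)
  then obtain x0 where x0: "x0 \<in> {1..n}" "X = orbit \<sigma> x0" by auto
  have one: "card Y = 1" if "Y \<in> orbit \<sigma> ` {1..n}" "Y \<noteq> X" for Y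
  proof -
    have "Y \<in># mset_set (orbit \<sigma> ` {1..n})" using that(1) by simp
    then have "Y \<in># add_mset X M" by (simp only: M)
    then have "Y \<in># M" using that(2) by simp
    then have "card Y \<in># image_mset card M" by auto
    then show ?thesis unfolding rest by (simp split: if_splits)
  qed
  have self: "x \<in> orbit \<sigma> x" for x by (rule permutation_self_in_orbit[OF p])
  have mv: "moved \<sigma> = X"
  proof (intro equalityI subsetI)
    fix x assume x: "x \<in> moved \<sigma>"
    then have xn: "x \<in> {1..n}" using permutes_not_in[OF \<sigma>] by (auto simp: moved_def)
    have "orbit \<sigma> x = X"
    proof (rule ccontr)
      assume "orbit \<sigma> x \<noteq> X"
      then have "card (orbit \<sigma> x) = 1" using one xn by simp
      then obtain y where "orbit \<sigma> x = {y}" by (rule card_1_singletonE)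
      then have "orbit \<sigma> x = {x}" using self[of x] by auto
      then show False using x by (simp add: orbit_eq_singleton_iff moved_def)
    qed
    then show "x \<in> X" using self by auto
  next
    fix x assume "x \<in> X"
    then have "orbit \<sigma> x = X" using x0 in_orbit_iff[OF p] by simp
    then have "orbit \<sigma> x \<noteq> {x}" using X k by auto
    then show "x \<in> moved \<sigma>" by (simp add: orbit_eq_singleton_iff moved_def)
  qed
  have "X \<subseteq> {1..n}" unfolding x0(2) by (rule permutes_orbit_subset[OF \<sigma> x0(1)])
  moreover have "\<sigma> permutes moved \<sigma>"
    by (rule permutes_superset[OF \<sigma>]) (simp add: moved_def)
  moreover have "cyclic_on \<sigma> X" unfolding x0(2) by (rule cyclic_on_orbit'[OF p])
  ultimately show "is_cycle {1..n} \<sigma> \<and> card (moved \<sigma>) = k"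
    by (simp add: is_cycle_def mv X)
qed

lemma is_cycle_iff: "is_cycle {1..n} \<sigma> \<longleftrightarrow> (\<exists>k\<ge>2. is_k_cycle n k \<sigma>)"
  using is_k_cycle_iff card_moved by metis

lemma num_cycles_cycle:
  assumes "is_cycle {1..n} \<sigma>"
  shows "int n - int (num_cycles n \<sigma>) = int (card (moved \<sigma>)) - 1"
proof -
  have "card (moved \<sigma>) \<le> n"
    using card_mono[OF _ is_cycle_facts(1)[OF assms]] by simp
  then show ?thesis using is_cycle_imp_cycle_type[OF assms] by (simp add: num_cycles_def)
qed

lemma blocks_factor_closed:
  assumes "\<forall>\<sigma>\<in>set F. is_cycle S \<sigma>" "B \<in> blocks S F" "x \<in> B" "\<sigma> \<in> set F"
  shows "\<sigma> x \<in> B"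
  using assms
proof (induction F arbitrary: B x)
  case (Cons \<tau> F)
  have cyc: "\<forall>\<sigma>\<in>set F. is_cycle S \<sigma>" and t: "is_cycle S \<tau>" using Cons.prems by auto
  have U: "moved \<tau> \<subseteq> \<Union>(blocks S F)"
    using is_cycle_facts(1)[OF t] partition_onD1[OF blocks_partition[OF cyc]] by simp
  have B: "B \<in> merge (blocks S F) (moved \<tau>)" using Cons.prems by simp
  show ?case
  proof (cases "\<sigma> = \<tau>")
    case True
    then show ?thesis
      using merge_closed(2)[of "blocks S F" "product F", OF blocks_closed[OF cyc] is_cycle_facts(2)[OF t] U B Cons.prems(3)]
      by simp
  next
    case False
    then have "\<sigma> \<in> set F" using Cons.prems by simp
    then have "\<sigma> y \<in> X" if "X \<in> blocks S F" "y \<in> X" for X y using Cons.IH[OF cyc that] by simp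
    then show ?thesis
      using merge_closed(1)[of "blocks S F" \<sigma>, OF _ is_cycle_facts(2)[OF t] U B Cons.prems(3)] by simp
  qed
qed simp

lemma generate_preserves_blocks:
  assumes F: "\<forall>\<sigma>\<in>set F. is_cycle {1..n} \<sigma>" and B: "B \<in> blocks {1..n} F"
    and g: "g \<in> generate (sym_group n) (set F)" and x: "x \<in> B"
  shows "g x \<in> B"
  using g x
proof (induction arbitrary: x)
  case one
  then show ?case by (simp add: sym_group_one)
next
  case (incl h)
  then show ?case using blocks_factor_closed[OF F B] by simp
next
  case (inv h)
  have h: "h permutes {1..n}" using F inv is_cycle_facts(6) by blast
  then have carr: "h \<in> carrier (sym_group n)" by (simp add: sym_group_carrier)
  have "B \<subseteq> {1..n}" using B partition_onD1[OF blocks_partition[OF F]] by auto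
  then have fB: "finite B" using finite_subset by auto
  \<comment> \<open>An injective map of the finite block into itself is onto, so closure under a
    factor implies closure under its inverse.\<close>
  have "h ` B \<subseteq> B" using blocks_factor_closed[OF F B] inv by auto
  then have "h ` B = B" using endo_inj_surj[OF fB] permutes_inj_on[OF h] by blast
  then obtain y where y: "y \<in> B" "x = h y" using inv by blast
  then have "pinv h x = y" using permutes_inverses(2)[OF h] by simp
  then show ?case using y sym_group_inv_equality[OF carr] by simp
next
  case (eng h1 h2)
  then show ?case by (simp add: sym_group_mult)
qed

text \<open>Points of a merged block are connected through the support of the new factor: from
  \<open>x\<close> inside its old block to the support, then along the cycle by a power of
  \<open>\<sigma>\<close>, then inside an old block to \<open>y\<close>.\<close>

lemma generate_connects_blocks:
  assumes "\<forall>\<sigma>\<in>set F. is_cycle {1..n} \<sigma>" "B \<in> blocks {1..n} F" "x \<in> B" "y \<in> B"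
  shows "\<exists>g\<in>generate (sym_group n) (set F). g x = y"
  using assms
proof (induction F arbitrary: B x y)
  case Nil
  then show ?case using generate.one[of "sym_group n"] by (auto simp: sym_group_one intro!: bexI[of _ id])
next
  case (Cons \<sigma> F)
  interpret G: group "sym_group n" by (rule sym_group_is_group)
  let ?G = "generate (sym_group n) (set (\<sigma> # F))"
  have cyc: "\<forall>\<sigma>\<in>set F. is_cycle {1..n} \<sigma>" and s: "is_cycle {1..n} \<sigma>" using Cons.prems by auto
  have sub: "generate (sym_group n) (set F) \<subseteq> ?G" by (rule G.mono_generate) auto
  have old: "\<exists>g\<in>?G. g u = v" if "X \<in> blocks {1..n} F" "u \<in> X" "v \<in> X" for X u v
    using Cons.IH[OF cyc that] sub by blast
  have comp: "g \<circ> h \<in> ?G" if "g \<in> ?G" "h \<in> ?G" for g h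
    using generate.eng[OF that] by (simp add: sym_group_mult)
  show ?case
  proof (cases "B \<in> blocks {1..n} F")
    case True
    then show ?thesis using old Cons.prems by blast
  next
    case False
    then have B: "B = \<Union>{X \<in> blocks {1..n} F. X \<inter> moved \<sigma> \<noteq> {}}" using Cons.prems by (auto simp: merge_def)
    obtain X a where X: "X \<in> blocks {1..n} F" "x \<in> X" "a \<in> X" "a \<in> moved \<sigma>" using B Cons.prems by blast
    obtain Y b where Y: "Y \<in> blocks {1..n} F" "y \<in> Y" "b \<in> Y" "b \<in> moved \<sigma>" using B Cons.prems by blast
    obtain g1 where g1: "g1 \<in> ?G" "g1 x = a" using old[OF X(1-3)] by blast
    obtain g3 where g3: "g3 \<in> ?G" "g3 b = y" using old[OF Y(1,3,2)] by blast
    have "b \<in> orbit \<sigma> a" using orbit_cyclic_eq3[OF is_cycle_facts(3)[OF s] X(4)] Y(4) by simp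
    then obtain m where m: "b = (\<sigma> ^^ m) a" by (auto simp: orbit_altdef)
    have pw: "\<sigma> ^^ m \<in> ?G" for m
    proof (induction m)
      case 0
      show ?case
        using generate.one[of "sym_group n" "set (\<sigma> # F)"] unfolding funpow.simps(1) sym_group_one .
    next
      case (Suc m)
      have "\<sigma> \<in> ?G" by (rule generate.incl) simp
      then show ?case using comp[OF _ Suc] by (simp only: funpow.simps(2))
    qed
    have "(g3 \<circ> ((\<sigma> ^^ m) \<circ> g1)) x = y" using g1(2) g3(2) m by simp
    then show ?thesis using comp[OF g3(1) comp[OF pw g1(1)]] by blast
  qed
qed

text \<open>Blocks are closed under the group and the group is transitive on each of them. For
  \<open>n = 0\<close> there would be no block at all, hence the positivity.\<close>

lemma transitive_iff_blocks:
  assumes F: "\<forall>\<sigma>\<in>set F. is_cycle {1..n} \<sigma>" and n: "0 < n"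
  shows "(\<forall>a\<in>{1..n}. \<forall>b\<in>{1..n}. \<exists>g\<in>generate (sym_group n) (set F). g a = b) \<longleftrightarrow> blocks {1..n} F = {{1..n}}"
proof
  assume "blocks {1..n} F = {{1..n}}"
  then show "\<forall>a\<in>{1..n}. \<forall>b\<in>{1..n}. \<exists>g\<in>generate (sym_group n) (set F). g a = b"
    using generate_connects_blocks[OF F, of "{1..n}"] by simp
next
  note P = blocks_partition[OF F]
  assume tr: "\<forall>a\<in>{1..n}. \<forall>b\<in>{1..n}. \<exists>g\<in>generate (sym_group n) (set F). g a = b"
  have all: "B = {1..n}" if B: "B \<in> blocks {1..n} F" for B
  proof
    show "B \<subseteq> {1..n}" using B partition_onD1[OF P] by auto
    have "B \<noteq> {}" using B partition_onD3[OF P] by metis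
    then obtain x where x: "x \<in> B" by blast
    show "{1..n} \<subseteq> B"
    proof
      fix y assume y: "y \<in> {1..n}"
      have "x \<in> {1..n}" using \<open>B \<subseteq> {1..n}\<close> x by auto
      then obtain g where "g \<in> generate (sym_group n) (set F)" "g x = y" using tr y by blast
      then show "y \<in> B" using generate_preserves_blocks[OF F B _ x] by blast
    qed
  qed
  have "\<Union>(blocks {1..n} F) = {1..n}" using partition_onD1[OF P] by simp
  then have "blocks {1..n} F \<noteq> {}" using n by auto
  then show "blocks {1..n} F = {{1..n}}" using all by blast
qed

text \<open>For a single block the quantity \<open>d\<close> of \<open>deficiency\<close> is the
  difference of the two sides of the minimality equation, since \<open>n\<close> minus the number of
  cycles of a k-cycle is k - 1.\<close>

lemma cycle_factorization_iff_facs: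
  assumes n: "0 < n"
  shows "cycle_factorization n \<pi> F \<longleftrightarrow> F \<in> facs {1..n} (length F) {{1..n}} \<pi>"
proof (cases "\<forall>\<sigma>\<in>set F. is_cycle {1..n} \<sigma>")
  case True
  have perm: "\<forall>\<sigma>\<in>set F. \<sigma> permutes {1..n}" using True is_cycle_facts(6) by blast
  have "int n * int (length F) - (\<Sum>\<sigma>\<leftarrow>F. int (num_cycles n \<sigma>)) = (\<Sum>\<sigma>\<leftarrow>F. int n - int (num_cycles n \<sigma>))"
    by (simp add: sum_list_subtractf sum_list_triv)
  also have "\<dots> = (\<Sum>\<sigma>\<leftarrow>F. int (card (moved \<sigma>)) - 1)"
    by (intro arg_cong[where f = sum_list] map_cong refl num_cycles_cycle) (use True in auto)
  finally have rh: "int n * int (length F) - (\<Sum>\<sigma>\<leftarrow>F. int (num_cycles n \<sigma>)) = (\<Sum>\<sigma>\<leftarrow>F. int (card (moved \<sigma>)) - 1)" .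
  have tight: "tight {1..n} F \<longleftrightarrow> (\<Sum>\<sigma>\<leftarrow>F. int (card (moved \<sigma>)) - 1) = int n + int (num_cycles n \<pi>) - 2"
    if "blocks {1..n} F = {{1..n}}" "product F = \<pi>"
    using deficiency[OF True] that by (auto simp: num_cycles_eq)
  show ?thesis
    unfolding cycle_factorization_def minimal_transitive_def transitive_factorization_def rh
      transitive_iff_blocks[OF True n] facs_def mem_Collect_eq is_cycle_iff[symmetric] product_foldr[symmetric]
    using True perm tight by auto
next
  case False
  then show ?thesis
    unfolding cycle_factorization_def facs_def mem_Collect_eq is_cycle_iff[symmetric] by blast
qed

definition index_of :: "('a \<Rightarrow> 'a) list \<Rightarrow> nat \<Rightarrow>\<^sub>0 nat" where
  "index_of F = (\<Sum>\<sigma>\<leftarrow>F. Poly_Mapping.single (card (moved \<sigma>)) 1)"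

lemma lookup_index_of:
  "Poly_Mapping.lookup (index_of F) k = length (filter (\<lambda>\<sigma>. card (moved \<sigma>) = k) F)"
  by (induction F) (auto simp: index_of_def lookup_add lookup_single)

lemma num_factors_eq_sum:
  assumes "finite A" "Poly_Mapping.keys i \<subseteq> A"
  shows "num_factors i = (\<Sum>k\<in>A. Poly_Mapping.lookup i k)"
  unfolding num_factors_def by (rule sum.mono_neutral_left) (use assms in \<open>auto simp: in_keys_iff\<close>)

lemma num_factors_add: "num_factors (i + j) = num_factors i + num_factors j"
proof -
  let ?A = "Poly_Mapping.keys i \<union> Poly_Mapping.keys j"
  have "num_factors (i + j) = (\<Sum>k\<in>?A. Poly_Mapping.lookup (i + j) k)"
    by (rule num_factors_eq_sum) (use Poly_Mapping.keys_add[of i j] in auto)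
  also have "\<dots> = num_factors i + num_factors j"
    by (simp add: lookup_add sum.distrib num_factors_eq_sum[of ?A])
  finally show ?thesis .
qed

lemma num_factors_index_of: "num_factors (index_of F) = length F"
proof (induction F)
  case (Cons \<sigma> F)
  have "num_factors (Poly_Mapping.single k 1) = 1" for k :: nat
    by (simp add: num_factors_def)
  then show ?case using Cons by (simp add: index_of_def num_factors_add)
qed (simp add: index_of_def num_factors_def)

text \<open>The cycle index determines the number of factors, and it vanishes below 2, so the
  conditions for all \<open>k \<ge> 2\<close> amount to one equation between indices.\<close>

lemma cycle_factorizations_of_eq:
  assumes n: "0 < n" and i: "is_cycle_index i"
  shows "cycle_factorizations_of n \<pi> i = {F \<in> facs {1..n} (num_factors i) {{1..n}} \<pi>. index_of F = i}"
proof (intro equalityI subsetI)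
  have cnt: "length (filter (is_k_cycle n k) F) = Poly_Mapping.lookup (index_of F) k"
    if "\<forall>\<sigma>\<in>set F. is_cycle {1..n} \<sigma>" "2 \<le> k" for F k
  proof -
    have "filter (is_k_cycle n k) F = filter (\<lambda>\<sigma>. card (moved \<sigma>) = k) F"
      by (rule filter_cong) (use that is_k_cycle_iff in auto)
    then show ?thesis by (simp add: lookup_index_of)
  qed
  have small: "Poly_Mapping.lookup (index_of F) k = 0"
    if "\<forall>\<sigma>\<in>set F. is_cycle {1..n} \<sigma>" "k < 2" for F k
    using that card_moved by (fastforce simp: lookup_index_of filter_empty_conv)
  have small_i: "Poly_Mapping.lookup i k = 0" if "k < 2" for k
    using i that by (force simp: is_cycle_index_def in_keys_iff)
  {
    fix F assume F: "F \<in> cycle_factorizations_of n \<pi> i"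
    then have cf: "F \<in> facs {1..n} (length F) {{1..n}} \<pi>"
      by (simp add: cycle_factorizations_of_def cycle_factorization_iff_facs[OF n])
    then have cyc: "\<forall>\<sigma>\<in>set F. is_cycle {1..n} \<sigma>" by (simp add: facs_def)
    have "index_of F = i"
    proof (rule poly_mapping_eqI)
      fix k show "Poly_Mapping.lookup (index_of F) k = Poly_Mapping.lookup i k"
        using F cnt[OF cyc, of k] small[OF cyc, of k] small_i[of k]
        by (cases "k < 2") (auto simp: cycle_factorizations_of_def)
    qed
    then show "F \<in> {F \<in> facs {1..n} (num_factors i) {{1..n}} \<pi>. index_of F = i}"
      using cf num_factors_index_of[of F] by auto
  }
  fix F assume F: "F \<in> {F \<in> facs {1..n} (num_factors i) {{1..n}} \<pi>. index_of F = i}"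
  then have cf: "F \<in> facs {1..n} (length F) {{1..n}} \<pi>" by (simp add: facs_def)
  then have cyc: "\<forall>\<sigma>\<in>set F. is_cycle {1..n} \<sigma>" by (simp add: facs_def)
  show "F \<in> cycle_factorizations_of n \<pi> i"
    using cf F cnt[OF cyc] by (auto simp: cycle_factorizations_of_def cycle_factorization_iff_facs[OF n])
qed

lemma index_of_is_cycle_index:
  assumes "F \<in> facs S r P \<pi>"
  shows "is_cycle_index (index_of F)" "num_factors (index_of F) = r"
proof -
  have cyc: "\<forall>\<sigma>\<in>set F. is_cycle S \<sigma>" using assms by (simp add: facs_def)
  have "2 \<le> k" if "k \<in> Poly_Mapping.keys (index_of F)" for k
  proof -
    have "filter (\<lambda>\<sigma>. card (moved \<sigma>) = k) F \<noteq> []"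
      using that by (auto simp: in_keys_iff lookup_index_of)
    then obtain \<sigma> where "\<sigma> \<in> set F" "card (moved \<sigma>) = k" by (auto simp: filter_empty_conv)
    then show ?thesis using cyc card_moved by metis
  qed
  then show "is_cycle_index (index_of F)" by (auto simp: is_cycle_index_def)
  show "num_factors (index_of F) = r" using assms by (simp add: facs_def num_factors_index_of)
qed

text \<open>With the variable q_k as the weight of a k-cycle, a factorization has the monomial of
  its cycle index as weight; sums of weights thus collect the numbers \<open>H\<close>.\<close>

lemma wt_eq_single:
  "wt (\<lambda>k. Poly_Mapping.single (Poly_Mapping.single k 1) (1 :: rat)) F = Poly_Mapping.single (index_of F) 1"
  by (induction F) (simp_all add: wt_def index_of_def mult_single single_one)

text \<open>Ensures that the choice in \<open>H\<close> denotes a permutation of the intended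
  type.\<close>

lemma exists_cycle_type_pair:
  assumes "1 \<le> a" "1 \<le> b"
  shows "\<exists>\<pi>. \<pi> permutes {1..a + b} \<and> cycle_type (a + b) \<pi> = {#a, b#}"
proof -
  \<comment> \<open>The product of the cycles on 1, ..., a and on a + 1, ..., a + b; for
    \<open>a = 1\<close> or \<open>b = 1\<close> the order of the clauses yields a fixed
    point.\<close>
  define \<pi> where "\<pi> = (\<lambda>x. if x = a then 1 else if x = a + b then a + 1 else if x \<in> {1..a + b} then x + 1 else x)"
  have inj: "inj_on \<pi> {1..a + b}" using assms by (auto simp: inj_on_def \<pi>_def split: if_splits)
  have im: "\<pi> ` {1..a + b} \<subseteq> {1..a + b}" using assms by (auto simp: \<pi>_def)
  have "bij_betw \<pi> {1..a + b} {1..a + b}"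
    unfolding bij_betw_def using inj endo_inj_surj[OF _ im inj] by simp
  then have perm: "\<pi> permutes {1..a + b}"
    by (rule bij_imp_permutes) (use assms in \<open>auto simp: \<pi>_def\<close>)
  then have p: "permutation \<pi>" using permutation_permutes by auto
  have up1: "x \<in> orbit \<pi> 1" if "1 \<le> x" "x \<le> a" for x
    using that
  proof (induction x rule: nat_induct_at_least)
    case base
    show ?case by (rule permutation_self_in_orbit[OF p])
  next
    case (Suc x)
    then have "\<pi> x \<in> orbit \<pi> 1" by (intro orbit.step) simp
    moreover have "\<pi> x = Suc x" using Suc assms by (auto simp: \<pi>_def)
    ultimately show ?case by simp
  qed
  have up2: "x \<in> orbit \<pi> (a + 1)" if "a + 1 \<le> x" "x \<le> a + b" for x
    using that
  proof (induction x rule: nat_induct_at_least)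
    case base
    show ?case by (rule permutation_self_in_orbit[OF p])
  next
    case (Suc x)
    then have "\<pi> x \<in> orbit \<pi> (a + 1)" by (intro orbit.step) simp
    moreover have "\<pi> x = Suc x" using Suc assms by (auto simp: \<pi>_def)
    ultimately show ?case by simp
  qed
  have o1: "orbit \<pi> 1 = {1..a}"
  proof
    show "orbit \<pi> 1 \<subseteq> {1..a}"
      by (rule orbit_subset_closed) (use assms in \<open>auto simp: \<pi>_def\<close>)
  qed (use up1 in auto)
  have o2: "orbit \<pi> (a + 1) = {a + 1..a + b}"
  proof
    show "orbit \<pi> (a + 1) \<subseteq> {a + 1..a + b}"
      by (rule orbit_subset_closed) (use assms in \<open>auto simp: \<pi>_def\<close>)
  qed (use up2 in auto)
  have c: "cyclic_on \<pi> {1..a}" "cyclic_on \<pi> {a + 1..a + b}"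
    using cyclic_on_orbit'[OF p] o1 o2 by metis+
  have "orbit \<pi> x \<in> {{1..a}, {a + 1..a + b}}" if "x \<in> {1..a + b}" for x
    using that orbit_cyclic_eq3[OF c(1), of x] orbit_cyclic_eq3[OF c(2), of x] by (cases "x \<le> a") auto
  moreover have "{1..a} \<in> orbit \<pi> ` {1..a + b}" "{a + 1..a + b} \<in> orbit \<pi> ` {1..a + b}"
    unfolding o1[symmetric] o2[symmetric] using assms by auto
  ultimately have "orbit \<pi> ` {1..a + b} = {{1..a}, {a + 1..a + b}}" by blast
  moreover have "{1..a} \<noteq> {a + 1..a + b}" using assms by (auto simp: set_eq_iff)
  ultimately have "cycle_type (a + b) \<pi> = {#a, b#}"
    by (simp add: cycle_type_def)
  then show ?thesis using perm by blast
qed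

lemma cycle_type_pair_orbits:
  assumes "cycle_type n \<pi> = {#a, b#}"
  obtains C D where "orbit \<pi> ` {1..n} = {C, D}" "C \<noteq> D" "card C = a" "card D = b"
proof -
  have im: "image_mset card (mset_set (orbit \<pi> ` {1..n})) = add_mset a {#b#}"
    using assms by (simp add: cycle_type_def)
  obtain C M where 1: "mset_set (orbit \<pi> ` {1..n}) = add_mset C M" "card C = a" "image_mset card M = {#b#}"
    using msed_map_invR[OF im] by auto
  obtain D where D: "M = {#D#}" "card D = b" using msed_map_invR[OF 1(3)] by auto
  have "orbit \<pi> ` {1..n} = {C, D}"
    using arg_cong[OF 1(1), of set_mset] D by (simp add: cycle_type_orbits)
  \<comment> \<open>For \<open>a = b\<close> the lengths do not separate the cycles, but the
    multiset of orbits comes from a set and has no repetitions.\<close>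
  moreover have "C \<noteq> D"
  proof
    assume "C = D"
    then have "count (mset_set (orbit \<pi> ` {1..n})) C = 2" using 1(1) D by simp
    then show False by (simp add: count_mset_set' split: if_splits)
  qed
  ultimately show ?thesis using that 1 D by simp
qed

section \<open>Comparison of the coefficients of both series\<close>

section \<open>The main theorem\<close>

abbreviation qcoeff :: "nat \<Rightarrow> ((nat \<Rightarrow>\<^sub>0 nat) \<Rightarrow>\<^sub>0 rat)" where
  "qcoeff k \<equiv> Poly_Mapping.single (Poly_Mapping.single k 1) 1"

lemma sum_single_lookup: "(\<Sum>k\<in>Poly_Mapping.keys i. Poly_Mapping.single k (Poly_Mapping.lookup i k)) = i"
proof (rule poly_mapping_eqI)
  fix j
  show "Poly_Mapping.lookup (\<Sum>k\<in>Poly_Mapping.keys i. Poly_Mapping.single k (Poly_Mapping.lookup i k)) j = Poly_Mapping.lookup i j"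
    by (cases "j \<in> Poly_Mapping.keys i") (simp_all add: lookup_sum lookup_single when_def in_keys_iff)
qed

lemma qmonom_eq: "qmonom i = [:Poly_Mapping.single i 1:]"
proof -
  have pw: "qvar k ^ m = [:Poly_Mapping.single (Poly_Mapping.single k m) 1:]" for k m
  proof (induction m)
    case 0
    show ?case by (simp add: single_one one_pCons)
  next
    case (Suc m)
    then show ?case by (simp add: qvar_def mult_single single_add[symmetric])
  qed
  have pr: "(\<Prod>k\<in>A. [:Poly_Mapping.single (f k) (1 :: rat):]) = [:Poly_Mapping.single (\<Sum>k\<in>A. f k) 1:]"
    if "finite A" for A and f :: "nat \<Rightarrow> nat \<Rightarrow>\<^sub>0 nat"
    using that
  proof (induction A rule: finite_induct)
    case empty
    show ?case by (simp add: single_one one_pCons)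
  next
    case (insert x A)
    then show ?case by (simp add: mult_single add.commute)
  qed
  show ?thesis unfolding qmonom_def pw by (simp only: pr[OF finite_keys] sum_single_lookup)
qed

lemma coeff_const_mult_uvar_power:
  "coeff (scalar c * qmonom i * uvar ^ m) r = (if m = r then Poly_Mapping.single i c else 0)"
proof -
  have "scalar c * qmonom i * uvar ^ m = monom (Poly_Mapping.single i c) m"
    by (simp add: scalar_def qmonom_eq mult_single uvar_def monom_altdef)
  then show ?thesis by simp
qed

lemma of_nat_mult_single:
  "of_nat m * Poly_Mapping.single i (c :: rat) = Poly_Mapping.single i (of_nat m * c)" for i :: "nat \<Rightarrow>\<^sub>0 nat"
proof -
  have "(of_nat m :: (nat \<Rightarrow>\<^sub>0 nat) \<Rightarrow>\<^sub>0 rat) = Poly_Mapping.single 0 (of_nat m)"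
    by (induction m) (simp_all add: single_add single_one)
  then have "of_nat m * Poly_Mapping.single i c = Poly_Mapping.single 0 (of_nat m) * Poly_Mapping.single i c"
    by (rule arg_cong)
  also have "\<dots> = Poly_Mapping.single i (of_nat m * c)" unfolding mult_single by simp
  finally show ?thesis .
qed

lemma facs_sum_closed_form:
  assumes tree: "tree_equation w" and \<pi>: "\<pi> permutes {1..n}" and ct: "cycle_type n \<pi> = {#a, b#}"
  shows "(\<Sum>F\<in>facs {1..n} r {{1..n}} \<pi>. wt qcoeff F) = fact r * coeff (cycle_pair_series w a b) r"
proof -
  obtain C D where CD: "orbit \<pi> ` {1..n} = {C, D}" "C \<noteq> D" and c: "card C = a" "card D = b"
    using cycle_type_pair_orbits[OF ct] by blast
  have q: "[:qcoeff k:] = qvar k" for k by (simp add: qvar_def)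
  show ?thesis
    unfolding c[symmetric]
  proof (rule facs_sum_two_cycles[where W = w and Y = "\<lambda>n k. (euler w * w ^ (k - 1)) $ n"])
    show "w $ 0 = 0" by (rule w0[OF tree])
    show "cycle_pair_series w 0 b = 0" for b by (simp add: cycle_pair_series_def[OF tree])
    show "cycle_pair_series w a b = cycle_pair_series w b a" for a b
      by (simp add: cycle_pair_series_def[OF tree] closed_form_sym[OF tree, of b a] mult.commute)
    show "pderiv (w $ n) = (\<Sum>k=2..n. [:qcoeff k:] * (euler w * w ^ (k - 1)) $ n)" for n
      unfolding q by (rule w_ode[OF tree])
    show "of_nat k * (euler w * w ^ (k - 1)) $ n = of_nat n * (w ^ k) $ n" for n k
      by (rule euler_w_power[OF tree])
    show "pderiv (cycle_pair_series w a b) =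
        of_nat a * (\<Sum>k=2..a. [:qcoeff k:] * (Abs_fps (\<lambda>g. cycle_pair_series w g b) * w ^ (k - 1)) $ a)
      + of_nat b * (\<Sum>k=2..b. [:qcoeff k:] * (Abs_fps (\<lambda>g. cycle_pair_series w g a) * w ^ (k - 1)) $ b)
      + of_nat a * of_nat b * (\<Sum>i=1..a. \<Sum>j=1..b. [:qcoeff (i + j):] * glued_coeff w a b i j)" for a b
      unfolding q by (rule cycle_pair_series_ode[OF tree])
    show "coeff (w $ n) 0 = (if n = 1 then 1 else 0)" for n by (rule coeff_w_0[OF tree])
    show "coeff (cycle_pair_series w a b) 0 = 0" for a b
      by (simp add: cycle_pair_series_def[OF tree] coeff_mult coeff_closed_form_0[OF tree])
  qed (use \<pi> CD in simp_all)
qed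

text \<open>The coefficients of u^r are compared after multiplication by a b r!, which clears the
  denominators of \<open>Psi2\<close>. One side becomes the sum of \<open>H\<close> times the
  monomial over the indices with r factors; grouping lists by their index turns it into the weighted
  sum over all lists of length r.\<close>

lemma Psi2_nth:
  assumes tree: "tree_equation w" and a: "1 \<le> a" and b: "1 \<le> b"
  shows "Psi2 $ b $ a = closed_form w $ b $ a"
proof (rule poly_eqI)
  fix r
  define n where "n = a + b"
  define \<pi> where "\<pi> = (SOME \<pi>. \<pi> permutes {1..n} \<and> cycle_type n \<pi> = mset [a, b])"
  have \<pi>: "\<pi> permutes {1..n}" "cycle_type n \<pi> = {#a, b#}"
    using someI_ex[OF exists_cycle_type_pair[OF a b]] unfolding \<pi>_def n_def by simp_all
  have n: "0 < n" using a by (simp add: n_def)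
  define Fr where "Fr = (\<lambda>r. facs {1..n} r {{1..n}} \<pi>)"
  have H: "H [a, b] i = card {F \<in> Fr (num_factors i). index_of F = i}" if "is_cycle_index i" for i
  proof -
    have "H [a, b] i = card (cycle_factorizations_of n \<pi> i)" unfolding H_def \<pi>_def n_def by simp
    then show ?thesis by (simp only: cycle_factorizations_of_eq[OF n that] Fr_def)
  qed
  define J where "J = index_of ` Fr r"
  have finF: "finite (Fr r)" unfolding Fr_def by (rule finite_facs) simp
  have J: "is_cycle_index i" "num_factors i = r" if "i \<in> J" for i
    using that index_of_is_cycle_index unfolding J_def Fr_def by blast+
  have notJ: "H [a, b] i = 0" if "is_cycle_index i" "num_factors i = r" "i \<notin> J" for i
  proof -
    have e: "{F \<in> Fr (num_factors i). index_of F = i} = {}" using that by (auto simp: J_def)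
    show ?thesis unfolding H[OF that(1)] e by simp
  qed
  \<comment> \<open>The support of \<open>H\<close> also contains indices with other numbers of
    factors. The union with \<open>J\<close> is finite and contains both index sets, so the sums can
    be compared inside it.\<close>
  define I where "I = {i. is_cycle_index i \<and> H [a, b] i \<noteq> 0} \<union> J"
  have finI: "finite I" unfolding I_def J_def using finite_H_support finF by simp
  have I: "is_cycle_index i" if "i \<in> I" for i using that J by (auto simp: I_def)
  define c where "c = (\<lambda>i. of_nat (H [a, b] i) / (of_nat a * of_nat b * fact (num_factors i)) :: rat)"
  define g where "g = (\<lambda>i. if is_cycle_index i then scalar (c i) * qmonom i * uvar ^ num_factors i else 0)"
  have "Psi2 $ b $ a = Sum_any g" unfolding Psi2_def g_def c_def using a b by simp
  also have "\<dots> = (\<Sum>i\<in>I. g i)"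
  proof (rule Sum_any.expand_superset[OF finI])
    have "scalar 0 = 0" by (rule scalar_simps)
    then have gc: "g i = 0" if "c i = 0" for i using that by (simp add: g_def)
    have "g i = 0" if "H [a, b] i = 0" for i by (rule gc) (simp add: c_def that)
    then have "H [a, b] i \<noteq> 0" if "g i \<noteq> 0" for i using that by blast
    moreover have "is_cycle_index i" if "g i \<noteq> 0" for i using that by (auto simp: g_def split: if_splits)
    ultimately show "{i. g i \<noteq> 0} \<subseteq> I" by (auto simp: I_def)
  qed
  finally have "coeff (Psi2 $ b $ a) r = (\<Sum>i\<in>I. coeff (g i) r)" by (simp add: coeff_sum)
  also have "\<dots> = (\<Sum>i\<in>I. if num_factors i = r then Poly_Mapping.single i (c i) else 0)"
    by (rule sum.cong) (use I in \<open>auto simp: g_def coeff_const_mult_uvar_power\<close>)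
  also have "\<dots> = (\<Sum>i\<in>J. if num_factors i = r then Poly_Mapping.single i (c i) else 0)"
  proof (rule sum.mono_neutral_right[OF finI])
    show "\<forall>i\<in>I - J. (if num_factors i = r then Poly_Mapping.single i (c i) else 0) = 0"
    proof
      fix i assume i: "i \<in> I - J"
      then have "c i = 0" if "num_factors i = r" using notJ[of i] I that by (simp add: c_def)
      then show "(if num_factors i = r then Poly_Mapping.single i (c i) else 0) = 0" by simp
    qed
  qed (simp add: I_def)
  also have "\<dots> = (\<Sum>i\<in>J. Poly_Mapping.single i (c i))"
    by (rule sum.cong) (simp_all add: J)
  finally have 1: "coeff (Psi2 $ b $ a) r = (\<Sum>i\<in>J. Poly_Mapping.single i (c i))" .
  have "of_nat (a * b * fact r) * coeff (Psi2 $ b $ a) r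
      = (\<Sum>i\<in>J. of_nat (H [a, b] i) * Poly_Mapping.single i 1)"
    unfolding 1 sum_distrib_left
  proof (rule sum.cong[OF refl])
    fix i assume "i \<in> J"
    then have "of_nat (a * b * fact r) * c i = of_nat (H [a, b] i)"
      using a b J(2)[of i] by (simp add: c_def)
    then show "of_nat (a * b * fact r) * Poly_Mapping.single i (c i) = of_nat (H [a, b] i) * Poly_Mapping.single i 1"
      by (simp only: of_nat_mult_single mult_1_right)
  qed
  also have "\<dots> = (\<Sum>i\<in>J. \<Sum>F | F \<in> Fr r \<and> index_of F = i. wt qcoeff F)"
  proof (rule sum.cong[OF refl])
    fix i assume i: "i \<in> J"
    have "(\<Sum>F | F \<in> Fr r \<and> index_of F = i. wt qcoeff F) = (\<Sum>F | F \<in> Fr r \<and> index_of F = i. Poly_Mapping.single i (1 :: rat))"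
      by (rule sum.cong[OF refl]) (simp only: wt_eq_single mem_Collect_eq)
    then show "of_nat (H [a, b] i) * Poly_Mapping.single i 1 = (\<Sum>F | F \<in> Fr r \<and> index_of F = i. wt qcoeff F)"
      using H[OF J(1)[OF i]] J(2)[OF i] by simp
  qed
  also have "\<dots> = (\<Sum>F\<in>Fr r. wt qcoeff F)"
    unfolding J_def by (rule sum.image_gen[OF finF, symmetric])
  also have "\<dots> = fact r * coeff (cycle_pair_series w a b) r"
    unfolding Fr_def by (rule facs_sum_closed_form[OF tree \<pi>])
  also have "\<dots> = of_nat (a * b * fact r) * coeff (closed_form w $ b $ a) r"
    by (simp add: cycle_pair_series_def[OF tree] of_nat_poly mult_ac)
  finally have "of_nat (a * b * fact r) * coeff (Psi2 $ b $ a) r = of_nat (a * b * fact r) * coeff (closed_form w $ b $ a) r" .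
  moreover have "(of_nat (a * b * fact r) :: (nat \<Rightarrow>\<^sub>0 nat) \<Rightarrow>\<^sub>0 rat) \<noteq> 0"
    unfolding of_nat_eq_0_iff using a b by simp
  ultimately show "coeff (Psi2 $ b $ a) r = coeff (closed_form w $ b $ a) r"
    by (simp only: mult_cancel_left simp_thms)
qed

theorem theorem1p1:
  shows "(\<exists>!w. tree_equation w) \<and>
    (\<forall>w. tree_equation w \<longrightarrow>
      (let w1 = at_x1 w; w2 = at_x2 w;
           Qw1 = at_x1 (Qser oo w); Qw2 = at_x2 (Qser oo w)
       in Psi2 = series_log (exact_quot (w1 - w2) (x1 - x2))
                 - u2 * exact_quot (w1 * Qw1 - w2 * Qw2) (w1 - w2)))"
proof (intro conjI allI impI)
  show "\<exists>!w. tree_equation w" by (rule ex1_tree_equation)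
  fix w assume tree: "tree_equation w"
  have "Psi2 = closed_form w"
  proof (rule fps2_ext)
    fix b a
    show "Psi2 $ b $ a = closed_form w $ b $ a"
    proof (cases "1 \<le> a \<and> 1 \<le> b")
      case True
      then show ?thesis using Psi2_nth[OF tree] by simp
    next
      \<comment> \<open>A zero exponent: \<open>Psi2\<close> has no such term by definition.\<close>
      case False
      then have "a = 0 \<or> b = 0" by auto
      then show ?thesis using closed_form_boundary[OF tree] by (auto simp: Psi2_def)
    qed
  qed
  then show "let w1 = at_x1 w; w2 = at_x2 w;
           Qw1 = at_x1 (Qser oo w); Qw2 = at_x2 (Qser oo w)
       in Psi2 = series_log (exact_quot (w1 - w2) (x1 - x2))
                 - u2 * exact_quot (w1 * Qw1 - w2 * Qw2) (w1 - w2)"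
    unfolding Let_def closed_form_eq[OF tree] .
qed

end
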